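(* Let $G$ be a graph with maximum degree $\Delta(G) \le 4$ and let $\lambda \ge 2$ be an integer. Then: (a) if $M$ is a matching in $G$ (viewed as a spanning subgraph), then $BBC_\lambda(G, M) \le 2\lambda + 1$; (b) if $H$ is a $1$-degenerate spanning subgraph of $G$, then $BBC_\lambda(G, H) \le 2\lambda + 2$. The respective colorings (a $\lambda$-backbone $(2\lambda+1)$-coloring in (a), a $\lambda$-backbone $(2\lambda+2)$-coloring in (b)) can be found in $\mathcal{O}(n)$ time, where $n = |V(G)|$.
   Context: A graph is $d$-degenerate if every induced subgraph of it contains a vertex of degree at most $d$. For an integer $\lambda \ge 2$, a graph $G$ and a spanning subgraph $H$ of $G$ (the backbone; $E(H) \subseteq E(G)$), a $\lambda$-backbone coloring of $G$ with backbone $H$ is a function $c\colon V(G) \to \mathbb{N}_+$ with $c(u) \ne c(v)$ for every $\{u,v\} \in E(G)$ and $|c(u) - c(v)| \ge \lambda$ for every $\{u,v\} \in E(H)$; it is a $\lambda$-backbone $k$-coloring if all colors lie in $\{1,\ldots,k\}$. $BBC_\lambda(G,H)$ is the smallest $k$ for which a $\lambda$-backbone $k$-coloring exists. *)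

theory Defs
  imports Complex_Main "HOL-Library.Landau_Symbols" "HOL-Library.Disjoint_Sets"
begin

record 'a ugraph =
  verts :: "'a set"
  edges :: "'a set set"

definition simple_graph :: "'a ugraph \<Rightarrow> bool" where
  "simple_graph G \<longleftrightarrow> finite (verts G) \<and> (\<forall>e\<in>edges G. e \<subseteq> verts G \<and> card e = 2)"

definition degree :: "'a ugraph \<Rightarrow> 'a \<Rightarrow> nat" where
  "degree G v = card {e \<in> edges G. v \<in> e}"

text \<open>The inserted \<open>0\<close> only matters for the graph without vertices.\<close>

definition max_degree :: "'a ugraph \<Rightarrow> nat" where
  "max_degree G = Max (insert 0 (degree G ` verts G))"

definition induced_subgraph :: "'a ugraph \<Rightarrow> 'a set \<Rightarrow> 'a ugraph" where
  "induced_subgraph G S = \<lparr>verts = S, edges = {e \<in> edges G. e \<subseteq> S}\<rparr>"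

definition degenerate :: "nat \<Rightarrow> 'a ugraph \<Rightarrow> bool" where
  "degenerate d G \<longleftrightarrow>
     (\<forall>S. S \<subseteq> verts G \<and> S \<noteq> {} \<longrightarrow> (\<exists>v\<in>S. degree (induced_subgraph G S) v \<le> d))"

definition spanning_subgraph :: "'a ugraph \<Rightarrow> 'a ugraph \<Rightarrow> bool" where
  "spanning_subgraph H G \<longleftrightarrow> verts H = verts G \<and> edges H \<subseteq> edges G"

definition matching :: "'a ugraph \<Rightarrow> 'a set set \<Rightarrow> bool" where
  "matching G M \<longleftrightarrow> M \<subseteq> edges G \<and> pairwise disjnt M"

definition spanned_by :: "'a ugraph \<Rightarrow> 'a set set \<Rightarrow> 'a ugraph" where
  "spanned_by G M = \<lparr>verts = verts G, edges = M\<rparr>"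

definition backbone_coloring :: "nat \<Rightarrow> 'a ugraph \<Rightarrow> 'a ugraph \<Rightarrow> ('a \<Rightarrow> nat) \<Rightarrow> bool" where
  "backbone_coloring lam G H c \<longleftrightarrow>
     (\<forall>v\<in>verts G. 1 \<le> c v) \<and>
     (\<forall>u v. {u, v} \<in> edges G \<longrightarrow> c u \<noteq> c v) \<and>
     (\<forall>u v. {u, v} \<in> edges H \<longrightarrow> int lam \<le> \<bar>int (c u) - int (c v)\<bar>)"

definition backbone_k_coloring ::
    "nat \<Rightarrow> nat \<Rightarrow> 'a ugraph \<Rightarrow> 'a ugraph \<Rightarrow> ('a \<Rightarrow> nat) \<Rightarrow> bool" where
  "backbone_k_coloring lam k G H c \<longleftrightarrow>
     backbone_coloring lam G H c \<and> (\<forall>v\<in>verts G. c v \<in> {1..k})"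

definition BBC :: "nat \<Rightarrow> 'a ugraph \<Rightarrow> 'a ugraph \<Rightarrow> nat" where
  "BBC lam G H = (LEAST k. \<exists>c. backbone_k_coloring lam k G H c)"

text \<open>
  Running time is measured on a uniform-cost random access machine, presented as a structured
  while language. The memory consists of arrays of natural numbers; a program names its arrays
  by literals, so it uses only finitely many of them, while indices are computed. The only
  arithmetic operations are addition and truncated subtraction, and every node of an evaluated
  expression and every executed command other than sequencing costs one time unit. In
  conditionals and loops a test succeeds iff its value is nonzero.
\<close>

type_synonym store = "nat \<Rightarrow> nat \<Rightarrow> nat"

datatype aexp = Const nat | Cell nat aexp | Add aexp aexp | Sub aexp aexp

fun aval :: "aexp \<Rightarrow> store \<Rightarrow> nat" where
  "aval (Const k) s = k"
| "aval (Cell a i) s = s a (aval i s)"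
| "aval (Add x y) s = aval x s + aval y s"
| "aval (Sub x y) s = aval x s - aval y s"

fun acost :: "aexp \<Rightarrow> nat" where
  "acost (Const k) = 1"
| "acost (Cell a i) = 1 + acost i"
| "acost (Add x y) = 1 + acost x + acost y"
| "acost (Sub x y) = 1 + acost x + acost y"

datatype com =
    Skip
  | Assign nat aexp aexp
  | Seq com com
  | Cond aexp com com
  | Loop aexp com

text \<open>\<open>exec p s t s'\<close>: started in \<open>s\<close>, the program \<open>p\<close> halts in \<open>s'\<close> after \<open>t\<close> time units.\<close>

inductive exec :: "com \<Rightarrow> store \<Rightarrow> nat \<Rightarrow> store \<Rightarrow> bool" where
  exec_Skip: "exec Skip s 1 s"
| exec_Assign:
    "exec (Assign a i x) s (1 + acost i + acost x) (s(a := (s a)(aval i s := aval x s)))"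
| exec_Seq:
    "exec p s t s' \<Longrightarrow> exec q s' t' s'' \<Longrightarrow> exec (Seq p q) s (t + t') s''"
| exec_CondTrue:
    "aval b s \<noteq> 0 \<Longrightarrow> exec p s t s' \<Longrightarrow> exec (Cond b p q) s (1 + acost b + t) s'"
| exec_CondFalse:
    "aval b s = 0 \<Longrightarrow> exec q s t s' \<Longrightarrow> exec (Cond b p q) s (1 + acost b + t) s'"
| exec_LoopFalse:
    "aval b s = 0 \<Longrightarrow> exec (Loop b p) s (1 + acost b) s"
| exec_LoopTrue:
    "aval b s \<noteq> 0 \<Longrightarrow> exec p s t s' \<Longrightarrow> exec (Loop b p) s' t' s'' \<Longrightarrow>
     exec (Loop b p) s (1 + acost b + t + t') s''"

inductive_cases exec_SkipE: "exec Skip s t s'"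
inductive_cases exec_AssignE: "exec (Assign a i x) s t s'"
inductive_cases exec_SeqE: "exec (Seq p q) s t s'"
inductive_cases exec_CondE: "exec (Cond b p q) s t s'"
inductive_cases exec_LoopE: "exec (Loop b p) s t s'"

lemma exec_deterministic:
  "exec p s t s' \<Longrightarrow> exec p s u r \<Longrightarrow> t = u \<and> s' = r"
proof (induction arbitrary: u r rule: exec.induct)
  case (exec_Skip s)
  then show ?case by (auto elim: exec_SkipE)
next
  case (exec_Assign a i x s)
  then show ?case by (auto elim: exec_AssignE)
next
  case (exec_Seq p s t s' q t' s'')
  from exec_Seq.prems obtain t1 r1 t2
    where "exec p s t1 r1" "exec q r1 t2 r" "u = t1 + t2" by (rule exec_SeqE)
  with exec_Seq.IH show ?case by metis
next
  case (exec_CondTrue b s p t s' q)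
  from exec_CondTrue.prems exec_CondTrue.hyps(1) obtain t1
    where "exec p s t1 r" "u = 1 + acost b + t1" by (auto elim: exec_CondE)
  with exec_CondTrue.IH show ?case by metis
next
  case (exec_CondFalse b s q t s' p)
  from exec_CondFalse.prems exec_CondFalse.hyps(1) obtain t1
    where "exec q s t1 r" "u = 1 + acost b + t1" by (auto elim: exec_CondE)
  with exec_CondFalse.IH show ?case by metis
next
  case (exec_LoopFalse b s p)
  then show ?case by (auto elim: exec_LoopE)
next
  case (exec_LoopTrue b s p t s' t' s'')
  from exec_LoopTrue.prems obtain t1 r1 t2
    where "exec p s t1 r1" "exec (Loop b p) r1 t2 r" "u = 1 + acost b + t1 + t2"
    by (rule exec_LoopE) (use exec_LoopTrue.hyps(1) in auto)
  with exec_LoopTrue.IH show ?case by metis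
qed

definition adjacency_lists :: "nat ugraph \<Rightarrow> nat list list \<Rightarrow> bool" where
  "adjacency_lists G adj \<longleftrightarrow>
     verts G = {..<length adj} \<and>
     (\<forall>v<length adj. distinct (adj ! v) \<and> set (adj ! v) = {u. {v, u} \<in> edges G})"

definition array_of :: "nat list \<Rightarrow> nat \<Rightarrow> nat" where
  "array_of xs i = (if i < length xs then xs ! i else 0)"

text \<open>
  Adjacency lists are stored consecutively in one array; the list of vertex \<open>v\<close> occupies the
  positions from \<open>offsets adj ! v\<close> (inclusive) to \<open>offsets adj ! (v + 1)\<close> (exclusive).
\<close>

definition offsets :: "nat list list \<Rightarrow> nat list" where
  "offsets adj = map (\<lambda>v. length (concat (take v adj))) [0..<length adj + 1]"

definition input_store :: "nat \<Rightarrow> nat list list \<Rightarrow> nat list list \<Rightarrow> store" where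
  "input_store lam adjG adjH =
     (\<lambda>_ _. 0)
       (0 := array_of [length adjG, lam],
        1 := array_of (offsets adjG),
        2 := array_of (concat adjG),
        3 := array_of (offsets adjH),
        4 := array_of (concat adjH))"

text \<open>
  On every presentation of \<open>G\<close> and \<open>H\<close> by adjacency lists, \<open>p\<close> halts within \<open>T n\<close> time units,
  where \<open>n\<close> is the number of vertices, leaving in array \<open>5\<close> (indexed by the vertices) a
  backbone coloring with at most \<open>k\<close> colors.
\<close>

definition finds_coloring_in_time ::
    "com \<Rightarrow> (nat \<Rightarrow> nat) \<Rightarrow> nat \<Rightarrow> nat \<Rightarrow> nat ugraph \<Rightarrow> nat ugraph \<Rightarrow> bool" where
  "finds_coloring_in_time p T lam k G H \<longleftrightarrow>
     (\<forall>adjG adjH. adjacency_lists G adjG \<and> adjacency_lists H adjH \<longrightarrow>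
        (\<exists>t s. exec p (input_store lam adjG adjH) t s \<and> t \<le> T (card (verts G)) \<and>
               backbone_k_coloring lam k G H (s 5)))"

end

theory Submission imports Defs begin

text \<open>
  The color map sending 1, 2, 3, 4, 5, 6 to 1, 2, $\lambda+1$, $\lambda+2$, $2\lambda+1$, $2\lambda+2$
  turns distance at least 2 into distance at least $\lambda$, so it suffices to treat $\lambda = 2$, with
  five colors for a matching and six for a forest.

  Colors are assigned in two passes. First the vertices are eliminated one after the other: if \<open>a\<close> is
  the least color left in the list of \<open>v\<close>, then \<open>v\<close> deletes \<open>a\<close> from the lists of its remaining
  ordinary neighbors and \<open>a + 1\<close> from the list of its remaining backbone neighbor \<open>p\<close>, of which there
  is at most one. In the second pass the vertices are colored in reverse order from their lists.
  Then \<open>v\<close> may take \<open>a\<close>, unless \<open>p\<close> has color \<open>a - 1\<close> or \<open>a\<close> and so excludes at most the colors \<open>a\<close> and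
  \<open>a + 1\<close> from the list of \<open>v\<close>; hence a list with three colors more than \<open>v\<close> has remaining ordinary
  neighbors is long enough. With six colors and degree at most four, each vertex deletes only one
  color per neighbor, and eliminating leaves of the forest keeps all lists long enough.

  With five colors the lists are shorter by one, and \<open>v\<close> deletes \<open>a\<close> from the list of \<open>p\<close> too, unless
  \<open>a + 1\<close> is missing in its own list. This is affordable if the second endpoint of every matching edge
  has degree at most three or still has a remaining neighbor when it is eliminated, as is the case
  for the reverse of a graph search started at all unmatched vertices and all vertices of degree at most
  three. A component without such vertices is 4-regular and perfectly matched. Number it by a search
  that discovers matched pairs together, let \<open>u\<close> be the last vertex with a later neighbor \<open>x\<close> other
  than its partner, and let \<open>y\<close> be the partner of \<open>x\<close>. Removing \<open>x\<close>, \<open>y\<close> and \<open>u\<close> leaves the component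
  connected. Color \<open>x\<close> and \<open>y\<close> with 2 and 4 and eliminate \<open>u\<close> first: as its list contains 1 but not 2,
  the partner of \<open>u\<close> loses only the color 2 and can serve as the start of a search of the rest.
\<close>

section \<open>Splittings of lists\<close>

definition at_splits :: "('a list \<Rightarrow> 'a \<Rightarrow> 'a list \<Rightarrow> bool) \<Rightarrow> 'a list \<Rightarrow> bool" where
  "at_splits P xs \<longleftrightarrow> (\<forall>ps x es. xs = ps @ x # es \<longrightarrow> P ps x es)"

lemma at_splitsD: "at_splits P (ps @ x # es) \<Longrightarrow> P ps x es"
  by (simp add: at_splits_def)

lemma at_splits_mono:
  "at_splits P xs \<Longrightarrow> (\<And>ps x es. xs = ps @ x # es \<Longrightarrow> P ps x es \<Longrightarrow> Q ps x es) \<Longrightarrow> at_splits Q xs"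
  by (simp add: at_splits_def)

lemma at_splits_Nil [simp]: "at_splits P []"
  by (simp add: at_splits_def)

lemma at_splits_Cons [simp]: "at_splits P (x # xs) \<longleftrightarrow> P [] x xs \<and> at_splits (\<lambda>ps. P (x # ps)) xs"
  by (force simp: at_splits_def Cons_eq_append_conv)

lemma at_splits_append [simp]:
  "at_splits P (xs @ ys) \<longleftrightarrow>
     at_splits (\<lambda>ps x es. P ps x (es @ ys)) xs \<and> at_splits (\<lambda>ps. P (xs @ ps)) ys"
  by (induction xs arbitrary: P) auto

section \<open>Neighborhoods\<close>

definition neighbors :: "'a ugraph \<Rightarrow> 'a \<Rightarrow> 'a set" where
  "neighbors G v = {u. {v, u} \<in> edges G}"

lemma neighbors_sym: "w \<in> neighbors G v \<longleftrightarrow> v \<in> neighbors G w"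
  by (simp add: neighbors_def insert_commute)

lemma neighbors_image: "(\<lambda>u. {v, u}) ` neighbors G v \<subseteq> {e \<in> edges G. v \<in> e}"
  by (auto simp: neighbors_def)

lemma inj_on_doubleton: "inj_on (\<lambda>u. {v, u}) A"
  by (auto simp: inj_on_def doubleton_eq_iff)

lemma finite_neighbors: "finite (edges G) \<Longrightarrow> finite (neighbors G v)"
  by (rule finite_imageD[OF finite_subset[OF neighbors_image] inj_on_doubleton]) simp

lemma card_neighbors_le_degree:
  assumes "finite (edges G)"
  shows "card (neighbors G v) \<le> degree G v"
proof -
  have "card (neighbors G v) = card ((\<lambda>u. {v, u}) ` neighbors G v)"
    by (simp add: card_image inj_on_doubleton)
  also have "\<dots> \<le> degree G v"
    unfolding degree_def using assms by (intro card_mono[OF _ neighbors_image]) simp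
  finally show ?thesis .
qed

lemma simple_graph_finite_edges:
  assumes "simple_graph G"
  shows "finite (edges G)"
proof (rule finite_subset)
  show "edges G \<subseteq> Pow (verts G)" using assms by (auto simp: simple_graph_def)
  show "finite (Pow (verts G))" using assms by (simp add: simple_graph_def)
qed

lemma simple_graph_neighborsD:
  assumes "simple_graph G" "w \<in> neighbors G v"
  shows "v \<in> verts G" "w \<in> verts G" "w \<noteq> v"
  using assms by (force simp: simple_graph_def neighbors_def)+

lemma degree_le_max_degree: "finite (verts G) \<Longrightarrow> v \<in> verts G \<Longrightarrow> degree G v \<le> max_degree G"
  unfolding max_degree_def by (intro Max_ge) auto

lemma card_neighbors_le_max_degree:
  assumes "simple_graph G"
  shows "card (neighbors G v) \<le> max_degree G"
proof (cases "neighbors G v = {}")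
  case False
  then have "v \<in> verts G" using simple_graph_neighborsD[OF assms] by blast
  then show ?thesis
    using card_neighbors_le_degree[OF simple_graph_finite_edges[OF assms]] degree_le_max_degree assms
    by (meson le_trans simple_graph_def)
qed simp

section \<open>List coloring in two passes\<close>

definition conflict :: "bool \<Rightarrow> nat \<Rightarrow> nat \<Rightarrow> bool" where
  "conflict h c d \<longleftrightarrow> c = d \<or> h \<and> (c = d + 1 \<or> d = c + 1)"

lemma conflict_commute: "conflict h c d \<longleftrightarrow> conflict h d c"
  by (auto simp: conflict_def)

lemma free_color_exists:
  assumes L: "finite L" "a \<in> L" "\<forall>c\<in>L. a \<le> c" and F: "finite F" "a \<notin> F" "card F + 2 \<le> card L"
    and d: "d \<noteq> a + 1" "d = a \<Longrightarrow> a + 1 \<notin> L \<or> card F + 3 \<le> card L"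
  shows "\<exists>c\<in>L - F. \<not> conflict True c d"
proof (cases "conflict True a d")
  case True
  define Y where "Y = {c \<in> L. conflict True c d}"
  have "Y \<subseteq> (if d = a then L \<inter> {a, a + 1} else {a})"
    using L(3) d(1) True by (fastforce simp: Y_def conflict_def)
  moreover have "card (L \<inter> {a, a + 1}) \<le> card {a, a + 1}" by (intro card_mono) auto
  moreover have "a + 1 \<notin> L \<Longrightarrow> L \<inter> {a, a + 1} = {a}" using L(2) by auto
  ultimately have "card Y + card F < card L"
    using card_mono[of "if d = a then L \<inter> {a, a + 1} else {a}" Y] F(3) d(2)
    by (fastforce split: if_splits)
  then have "card (Y \<union> F) < card L" using card_Un_le[of Y F] by simp
  then have "\<not> L \<subseteq> Y \<union> F"
    using card_mono[of "Y \<union> F" L] L(1) F(1) by (auto simp: Y_def)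
  then show ?thesis by (auto simp: Y_def)
qed (use L F in blast)

locale backbone =
  fixes G H :: "'a ugraph"
  assumes simple: "simple_graph G" and spanning: "spanning_subgraph H G"
begin

abbreviation V :: "'a set" where "V \<equiv> verts G"
abbreviation N :: "'a \<Rightarrow> 'a set" where "N \<equiv> neighbors G"
abbreviation B :: "'a \<Rightarrow> 'a set" where "B \<equiv> neighbors H"

lemma N_D: "w \<in> N v \<Longrightarrow> v \<in> V \<and> w \<in> V \<and> w \<noteq> v \<and> v \<in> N w"
  using simple_graph_neighborsD[OF simple] neighbors_sym by metis

lemma B_subset: "B v \<subseteq> N v"
  using spanning by (auto simp: spanning_subgraph_def neighbors_def)

lemma finite_V: "finite V"
  using simple by (simp add: simple_graph_def)

lemma finite_N [simp]: "finite (N v)"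
  by (rule finite_neighbors[OF simple_graph_finite_edges[OF simple]])

lemma finite_B [simp]: "finite (B v)"
  by (rule finite_subset[OF B_subset finite_N])

text \<open>
  The color \<open>0\<close> means uncolored. The values \<open>a w\<close> and \<open>b w\<close> are the colors that \<open>w\<close> deletes from
  the lists of its neighbors when it is eliminated, and \<open>a w = 0\<close> before that.
\<close>

definition excludes :: "('a \<Rightarrow> nat) \<Rightarrow> ('a \<Rightarrow> nat) \<Rightarrow> ('a \<Rightarrow> nat) \<Rightarrow> 'a \<Rightarrow> 'a \<Rightarrow> nat \<Rightarrow> bool" where
  "excludes col a b v w c \<longleftrightarrow>
     (if col w \<noteq> 0 then conflict (w \<in> B v) c (col w)
      else a w \<noteq> 0 \<and> c \<in> (if w \<in> B v then {a w + 1, b w} else {a w}))"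

definition avail :: "nat \<Rightarrow> ('a \<Rightarrow> nat) \<Rightarrow> ('a \<Rightarrow> nat) \<Rightarrow> ('a \<Rightarrow> nat) \<Rightarrow> 'a \<Rightarrow> nat set" where
  "avail K col a b v = {c \<in> {1..K}. \<forall>w\<in>N v. \<not> excludes col a b v w c}"

lemma finite_avail [simp]: "finite (avail K col a b v)"
  by (simp add: avail_def)

lemma avail_subset: "avail K col a b v \<subseteq> {1..K}"
  by (auto simp: avail_def)

definition least_avail :: "nat \<Rightarrow> ('a \<Rightarrow> nat) \<Rightarrow> ('a \<Rightarrow> nat) \<Rightarrow> ('a \<Rightarrow> nat) \<Rightarrow> 'a \<Rightarrow> nat" where
  "least_avail K col a b v = Min (insert K (avail K col a b v))"

lemma least_avail_le: "c \<in> avail K col a b v \<Longrightarrow> least_avail K col a b v \<le> c"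
  by (simp add: least_avail_def)

lemma least_avail_in:
  assumes "avail K col a b v \<noteq> {}"
  shows "least_avail K col a b v \<in> avail K col a b v"
proof -
  obtain c where c: "c \<in> avail K col a b v" "c \<le> K" using assms avail_subset by fastforce
  have "least_avail K col a b v \<in> insert K (avail K col a b v)"
    unfolding least_avail_def by (rule Min_in) auto
  moreover have "K = c" if "least_avail K col a b v = K" using least_avail_le[OF c(1)] c(2) that by simp
  ultimately show ?thesis using c(1) by auto
qed

lemma least_avail_range: "1 \<le> K \<Longrightarrow> least_avail K col a b v \<in> {1..K}"
  using avail_subset[of K col a b v] by (auto simp: least_avail_def)

fun eliminate :: "nat \<Rightarrow> ('a \<Rightarrow> nat) \<Rightarrow> 'a list \<Rightarrow> ('a \<Rightarrow> nat) \<times> ('a \<Rightarrow> nat)" where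
  "eliminate K col [] = (\<lambda>_. 0, \<lambda>_. 0)"
| "eliminate K col (v # es) =
     (let (a, b) = eliminate K col es; c = least_avail K col a b v
      in (a(v := c), b(v := if 6 \<le> K \<or> (\<exists>w\<in>N v. excludes col a b v w (c + 1)) then c + 1 else c)))"

abbreviation low :: "nat \<Rightarrow> ('a \<Rightarrow> nat) \<Rightarrow> 'a list \<Rightarrow> 'a \<Rightarrow> nat" where
  "low K col es \<equiv> fst (eliminate K col es)"

abbreviation high :: "nat \<Rightarrow> ('a \<Rightarrow> nat) \<Rightarrow> 'a list \<Rightarrow> 'a \<Rightarrow> nat" where
  "high K col es \<equiv> snd (eliminate K col es)"

abbreviation paint_avail :: "nat \<Rightarrow> ('a \<Rightarrow> nat) \<Rightarrow> 'a list \<Rightarrow> ('a \<Rightarrow> nat) \<Rightarrow> 'a \<Rightarrow> nat set" where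
  "paint_avail K col vs col' \<equiv> avail K col' (low K col vs) (high K col vs)"

definition color_list :: "nat \<Rightarrow> ('a \<Rightarrow> nat) \<Rightarrow> 'a list \<Rightarrow> 'a \<Rightarrow> nat set" where
  "color_list K col es = paint_avail K col es col"

lemma low_Cons:
  "low K col (v # es) = (low K col es)(v := least_avail K col (low K col es) (high K col es) v)"
  by (simp add: Let_def split_beta)

lemma high_Cons:
  "high K col (v # es) = (high K col es)(v := (let c = low K col (v # es) v
     in if 6 \<le> K \<or> (\<exists>w\<in>N v. excludes col (low K col es) (high K col es) v w (c + 1)) then c + 1 else c))"
  by (simp add: Let_def split_beta)

declare eliminate.simps(2) [simp del]

lemma low_notin: "v \<notin> set es \<Longrightarrow> low K col es v = 0"
  by (induction es) (auto simp: low_Cons)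

lemma eliminate_append:
  "w \<notin> set xs \<Longrightarrow> low K col (xs @ es) w = low K col es w \<and> high K col (xs @ es) w = high K col es w"
  by (induction xs) (auto simp: low_Cons high_Cons)

lemma low_in: "1 \<le> K \<Longrightarrow> v \<in> set es \<Longrightarrow> low K col es v \<in> {1..K}"
  by (induction es) (use least_avail_range in \<open>auto simp: low_Cons\<close>)

lemma high_six: "6 \<le> K \<Longrightarrow> v \<in> set es \<Longrightarrow> high K col es v = low K col es v + 1"
  by (induction es) (auto simp: low_Cons high_Cons)

text \<open>
  With fewer than six colors \<open>v\<close> deletes its least color \<open>c\<close> from the list of its backbone neighbor,
  unless \<open>c + 1\<close> is missing in its own list. Otherwise it may lose both in the second pass.
\<close>

definition colorable :: "nat \<Rightarrow> ('a \<Rightarrow> nat) \<Rightarrow> 'a list \<Rightarrow> 'a \<Rightarrow> 'a list \<Rightarrow> bool" where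
  "colorable K col ps v es \<longleftrightarrow> color_list K col es v \<noteq> {} \<and>
     (\<forall>p\<in>B v \<inter> set ps. B v \<inter> set ps = {p} \<and>
        card (N v \<inter> set ps) + (if 6 \<le> K then 2 else 1) \<le> card (color_list K col es v))"

definition conflict_free :: "('a \<Rightarrow> nat) \<Rightarrow> bool" where
  "conflict_free col \<longleftrightarrow>
     (\<forall>v. \<forall>w\<in>N v. col v \<noteq> 0 \<and> col w \<noteq> 0 \<longrightarrow> \<not> conflict (w \<in> B v) (col v) (col w))"

definition paint :: "nat \<Rightarrow> ('a \<Rightarrow> nat) \<Rightarrow> ('a \<Rightarrow> nat) \<Rightarrow> ('a \<Rightarrow> nat) \<Rightarrow> 'a list \<Rightarrow> 'a \<Rightarrow> nat" where
  "paint K a b = foldl (\<lambda>col v. col(v := least_avail K col a b v))"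

lemma paint_Nil [simp]: "paint K a b col [] = col"
  by (simp add: paint_def)

lemma paint_snoc:
  "paint K a b col (ps @ [v]) =
     (paint K a b col ps)(v := least_avail K (paint K a b col ps) a b v)"
  unfolding paint_def foldl_append foldl.simps ..

text \<open>
  The coloring \<open>col'\<close> may arise from \<open>col\<close> in the second pass by coloring \<open>ps\<close>, with \<open>qs\<close> yet to
  be colored.
\<close>

definition consistent :: "nat \<Rightarrow> ('a \<Rightarrow> nat) \<Rightarrow> 'a list \<Rightarrow> 'a list \<Rightarrow> ('a \<Rightarrow> nat) \<Rightarrow> bool" where
  "consistent K col qs ps col' \<longleftrightarrow> (\<forall>w. w \<notin> set ps \<longrightarrow> col' w = col w) \<and>
     at_splits (\<lambda>_ v es. col' v \<in> color_list K col (es @ qs) v) ps \<and> conflict_free col'"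

lemma consistent_color_list:
  assumes "consistent K col qs ps col'" "w \<in> set ps"
  obtains xs ys where "ps = xs @ w # ys" "col' w \<in> color_list K col (ys @ qs) w"
  using assms split_list[of w ps] by (auto simp: consistent_def dest: at_splitsD)

lemma consistent_nonzero: "consistent K col qs ps col' \<Longrightarrow> w \<in> set ps \<Longrightarrow> col' w \<noteq> 0"
  using avail_subset by (force simp: color_list_def elim!: consistent_color_list)

lemma avail_consistent:
  assumes vs: "distinct (ps @ v # es)" "set (ps @ v # es) = {v \<in> V. col v = 0}"
    and col': "consistent K col (v # es) ps col'"
  shows "paint_avail K col (ps @ v # es) col' v =
    {c \<in> color_list K col es v. \<forall>w\<in>N v \<inter> set ps. \<not> conflict (w \<in> B v) c (col' w)}"
proof -
  let ?a = "low K col (ps @ v # es)" and ?b = "high K col (ps @ v # es)"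
  have painted: "excludes col' ?a ?b v w c \<longleftrightarrow> conflict (w \<in> B v) c (col' w)"
    "\<not> excludes col (low K col es) (high K col es) v w c" if "w \<in> set ps" for w c
  proof -
    have "col w = 0" "w \<notin> set es" using vs that by auto
    then show "excludes col' ?a ?b v w c \<longleftrightarrow> conflict (w \<in> B v) c (col' w)"
      "\<not> excludes col (low K col es) (high K col es) v w c"
      using consistent_nonzero[OF col' that] low_notin[of w es] by (simp_all add: excludes_def)
  qed
  have "excludes col' ?a ?b v w c \<longleftrightarrow> excludes col (low K col es) (high K col es) v w c"
    if "w \<in> N v" "w \<notin> set ps" for w c
  proof -
    have "col' w = col w" using col' that(2) by (simp add: consistent_def)
    moreover have "?a w = low K col es w" "?b w = high K col es w"
      using eliminate_append[of w "ps @ [v]" K col es] that N_D by auto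
    ultimately show ?thesis by (simp add: excludes_def)
  qed
  with painted show ?thesis unfolding color_list_def avail_def by blast
qed

lemma consistent_avoids_deleted:
  assumes "distinct (ps @ v # es)" "set (ps @ v # es) = {v \<in> V. col v = 0}" "1 \<le> K"
    and "consistent K col (v # es) ps col'" and w: "w \<in> N v \<inter> set ps"
  shows "col' w \<notin> (if w \<in> B v then {low K col (v # es) v + 1, high K col (v # es) v}
    else {low K col (v # es) v})"
proof -
  obtain xs ys where ys: "ps = xs @ w # ys" "col' w \<in> color_list K col (ys @ v # es) w"
    using consistent_color_list assms(4) w by blast
  have "v \<in> N w" "v \<in> B w \<longleftrightarrow> w \<in> B v" using w N_D neighbors_sym[of v H w] by auto
  moreover have "low K col (ys @ v # es) v = low K col (v # es) v"
    "high K col (ys @ v # es) v = high K col (v # es) v"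
    using eliminate_append[of v ys] ys(1) assms(1) by auto
  moreover have "low K col (v # es) v \<noteq> 0" using low_in[OF assms(3), of v "v # es" col] by simp
  moreover have "col v = 0" using assms(2) by auto
  ultimately show ?thesis using ys(2) by (auto simp: color_list_def avail_def excludes_def)
qed

lemma avail_consistent_nonempty:
  assumes vs: "distinct (ps @ v # es)" "set (ps @ v # es) = {v \<in> V. col v = 0}" and K: "1 \<le> K"
    and col': "consistent K col (v # es) ps col'" and v: "colorable K col ps v es"
  shows "paint_avail K col (ps @ v # es) col' v \<noteq> {}"
proof -
  define L where "L = color_list K col es v"
  define a where "a = low K col (v # es) v"
  define b where "b = high K col (v # es) v"
  have L: "finite L" "a \<in> L" "\<forall>c\<in>L. a \<le> c"
    using v least_avail_in least_avail_le
    by (auto simp: colorable_def L_def color_list_def a_def low_Cons)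
  note avoids = consistent_avoids_deleted[OF vs K col', folded a_def b_def]
  have "\<exists>c\<in>L. \<forall>w\<in>N v \<inter> set ps. \<not> conflict (w \<in> B v) c (col' w)"
  proof (cases "B v \<inter> set ps = {}")
    case True
    then have "w \<notin> B v" if "w \<in> N v \<inter> set ps" for w using that by blast
    then have "\<not> conflict (w \<in> B v) a (col' w)" if "w \<in> N v \<inter> set ps" for w
      using avoids[OF that] that by (auto simp: conflict_def)
    then show ?thesis using L(2) by blast
  next
    case False
    then obtain p where p: "B v \<inter> set ps = {p}"
      and c: "card (N v \<inter> set ps) + (if 6 \<le> K then 2 else 1) \<le> card L"
      using v unfolding colorable_def L_def by blast
    from p have pB: "p \<in> B v" and pN: "p \<in> N v \<inter> set ps" using B_subset[of v] by blast+
    define X where "X = N v \<inter> set ps - {p}"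
    have X: "N v \<inter> set ps = insert p X" "p \<notin> X" "finite X" using pN by (auto simp: X_def)
    have ordinary: "w \<notin> B v" if "w \<in> X" for w using that p unfolding X_def by blast
    have "card (col' ` X) \<le> card X" by (rule card_image_le[OF X(3)])
    with c X have c': "card (col' ` X) + (if 6 \<le> K then 3 else 2) \<le> card L" by (auto split: if_splits)
    have "\<exists>c\<in>L - col' ` X. \<not> conflict True c (col' p)"
    proof (rule free_color_exists[OF L])
      show "a \<notin> col' ` X" using avoids[unfolded X(1)] ordinary by force
      show "col' p \<noteq> a + 1" using avoids[OF pN] pB by auto
      assume "col' p = a"
      then have "b \<noteq> a" using avoids[OF pN] pB by auto
      then show "a + 1 \<notin> L \<or> card (col' ` X) + 3 \<le> card L"
        using c'
        by (auto simp: a_def b_def high_Cons Let_def L_def color_list_def avail_def split: if_splits)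
    qed (use X c' in \<open>auto split: if_splits\<close>)
    then show ?thesis using ordinary p by (auto simp: X(1) conflict_def)
  qed
  then show ?thesis unfolding avail_consistent[OF vs col'] L_def by blast
qed

lemma consistent_snoc:
  assumes vs: "distinct (ps @ v # es)" "set (ps @ v # es) = {v \<in> V. col v = 0}"
    and col': "consistent K col (v # es) ps col'"
    and c: "c \<in> paint_avail K col (ps @ v # es) col' v"
  shows "consistent K col es (ps @ [v]) (col'(v := c))"
proof -
  note c' = c[unfolded avail_consistent[OF vs col']]
  have "\<not> conflict (w \<in> B v) c (col' w)" if "w \<in> N v" "col' w \<noteq> 0" for w
    using c that by (auto simp: avail_def excludes_def)
  moreover have "w \<in> B v \<longleftrightarrow> v \<in> B w" for w by (rule neighbors_sym)
  ultimately have "conflict_free (col'(v := c))"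
    using col' N_D by (auto simp: consistent_def conflict_free_def conflict_commute)
  moreover have "at_splits (\<lambda>_ w ys. (col'(v := c)) w \<in> color_list K col (ys @ v # es) w) ps"
    using col' vs(1) by (auto simp: consistent_def elim!: at_splits_mono)
  ultimately show ?thesis using col' c' by (auto simp: consistent_def)
qed

lemma paint_consistent:
  assumes "distinct (ps @ qs)" "set (ps @ qs) = {v \<in> V. col v = 0}" "1 \<le> K" "conflict_free col"
    and "at_splits (colorable K col) (ps @ qs)"
  shows "consistent K col qs ps (paint K (low K col (ps @ qs)) (high K col (ps @ qs)) col ps)"
  using assms
proof (induction ps arbitrary: qs rule: rev_induct)
  case Nil
  then show ?case by (simp add: consistent_def)
next
  case (snoc v ps)
  define col' where "col' = paint K (low K col (ps @ v # qs)) (high K col (ps @ v # qs)) col ps"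
  have vs: "distinct (ps @ v # qs)" "set (ps @ v # qs) = {v \<in> V. col v = 0}" using snoc.prems by auto
  have con: "consistent K col (v # qs) ps col'"
    unfolding col'_def using snoc.prems by (intro snoc.IH) auto
  have "colorable K col ps v qs" using snoc.prems(5) by simp
  then have "least_avail K col' (low K col (ps @ v # qs)) (high K col (ps @ v # qs)) v
      \<in> paint_avail K col (ps @ v # qs) col' v"
    by (intro least_avail_in avail_consistent_nonempty[OF vs snoc.prems(3) con])
  from consistent_snoc[OF vs con this] show ?case
    by (simp add: paint_snoc col'_def del: fun_upd_apply)
qed

theorem two_pass_coloring:
  assumes "distinct vs" "set vs = {v \<in> V. col v = 0}" "1 \<le> K" "conflict_free col" "\<And>v. col v \<le> K"
    and "at_splits (colorable K col) vs"
  defines "col' \<equiv> paint K (low K col vs) (high K col vs) col vs"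
  shows "conflict_free col'" "v \<in> V \<Longrightarrow> col' v \<in> {1..K}"
proof -
  have con: "consistent K col [] vs col'" using paint_consistent[of vs "[]"] assms by simp
  then show "conflict_free col'" by (simp add: consistent_def)
  show "col' v \<in> {1..K}" if "v \<in> V"
  proof (cases "v \<in> set vs")
    case True
    from con this obtain es where "col' v \<in> color_list K col es v" by (rule consistent_color_list) auto
    then show ?thesis using avail_subset unfolding color_list_def by blast
  next
    case False
    then have "col' v = col v" "col v \<noteq> 0" using con assms(2) that by (auto simp: consistent_def)
    then show ?thesis using assms(5)[of v] by simp
  qed
qed

lemma finite_excludes [simp]: "finite {c. excludes col a b v w c}"
proof (rule finite_subset)
  show "{c. excludes col a b v w c} \<subseteq> {col w - 1, col w, col w + 1, a w, a w + 1, b w}"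
    by (auto simp: excludes_def conflict_def split: if_splits)
qed simp

lemma card_avail: "K \<le> card (avail K col a b v) + (\<Sum>w\<in>N v. card {c. excludes col a b v w c})"
proof -
  have "{1..K} \<subseteq> avail K col a b v \<union> (\<Union>w\<in>N v. {c. excludes col a b v w c})" by (auto simp: avail_def)
  then have "card {1..K} \<le> card (avail K col a b v \<union> (\<Union>w\<in>N v. {c. excludes col a b v w c}))"
    by (intro card_mono) auto
  also have "\<dots> \<le> card (avail K col a b v) + card (\<Union>w\<in>N v. {c. excludes col a b v w c})"
    by (rule card_Un_le)
  also have "card (\<Union>w\<in>N v. {c. excludes col a b v w c}) \<le> (\<Sum>w\<in>N v. card {c. excludes col a b v w c})"
    by (rule card_UN_le) simp
  finally show ?thesis by simp
qed

end

locale bounded_backbone = backbone +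
  assumes max_degree: "max_degree G \<le> 4"
begin

lemma card_N: "card (N v) \<le> 4"
  using card_neighbors_le_max_degree[OF simple] max_degree by (rule le_trans)

lemma colorable_six:
  assumes "distinct (ps @ v # es)" "set (ps @ v # es) = V" "card (B v \<inter> set ps) \<le> 1"
  shows "colorable 6 (\<lambda>_. 0) ps v es"
proof -
  let ?excl = "excludes (\<lambda>_. 0) (low 6 (\<lambda>_. 0) es) (high 6 (\<lambda>_. 0) es) v"
  have "card {c. ?excl w c} = (if w \<in> set es then 1 else 0)" for w
  proof (cases "w \<in> set es")
    case True
    then have "{c. ?excl w c} = (if w \<in> B v then {low 6 (\<lambda>_. 0) es w + 1} else {low 6 (\<lambda>_. 0) es w})"
      using low_in[of 6 w es "\<lambda>_. 0"] high_six[of 6 w es] by (auto simp: excludes_def)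
    with True show ?thesis by simp
  qed (simp add: excludes_def low_notin)
  then have "6 \<le> card (color_list 6 (\<lambda>_. 0) es v) + card (N v \<inter> set es)"
    using card_avail[of 6 "\<lambda>_. 0" "low 6 (\<lambda>_. 0) es" "high 6 (\<lambda>_. 0) es" v]
    by (simp add: color_list_def sum.If_cases)
  moreover have "card (N v) = card (N v \<inter> set ps) + card (N v \<inter> set es)"
  proof -
    have "N v = (N v \<inter> set ps) \<union> (N v \<inter> set es)" using assms(2) N_D by fastforce
    then show ?thesis using assms(1) by (subst card_Un_disjoint[symmetric]) auto
  qed
  ultimately have "card (N v \<inter> set ps) + 2 \<le> card (color_list 6 (\<lambda>_. 0) es v)"
    using card_N[of v] by simp
  moreover have "B v \<inter> set ps = {p}" if "p \<in> B v \<inter> set ps" for p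
    using that assms(3) card_le_Suc0_iff_eq[of "B v \<inter> set ps"] by auto
  ultimately show ?thesis by (auto simp: colorable_def)
qed

end

section \<open>Matchings in graphs of degree at most four\<close>

locale matching_backbone = bounded_backbone +
  assumes B_unique: "u \<in> B v \<Longrightarrow> w \<in> B v \<Longrightarrow> u = w"
begin

definition partner :: "'a \<Rightarrow> 'a" where
  "partner v = (THE w. w \<in> B v)"

lemma B_singleton: "w \<in> B v \<Longrightarrow> B v = {w}"
  using B_unique by blast

lemma B_singleton_sym: "B v = {w} \<Longrightarrow> B w = {v}"
  using B_singleton neighbors_sym by (metis singletonI)

lemma B_partner:
  assumes "B v \<noteq> {}"
  shows "B v = {partner v}"
proof -
  obtain w where "w \<in> B v" using assms by blast
  then have "partner v = w" unfolding partner_def using B_unique by blast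
  then show ?thesis using \<open>w \<in> B v\<close> B_singleton by blast
qed

lemma partner_eq: "B v = {w} \<Longrightarrow> partner v = w"
  using B_partner by force

lemma partnerD:
  assumes "B v \<noteq> {}"
  shows "partner v \<in> N v" "partner v \<noteq> v" "v \<in> N (partner v)" "B (partner v) = {v}"
    "partner (partner v) = v"
proof -
  show "B (partner v) = {v}" by (rule B_singleton_sym[OF B_partner[OF assms]])
  then show "partner (partner v) = v" by (rule partner_eq)
  show "partner v \<in> N v" using B_partner[OF assms] B_subset[of v] by blast
  then show "partner v \<noteq> v" "v \<in> N (partner v)" using N_D by auto
qed

definition slack :: "'a \<Rightarrow> bool" where
  "slack v \<longleftrightarrow> B v = {} \<or> card (N v) < 4"

text \<open>Such a vertex \<open>u\<close> deletes only the color \<open>2\<close> from the list of its partner.\<close>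

definition frugal :: "('a \<Rightarrow> nat) \<Rightarrow> 'a \<Rightarrow> 'a list \<Rightarrow> bool" where
  "frugal col u es \<longleftrightarrow> N u \<inter> set es = {} \<and> (\<exists>x\<in>N u. col x = 2) \<and> (\<forall>w\<in>N u. col w \<in> {0, 2, 4})"

definition anchored :: "('a \<Rightarrow> nat) \<Rightarrow> 'a list \<Rightarrow> 'a \<Rightarrow> 'a list \<Rightarrow> bool" where
  "anchored col ps v es \<longleftrightarrow> slack v \<or> N v \<inter> set ps \<noteq> {} \<or>
     (\<exists>xs u ys. u \<in> B v \<and> es = xs @ u # ys \<and> frugal col u ys)"

lemma frugal_high:
  assumes "frugal col u ys" "\<And>w. w \<in> B u \<Longrightarrow> col w = 0" "u \<notin> set xs"
  shows "high 5 col (xs @ u # ys) u = low 5 col (xs @ u # ys) u + 1"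
proof -
  have excl: "excludes col (low 5 col ys) (high 5 col ys) u w c \<longleftrightarrow> col w \<noteq> 0 \<and> c = col w"
    if w: "w \<in> N u" for w c
  proof -
    have "low 5 col ys w = 0" using w assms(1) by (intro low_notin) (auto simp: frugal_def)
    then show ?thesis using assms(2) by (auto simp: excludes_def conflict_def)
  qed
  have "1 \<in> avail 5 col (low 5 col ys) (high 5 col ys) u"
    using excl assms(1) by (fastforce simp: avail_def frugal_def)
  then have "least_avail 5 col (low 5 col ys) (high 5 col ys) u = 1"
    using least_avail_le least_avail_range
    by (metis One_nat_def atLeastAtMost_iff le_antisym numeral_le_one_iff order.refl one_le_numeral)
  moreover obtain x where "x \<in> N u" "col x = 1 + 1" using assms(1) by (auto simp: frugal_def)
  then have "\<exists>w\<in>N u. excludes col (low 5 col ys) (high 5 col ys) u w (1 + 1)"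
    using excl by force
  ultimately have "high 5 col (u # ys) u = low 5 col (u # ys) u + 1"
    by (simp add: low_Cons high_Cons)
  then show ?thesis using eliminate_append[OF assms(3)] by simp
qed

lemma card_color_list_five:
  assumes vs: "distinct (ps @ v # es)" "set (ps @ v # es) = {v \<in> V. col v = 0}"
    and B0: "\<And>w. w \<in> B v \<Longrightarrow> col w = 0"
  defines "X \<equiv> {w \<in> B v \<inter> set es. high 5 col es w \<noteq> low 5 col es w + 1}"
  shows "card (N v \<inter> set ps) + 5 \<le> card (color_list 5 col es v) + card (N v) + card X"
proof -
  let ?F = "\<lambda>w. {c. excludes col (low 5 col es) (high 5 col es) v w c}"
  have "card (?F w) \<le> (if w \<in> set ps then 0 else 1) + (if w \<in> X then 1 else 0)" if w: "w \<in> N v" for w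
  proof -
    consider (remaining) "w \<in> set ps" | (eliminated) "w \<in> set es" | (colored) "col w \<noteq> 0"
      using w vs N_D by fastforce
    then show ?thesis
    proof cases
      case remaining
      then have "col w = 0" "w \<notin> set es" using vs by auto
      then have "col w = 0" "low 5 col es w = 0" using low_notin by auto
      then show ?thesis by (simp add: excludes_def)
    next
      case eliminated
      then have "?F w = (if w \<in> B v then {low 5 col es w + 1, high 5 col es w} else {low 5 col es w})"
        using vs low_in[of 5 w es col] by (auto simp: excludes_def)
      moreover have "w \<notin> set ps" using eliminated vs by auto
      ultimately show ?thesis using eliminated by (auto simp: X_def card_insert_if)
    next
      case colored
      then have "w \<notin> B v" "w \<notin> set (ps @ v # es)" using B0 unfolding vs(2) by auto
      then have "?F w = {col w}" using colored by (auto simp: excludes_def conflict_def)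
      then show ?thesis using \<open>w \<notin> set (ps @ v # es)\<close> by simp
    qed
  qed
  then have "(\<Sum>w\<in>N v. card (?F w)) \<le> (\<Sum>w\<in>N v. (if w \<in> set ps then 0 else 1) + (if w \<in> X then 1 else 0))"
    by (rule sum_mono)
  also have "\<dots> = card (N v - set ps) + card (N v \<inter> X)"
    by (simp add: sum.distrib sum.If_cases Diff_eq)
  also have "N v \<inter> X = X" using B_subset by (auto simp: X_def)
  finally show ?thesis
    using card_avail[of 5 col "low 5 col es" "high 5 col es" v] card_Int_Diff[of "N v" "set ps"]
    by (simp add: color_list_def)
qed

lemma colorable_five:
  assumes vs: "distinct (ps @ v # es)" "set (ps @ v # es) = {v \<in> V. col v = 0}"
    and B0: "\<And>w w'. w \<in> B w' \<Longrightarrow> col w' = 0 \<Longrightarrow> col w = 0" and v: "anchored col ps v es"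
  shows "colorable 5 col ps v es"
proof -
  define X where "X = {w \<in> B v \<inter> set es. high 5 col es w \<noteq> low 5 col es w + 1}"
  have "col v = 0" using vs(2) by auto
  then have L: "card (N v \<inter> set ps) + 5 \<le> card (color_list 5 col es v) + card (N v) + card X"
    unfolding X_def using B0 by (intro card_color_list_five[OF vs]) blast
  have card_X: "card X \<le> 1"
    using B_unique card_le_Suc0_iff_eq[of X] by (auto simp: X_def)
  have "color_list 5 col es v \<noteq> {}"
  proof -
    consider (unmatched) "B v = {}" | (low_degree) "card (N v) < 4" | (remaining) "N v \<inter> set ps \<noteq> {}"
      | (frugal) xs u ys where "u \<in> B v" "es = xs @ u # ys" "frugal col u ys"
      using v by (auto simp: anchored_def slack_def)
    then have "card (N v) + card X < card (N v \<inter> set ps) + 5"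
    proof cases
      case remaining
      then have "0 < card (N v \<inter> set ps)" by (simp add: card_gt_0_iff)
      then show ?thesis using card_X card_N[of v] by simp
    next
      case frugal
      have "high 5 col es u = low 5 col es u + 1"
        unfolding frugal(2) using frugal(1,3) B0 \<open>col v = 0\<close> vs(1)[unfolded frugal(2)]
        by (intro frugal_high) auto
      then have "X = {}" using B_unique[OF frugal(1)] by (auto simp: X_def)
      then show ?thesis using card_N[of v] by simp
    qed (use card_X card_N[of v] in \<open>auto simp: X_def\<close>)
    then show ?thesis using L by auto
  qed
  moreover have "B v \<inter> set ps = {p} \<and> card (N v \<inter> set ps) + 1 \<le> card (color_list 5 col es v)"
    if p: "p \<in> B v \<inter> set ps" for p
  proof -
    have B: "B v = {p}" using p B_unique by blast
    then have "X = {}" using p vs(1) by (auto simp: X_def)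
    then show ?thesis using L card_N[of v] B p by auto
  qed
  ultimately show ?thesis by (auto simp: colorable_def)
qed

definition covered :: "('a \<Rightarrow> nat) \<Rightarrow> 'a list \<Rightarrow> 'a set" where
  "covered col vs = set vs \<union> {v. col v \<noteq> 0}"

definition arrangement :: "('a \<Rightarrow> nat) \<Rightarrow> 'a list \<Rightarrow> bool" where
  "arrangement col vs \<longleftrightarrow> distinct vs \<and> set vs \<subseteq> {v \<in> V. col v = 0} \<and>
     range col \<subseteq> {0, 2, 4} \<and> conflict_free col \<and> (\<forall>v. \<forall>w\<in>B v. col v = 0 \<longrightarrow> col w = 0) \<and>
     (\<forall>v\<in>covered col vs. N v \<subseteq> covered col vs) \<and> at_splits (anchored col) vs"

lemma arrangementD:
  assumes "arrangement col vs"
  shows "distinct vs" "set vs \<subseteq> {v \<in> V. col v = 0}" "col v \<in> {0, 2, 4}" "conflict_free col"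
    "w \<in> B v \<Longrightarrow> col v = 0 \<Longrightarrow> col w = 0" "v \<in> covered col vs \<Longrightarrow> N v \<subseteq> covered col vs"
    "at_splits (anchored col) vs"
  using assms unfolding arrangement_def by blast+

lemma arrangement_colorable:
  assumes "arrangement col vs" "V \<subseteq> covered col vs"
  shows "set vs = {v \<in> V. col v = 0}" "at_splits (colorable 5 col) vs"
proof -
  note arr = arrangementD[OF assms(1)]
  show vs: "set vs = {v \<in> V. col v = 0}" using arr(2) assms(2) by (auto simp: covered_def)
  show "at_splits (colorable 5 col) vs"
    using arr(7)
  proof (rule at_splits_mono)
    fix ps v es assume "vs = ps @ v # es" "anchored col ps v es"
    then show "colorable 5 col ps v es" using arr(1,5) vs by (intro colorable_five) auto
  qed
qed

definition search_order :: "'a set \<Rightarrow> 'a list \<Rightarrow> bool" where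
  "search_order R vs \<longleftrightarrow> distinct vs \<and> at_splits (\<lambda>ps v _. v \<in> R \<or> N v \<inter> set ps \<noteq> {}) vs"

lemma arrangement_search_order:
  assumes "search_order {v. slack v} vs" "set vs \<subseteq> V" "\<And>v. v \<in> set vs \<Longrightarrow> N v \<subseteq> set vs"
  shows "arrangement (\<lambda>_. 0) vs"
  using assms
  by (auto simp: arrangement_def search_order_def covered_def conflict_free_def anchored_def
      elim!: at_splits_mono)

lemma frugal_extend:
  assumes "frugal col u es" "N u \<inter> set fs = {}" "\<And>w. w \<in> N u \<Longrightarrow> col' w = col w"
  shows "frugal col' u (es @ fs)"
  using assms by (auto simp: frugal_def)

lemma anchored_extend:
  assumes "anchored col ps v es" "\<And>u. u \<in> set es \<Longrightarrow> N u \<inter> set fs = {}"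
    and "\<And>u w. u \<in> set es \<Longrightarrow> w \<in> N u \<Longrightarrow> col' w = col w"
  shows "anchored col' ps v (es @ fs)"
proof -
  have "\<exists>xs u' ys'. u' \<in> B v \<and> es @ fs = xs @ u' # ys' \<and> frugal col' u' ys'"
    if "u \<in> B v" "es = xs @ u # ys" "frugal col u ys" for xs u ys
  proof (intro exI conjI)
    show "frugal col' u (ys @ fs)" by (rule frugal_extend[OF that(3)]) (use that(2) assms(2,3) in auto)
  qed (use that in auto)
  then show ?thesis using assms(1) unfolding anchored_def by blast
qed

definition precolor :: "('a \<Rightarrow> nat) \<Rightarrow> 'a \<Rightarrow> 'a \<Rightarrow> 'a \<Rightarrow> nat" where
  "precolor col x y = col(x := 2, y := 4)"

context
  fixes col vs C u v x y cs
  assumes arrangement: "arrangement col vs"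
    and C: "C \<inter> covered col vs = {}" "C \<subseteq> V" "\<And>z. z \<in> C \<Longrightarrow> N z \<subseteq> C"
    and u: "u \<in> C" "B u = {v}" and x: "x \<in> N u" "x \<noteq> v" "B x = {y}"
    and cs: "search_order {v} cs" "set cs = C - {x, y, u}" "v \<in> set cs"
begin

private abbreviation (input) col' :: "'a \<Rightarrow> nat" where "col' \<equiv> precolor col x y"

private lemmas arr = arrangementD[OF arrangement]

private lemma B_sym: "B y = {x}" "B v = {u}"
  by (rule B_singleton_sym[OF x(3)], rule B_singleton_sym[OF u(2)])

private lemma xy_in_C: "x \<in> C" "y \<in> C" "y \<noteq> x" "x \<noteq> u" "y \<noteq> u"
proof -
  show xC: "x \<in> C" using C(3)[OF u(1)] x(1) by blast
  have "y \<in> N x" using x(3) B_subset[of x] by blast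
  then show "y \<in> C" "y \<noteq> x" "x \<noteq> u" using C(3)[OF xC] x(1) N_D by blast+
  show "y \<noteq> u" using B_sym u(2) x(2) by auto
qed

private lemma new_color_in: "z \<in> C \<Longrightarrow> col' z = (if z = x then 2 else if z = y then 4 else 0)"
  using C(1) xy_in_C by (auto simp: covered_def precolor_def)

private lemma new_color_notin: "z \<notin> C \<Longrightarrow> col' z = col z"
  using xy_in_C by (auto simp: precolor_def)

private lemma new_color_range: "col' z \<in> {0, 2, 4}"
  using arr(3)[of z] by (simp add: precolor_def)

private lemma neighbors_in_C: "w \<in> N z \<Longrightarrow> w \<in> C \<longleftrightarrow> z \<in> C"
  using C(3) N_D by blast

lemma covered_extend: "covered col' (vs @ cs @ [u]) = covered col vs \<union> C"
proof -
  have "{z. col' z \<noteq> 0} = {z. col z \<noteq> 0} \<union> {x, y}" by (auto simp: precolor_def)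
  moreover have "C = set cs \<union> {x, y, u}" using cs(2) xy_in_C u(1) by auto
  ultimately show ?thesis by (auto simp: covered_def)
qed

private lemma conflict_free_extend: "conflict_free col'"
  unfolding conflict_free_def
proof (intro allI ballI impI)
  fix z w assume w: "w \<in> N z" and nz: "col' z \<noteq> 0 \<and> col' w \<noteq> 0"
  show "\<not> conflict (w \<in> B z) (col' z) (col' w)"
  proof (cases "z \<in> C")
    case True
    then have "w \<in> C" "w \<noteq> z" using neighbors_in_C N_D w by auto
    then have "col' z = 2 \<and> col' w = 4 \<or> col' z = 4 \<and> col' w = 2"
      using nz True new_color_in by (auto split: if_splits)
    then show ?thesis by (auto simp: conflict_def)
  next
    case False
    then show ?thesis
      using arr(4) neighbors_in_C[OF w] w nz by (simp add: new_color_notin conflict_free_def)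
  qed
qed

private lemma partner_extend:
  assumes "w \<in> B z" "col' z = 0"
  shows "col' w = 0"
proof (cases "z \<in> C")
  case True
  then have "z \<noteq> x" "z \<noteq> y" using assms(2) new_color_in[OF True] by (auto split: if_splits)
  moreover have "B w = {z}" by (rule B_singleton_sym[OF B_singleton[OF assms(1)]])
  moreover have "w \<in> C" using neighbors_in_C assms(1) B_subset True by blast
  ultimately show ?thesis using x(3) B_sym(1) by (auto simp: new_color_in)
next
  case False
  moreover have "w \<notin> C" using neighbors_in_C assms(1) B_subset False by blast
  ultimately show ?thesis using arr(5) assms by (simp add: new_color_notin)
qed

private lemma anchored_old: "at_splits (\<lambda>ps z es. anchored col' ps z (es @ cs @ [u])) vs"
  using arr(7)
proof (rule at_splits_mono)
  fix ps z es assume vs: "vs = ps @ z # es" and z: "anchored col ps z es"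
  have sep: "N w \<inter> C = {}" if "w \<in> set es" for w
    using arr(6)[of w] C(1) vs that by (auto simp: covered_def)
  show "anchored col' ps z (es @ cs @ [u])"
  proof (rule anchored_extend[OF z])
    show "N w \<inter> set (cs @ [u]) = {}" if "w \<in> set es" for w using sep[OF that] cs(2) u(1) by auto
    show "col' w' = col w'" if "w \<in> set es" "w' \<in> N w" for w w'
      using new_color_notin sep[OF that(1)] that(2) by blast
  qed
qed

private lemma anchored_new: "at_splits (\<lambda>ps z es. anchored col' (vs @ ps) z (es @ [u])) cs"
proof -
  have "col' x = 2" using xy_in_C by (simp add: precolor_def)
  then have "frugal col' u []" using x(1) new_color_range unfolding frugal_def by auto
  then have "anchored col' ps v (es @ [u])" for ps es using B_sym unfolding anchored_def by blast
  then show ?thesis using cs(1) by (auto simp: search_order_def anchored_def elim!: at_splits_mono)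
qed

lemma arrangement_extend: "arrangement col' (vs @ cs @ [u])"
  unfolding arrangement_def
proof (intro conjI)
  have vsC: "set vs \<inter> C = {}" using C(1) by (auto simp: covered_def)
  show "distinct (vs @ cs @ [u])" using arr(1) cs(1,2) vsC u(1) by (auto simp: search_order_def)
  show "set (vs @ cs @ [u]) \<subseteq> {z \<in> V. col' z = 0}"
  proof -
    have "col' z = 0" if "z \<in> set vs" for z using that arr(2) vsC by (subst new_color_notin) auto
    moreover have "col' z = 0" if "z \<in> insert u (set cs)" for z
      using that cs(2) u(1) xy_in_C by (subst new_color_in) auto
    ultimately show ?thesis using arr(2) cs(2) u(1) C(2) by auto
  qed
  show "range col' \<subseteq> {0, 2, 4}" by (rule image_subsetI) (rule new_color_range)
  have "v \<in> N u" using u(2) B_subset[of u] by blast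
  then have "anchored col' (vs @ cs) u []" using cs(3) by (auto simp: anchored_def)
  then show "at_splits (anchored col') (vs @ cs @ [u])" using anchored_old anchored_new by simp
  show "\<forall>z\<in>covered col' (vs @ cs @ [u]). N z \<subseteq> covered col' (vs @ cs @ [u])"
    using arr(6) C(3) unfolding covered_extend by blast
qed (use conflict_free_extend partner_extend in blast)+

end

definition tight :: "'a set \<Rightarrow> bool" where
  "tight C \<longleftrightarrow> (\<forall>z\<in>C. N z \<subseteq> C \<and> \<not> slack z)"

lemma tightD:
  assumes "tight C" "z \<in> C"
  shows "N z \<subseteq> C" "\<not> slack z" "B z \<noteq> {}" "z \<in> V"
proof -
  show "N z \<subseteq> C" "\<not> slack z" using assms by (simp_all add: tight_def)
  then show "B z \<noteq> {}" by (simp add: slack_def)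
  then show "z \<in> V" using B_subset N_D by blast
qed

lemma tight_subset: "tight C \<Longrightarrow> C \<subseteq> V"
  using tightD(4) by blast

lemma tight_partner:
  assumes "tight C" "z \<in> C"
  shows "partner z \<in> C" "partner z \<in> N z" "partner z \<noteq> z" "z \<in> N (partner z)"
    "partner (partner z) = z" "B z = {partner z}"
  using tightD[OF assms] partnerD[of z] B_partner[of z] by auto

lemma third_neighbor:
  assumes "\<not> slack z"
  obtains w where "w \<in> N z" "w \<noteq> partner z" "w \<noteq> s" "w \<noteq> t"
proof -
  have "card {partner z, s, t} < card (N z)"
    using assms card_N[of z] by (simp add: card_insert_if slack_def)
  then have "\<not> N z \<subseteq> {partner z, s, t}" using card_mono[of "{partner z, s, t}" "N z"] by auto
  then show ?thesis using that by blast
qed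

text \<open>A search that discovers the endpoints of a matching edge consecutively.\<close>

definition search_numbering :: "'a set \<Rightarrow> 'a \<Rightarrow> ('a \<Rightarrow> nat) \<Rightarrow> bool" where
  "search_numbering C r num \<longleftrightarrow> inj_on num C \<and> (\<forall>z\<in>C. z = r \<or> (\<exists>w\<in>N z. num w < num z)) \<and>
     (\<forall>z\<in>C. \<forall>w\<in>C. num z < num w \<longrightarrow> w \<noteq> partner z \<longrightarrow> num (partner z) < num w)"

lemma search_numberingD:
  assumes "search_numbering C r num" "z \<in> C"
  shows "w \<in> C \<Longrightarrow> num z = num w \<Longrightarrow> z = w" "z = r \<or> (\<exists>w\<in>N z. num w < num z)"
    "w \<in> C \<Longrightarrow> num z < num w \<Longrightarrow> w \<noteq> partner z \<Longrightarrow> num (partner z) < num w"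
  using assms by (auto simp: search_numbering_def dest: inj_onD)

definition last_branch :: "'a set \<Rightarrow> ('a \<Rightarrow> nat) \<Rightarrow> 'a \<Rightarrow> 'a \<Rightarrow> bool" where
  "last_branch C num u x \<longleftrightarrow> x \<in> N u \<and> x \<noteq> partner u \<and> num u < num x \<and>
     (\<forall>z\<in>C. num u < num z \<longrightarrow> (\<forall>w\<in>N z. w \<noteq> partner z \<longrightarrow> num w < num z))"

lemma last_branchD:
  assumes "last_branch C num u x"
  shows "x \<in> N u" "x \<noteq> partner u" "num u < num x"
    "z \<in> C \<Longrightarrow> num u < num z \<Longrightarrow> w \<in> N z \<Longrightarrow> w \<noteq> partner z \<Longrightarrow> num w < num z"
  using assms by (simp_all add: last_branch_def)

text \<open>
  A vertex \<open>z\<close> after \<open>u\<close> has three neighbors besides its partner, none of them after \<open>u\<close>. One of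
  them precedes the matching edge of \<open>u\<close>, and the vertices before this edge are connected.
\<close>

context
  fixes C r num u x and W :: "'a set"
  assumes num: "search_numbering C r num" and C: "tight C" and u: "u \<in> C"
    and branch: "last_branch C num u x"
    and partner_W: "partner u \<in> W"
    and closed: "\<And>z w. z \<in> W \<Longrightarrow> z \<notin> {x, partner x, u} \<Longrightarrow> w \<in> N z \<Longrightarrow> w \<notin> {x, partner x, u} \<Longrightarrow> w \<in> W"
begin

private abbreviation (input) removed :: "'a set" where "removed \<equiv> {x, partner x, u}"

private lemma branch_in_C: "x \<in> C"
  using tightD(1)[OF C u] last_branchD(1)[OF branch] by blast

private lemma branch_partner_later: "num u < num (partner x)"
proof (rule ccontr)
  note px = tight_partner[OF C branch_in_C]
  assume "\<not> num u < num (partner x)"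
  moreover have "partner x \<noteq> u" using last_branchD(2)[OF branch] px(5) by auto
  ultimately have "num (partner x) < num u" using search_numberingD(1)[OF num px(1) u] by force
  then have "num x < num u"
    using search_numberingD(3)[OF num px(1) u] px(5) last_branchD(3)[OF branch] by auto
  then show False using last_branchD(3)[OF branch] by simp
qed

private lemma neighbors_in_W: "w \<in> N z \<Longrightarrow> z \<notin> removed \<Longrightarrow> w \<notin> removed \<Longrightarrow> z \<in> W \<longleftrightarrow> w \<in> W"
  using closed[of z w] closed[of w z] N_D[of w z] by blast

private lemma earlier_not_removed: "num w < num u \<Longrightarrow> w \<notin> removed"
  using last_branchD(3)[OF branch] branch_partner_later by auto

private lemma earlier_connected: "z \<in> C \<Longrightarrow> num z < num u \<Longrightarrow> z \<noteq> partner u \<Longrightarrow> z \<in> W \<longleftrightarrow> r \<in> W"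
proof (induction "num z" arbitrary: z rule: less_induct)
  case less
  show ?case
  proof (cases "z = r")
    case False
    then obtain w where w: "w \<in> N z" "num w < num z"
      using search_numberingD(2)[OF num less.prems(1)] by blast
    have "w \<noteq> partner u"
      using search_numberingD(3)[OF num tight_partner(1)[OF C u] less.prems(1)] w(2) less.prems
        tight_partner(5)[OF C u] by auto
    then have "w \<in> W \<longleftrightarrow> r \<in> W" using less.hyps[OF w(2)] w tightD(1)[OF C] less.prems by auto
    then show ?thesis using neighbors_in_W[OF w(1)] earlier_not_removed w(2) less.prems(2) by auto
  qed simp
qed

private lemma later_connected:
  assumes z: "z \<in> C" "num u < num z" "z \<notin> removed"
  shows "z \<in> W \<longleftrightarrow> r \<in> W"
proof -
  obtain w where w: "w \<in> N z" "w \<noteq> partner z" "w \<noteq> u" "w \<noteq> partner u"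
    using third_neighbor tightD(2)[OF C z(1)] by metis
  have wC: "w \<in> C" and zN: "z \<in> N w" using tightD(1)[OF C z(1)] w(1) N_D by blast+
  have "z \<noteq> partner w" using w(2) tight_partner(5)[OF C wC] by auto
  then have "\<not> num u < num w"
    using last_branchD(4)[OF branch z(1,2) w(1,2)] last_branchD(4)[OF branch wC _ zN] by fastforce
  then have "num w < num u" using search_numberingD(1)[OF num wC u] w(3) by force
  then show ?thesis
    using earlier_connected[OF wC _ w(4)] neighbors_in_W[OF w(1) z(3) earlier_not_removed] by blast
qed

lemma connected_without_last_branch: "C - {x, partner x, u} \<subseteq> W"
proof -
  let ?v = "partner u"
  have connected: "z \<in> W \<longleftrightarrow> r \<in> W" if "z \<in> C - removed" "z \<noteq> ?v" for z
    using earlier_connected[of z] later_connected[of z] that search_numberingD(1)[OF num, of z u] u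
    by force
  note v = tight_partner[OF C u] and px = tight_partner[OF C branch_in_C]
  have "?v \<notin> removed"
    using v(3,5) px(5) last_branchD(2)[OF branch] last_branchD(1)[OF branch] N_D by auto
  moreover obtain w where w: "w \<in> N ?v" "w \<noteq> partner ?v" "w \<noteq> x" "w \<noteq> partner x"
    using third_neighbor tightD(2)[OF C v(1)] by metis
  moreover have "w \<in> C" "w \<noteq> ?v" using tightD(1)[OF C v(1)] w(1) N_D by auto
  ultimately have "r \<in> W" using connected[of w] neighbors_in_W[of w ?v] v(5) partner_W by auto
  then show ?thesis using connected partner_W by blast
qed

end

definition component :: "'a \<Rightarrow> 'a set" where
  "component v = \<Inter>{C. v \<in> C \<and> (\<forall>z\<in>C. N z \<subseteq> C)}"

lemma component_root: "v \<in> component v"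
  by (simp add: component_def)

lemma component_closed: "z \<in> component v \<Longrightarrow> N z \<subseteq> component v"
  by (auto simp: component_def)

lemma component_least: "v \<in> C \<Longrightarrow> (\<And>z. z \<in> C \<Longrightarrow> N z \<subseteq> C) \<Longrightarrow> component v \<subseteq> C"
  by (auto simp: component_def)

section \<open>Numberings by searches\<close>

text \<open>
  Vertices not yet discovered have the number \<open>0\<close>, and \<open>ord\<close> is the inverse of \<open>num\<close> with indices
  shifted by one.
\<close>

definition well_numbered :: "'a set \<Rightarrow> 'a \<Rightarrow> nat \<Rightarrow> ('a \<Rightarrow> nat) \<Rightarrow> (nat \<Rightarrow> 'a) \<Rightarrow> nat \<Rightarrow> 'a \<Rightarrow> bool" where
  "well_numbered C r k num ord m z \<longleftrightarrow> num z \<in> {Suc k..m} \<and> ord (num z - 1) = z \<and> num (partner z) \<noteq> 0 \<and>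
     (z = r \<or> (\<exists>w\<in>N z. num w \<noteq> 0 \<and> num w < num z)) \<and>
     (\<forall>w\<in>C. num z < num w \<longrightarrow> w \<noteq> partner z \<longrightarrow> num (partner z) < num w)"

definition numbered :: "'a set \<Rightarrow> 'a \<Rightarrow> nat \<Rightarrow> ('a \<Rightarrow> nat) \<Rightarrow> (nat \<Rightarrow> 'a) \<Rightarrow> nat \<Rightarrow> bool" where
  "numbered C r k num ord m \<longleftrightarrow> k \<le> m \<and> (\<forall>j\<in>{k..<m}. ord j \<in> C \<and> num (ord j) = Suc j) \<and>
     (\<forall>z\<in>C. num z \<noteq> 0 \<longrightarrow> well_numbered C r k num ord m z)"

definition expanded :: "'a set \<Rightarrow> ('a \<Rightarrow> nat) \<Rightarrow> nat \<Rightarrow> 'a set" where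
  "expanded C num h = {z \<in> C. num z \<noteq> 0 \<and> num z \<le> h}"

lemma numbered_ord:
  assumes "numbered C r k num ord m" "k \<le> j" "j < m"
  shows "ord j \<in> C" "num (ord j) = Suc j"
  using assms by (auto simp: numbered_def)

lemma numberedD:
  assumes "numbered C r k num ord m" "z \<in> C" "num z \<noteq> 0"
  shows "k < num z" "num z \<le> m" "ord (num z - 1) = z" "num (partner z) \<noteq> 0"
    "z = r \<or> (\<exists>w\<in>N z. num w \<noteq> 0 \<and> num w < num z)"
    "w \<in> C \<Longrightarrow> num z < num w \<Longrightarrow> w \<noteq> partner z \<Longrightarrow> num (partner z) < num w"
  using assms by (auto simp: numbered_def well_numbered_def)

lemma numbered_inj:
  "numbered C r k num ord m \<Longrightarrow> z \<in> C \<Longrightarrow> w \<in> C \<Longrightarrow> num z \<noteq> 0 \<Longrightarrow> num w = num z \<Longrightarrow> w = z"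
  using numberedD(3) by metis

context
  fixes C r k num ord m w
  assumes num: "numbered C r k num ord m" and C: "tight C"
    and w: "w \<in> C" "num w = 0" "w = r \<or> (\<exists>v\<in>N w. num v \<noteq> 0)"
begin

private abbreviation (input) num' :: "'a \<Rightarrow> nat" where "num' \<equiv> num(w := Suc m, partner w := Suc (Suc m))"
private abbreviation (input) ord' :: "nat \<Rightarrow> 'a" where "ord' \<equiv> ord(m := w, Suc m := partner w)"

private lemmas partner_w = tight_partner[OF C w(1)]

private lemma num_partner_w: "num (partner w) = 0"
  using numberedD(4)[OF num partner_w(1)] w(2) partner_w(5) by auto

private lemma num'_old: "num z \<noteq> 0 \<Longrightarrow> num' z = num z"
  using w(2) num_partner_w by auto

private lemma num_le: "z \<in> C \<Longrightarrow> num z \<le> m"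
  using numberedD(2)[OF num] by (cases "num z = 0") auto

private lemma well_numbered_new:
  assumes "z \<in> {w, partner w}"
  shows "well_numbered C r k num' ord' (Suc (Suc m)) z"
proof -
  have km: "k \<le> m" using num by (simp add: numbered_def)
  have "z = r \<or> (\<exists>v\<in>N z. num' v \<noteq> 0 \<and> num' v < num' z)"
  proof (cases "z = w")
    case True
    have "num v < Suc m" if "v \<in> N w" for v using num_le[of v] tightD(1)[OF C w(1)] that by auto
    with True show ?thesis using w(3) num'_old partner_w(3) by fastforce
  next
    case False
    then have "w \<in> N z" "num' w < num' z" using assms partner_w by auto
    then show ?thesis using partner_w(3) by (intro disjI2 bexI[of _ w]) auto
  qed
  moreover have "\<not> Suc m < num v" if "v \<in> C" for v using num_le[OF that] by simp
  ultimately show ?thesis using assms partner_w km by (auto simp: well_numbered_def)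
qed

private lemma well_numbered_old:
  assumes z: "z \<in> C" "num z \<noteq> 0"
  shows "well_numbered C r k num' ord' (Suc (Suc m)) z"
proof -
  note old = numberedD[OF num z]
  have nz: "z \<noteq> w" "z \<noteq> partner w" "partner z \<noteq> w" "partner z \<noteq> partner w"
    using z(2) old(4) w(2) num_partner_w by auto
  have pz: "partner z \<in> C" by (rule tight_partner[OF C z(1)])
  have "z = r \<or> (\<exists>v\<in>N z. num' v \<noteq> 0 \<and> num' v < num z)" using old(5) num'_old by metis
  moreover have "num (partner z) < num' v" if "v \<in> C" "num z < num' v" "v \<noteq> partner z" for v
    using that old(6)[of v] num_le[OF pz] by (auto split: if_splits)
  moreover have "ord' (num z - 1) = z" using old(1-3) by auto
  ultimately show ?thesis using old(1,2,4) nz by (auto simp: well_numbered_def)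
qed

lemma numbered_push: "numbered C r k num' ord' (Suc (Suc m))"
  unfolding numbered_def
proof (intro conjI ballI impI)
  show "k \<le> Suc (Suc m)" using num by (simp add: numbered_def)
  fix j assume "j \<in> {k..<Suc (Suc m)}"
  then consider (old) "k \<le> j" "j < m" | (new) "j = m" | (new_partner) "j = Suc m" by fastforce
  then have "ord' j \<in> C \<and> num' (ord' j) = Suc j"
  proof cases
    case old
    from numbered_ord[OF num this] show ?thesis using num'_old[of "ord j"] old by simp
  qed (use w(1) partner_w in auto)
  then show "ord' j \<in> C" "num' (ord' j) = Suc j" by auto
next
  fix z assume "z \<in> C" "num' z \<noteq> 0"
  then show "well_numbered C r k num' ord' (Suc (Suc m)) z"
    using well_numbered_new[of z] well_numbered_old[of z]
    by (cases "num z = 0") (simp_all split: if_splits)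
qed

end

lemma numbered_length:
  assumes "numbered C r k num ord m" "finite C"
  shows "m \<le> k + card C"
proof -
  have "inj_on ord {k..<m}"
    using numbered_ord(2)[OF assms(1)] by (metis atLeastLessThan_iff inj_onI nat.inject)
  moreover have "ord ` {k..<m} \<subseteq> C" using numbered_ord(1)[OF assms(1)] by auto
  ultimately show ?thesis using card_inj_on_le[of ord "{k..<m}" C] assms(2) by simp
qed

lemma numbered_root:
  assumes "numbered C r k num ord m" "k < m" "\<And>z. z \<in> C \<Longrightarrow> N z \<subseteq> C"
  shows "num r \<noteq> 0"
proof -
  have first: "ord k \<in> C" "num (ord k) = Suc k"
    using numbered_ord[OF assms(1) order_refl assms(2)] by auto
  have "\<not> (num w \<noteq> 0 \<and> num w < Suc k)" if "w \<in> N (ord k)" for w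
    using numberedD(1)[OF assms(1), of w] assms(3)[OF first(1)] that by auto
  then have "ord k = r" using numberedD(5)[OF assms(1) first(1)] first(2) by fastforce
  then show ?thesis using first(2) by simp
qed

lemma last_branch_cong:
  assumes "u \<in> E" "\<And>z w. z \<in> E \<Longrightarrow> w \<in> insert z (N z) \<Longrightarrow> num' w = num w"
  shows "last_branch E num' u x \<longleftrightarrow> last_branch E num u x"
  using assms unfolding last_branch_def by auto

lemma expanded_Suc:
  assumes "numbered C r k num ord m" "k \<le> h" "h < m"
  shows "expanded C num (Suc h) = insert (ord h) (expanded C num h)"
proof (rule set_eqI)
  fix z
  have "z = ord h" if "z \<in> C" "num z = Suc h" using numberedD(3)[OF assms(1) that(1)] that(2) by simp
  then show "z \<in> expanded C num (Suc h) \<longleftrightarrow> z \<in> insert (ord h) (expanded C num h)"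
    using numbered_ord[OF assms] by (cases "z = ord h") (auto simp: expanded_def le_Suc_eq)
qed

lemma last_branch_expand:
  assumes num: "numbered C r k num ord m" and h: "k \<le> h" "h < m"
    and C: "tight C"
    and nb: "\<And>w. w \<in> N (ord h) \<Longrightarrow> num w \<noteq> 0"
    and old: "expanded C num h = {} \<or> u \<in> expanded C num h \<and> last_branch (expanded C num h) num u x"
    and none: "\<And>w. w \<in> N (ord h) \<Longrightarrow> w \<noteq> partner (ord h) \<Longrightarrow> \<not> Suc h < num w"
  shows "u \<in> expanded C num (Suc h) \<and> last_branch (expanded C num (Suc h)) num u x"
proof -
  define v where "v = ord h"
  have v: "v \<in> C" "num v = Suc h" using numbered_ord[OF num h] by (simp_all add: v_def)
  have less: "num w < num v" if w: "w \<in> N v" "w \<noteq> partner v" for w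
    using none w nb[of w] numbered_inj[OF num v(1), of w] tightD(1)[OF C v(1)] v N_D[OF w(1)]
    by (force simp: v_def)
  have "expanded C num h \<noteq> {}"
  proof
    assume empty: "expanded C num h = {}"
    obtain w where w: "w \<in> N v" "w \<noteq> partner v" using third_neighbor tightD(2)[OF C v(1)] by metis
    then have "w \<in> C" "num w \<noteq> 0" using tightD(1)[OF C v(1)] nb by (auto simp: v_def)
    moreover have "num w \<le> h" using less[OF w] v(2) by simp
    ultimately show False using empty by (auto simp: expanded_def)
  qed
  then have "u \<in> expanded C num h" "last_branch (expanded C num h) num u x" using old by auto
  then show ?thesis
    using less unfolding expanded_Suc[OF num h] by (auto simp: last_branch_def v_def)
qed

lemma last_branch_new:
  assumes num: "numbered C r k num ord m" and h: "k \<le> h" "h < m"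
    and x: "x \<in> N (ord h)" "x \<noteq> partner (ord h)" "Suc h < num x"
  shows "ord h \<in> expanded C num (Suc h) \<and> last_branch (expanded C num (Suc h)) num (ord h) x"
  using numbered_ord[OF num h] x by (auto simp: last_branch_def expanded_def)

lemma search_numbering_complete:
  assumes num: "numbered C r k num ord m" and C: "C = component r" "num r \<noteq> 0"
    and closed: "\<And>z w. z \<in> expanded C num m \<Longrightarrow> w \<in> N z \<Longrightarrow> num w \<noteq> 0"
  shows "search_numbering C r num" "expanded C num m = C"
proof -
  have closed': "N z \<subseteq> expanded C num m" if z: "z \<in> expanded C num m" for z
  proof
    fix w assume w: "w \<in> N z"
    then have "w \<in> C" using z component_closed unfolding C(1) expanded_def by blast
    then show "w \<in> expanded C num m"
      using closed[OF z w] numberedD(2)[OF num] by (simp add: expanded_def)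
  qed
  have "r \<in> expanded C num m" using C component_root numberedD(2)[OF num] by (simp add: expanded_def)
  then show exp: "expanded C num m = C"
    using component_least[of r "expanded C num m"] closed' C(1) by (auto simp: expanded_def)
  have nz: "num z \<noteq> 0" if "z \<in> C" for z using that exp by (auto simp: expanded_def)
  show "search_numbering C r num" unfolding search_numbering_def
  proof (intro conjI ballI impI)
    show "inj_on num C" using numbered_inj[OF num] nz by (auto simp: inj_on_def)
    show "z = r \<or> (\<exists>w\<in>N z. num w < num z)" if "z \<in> C" for z
      using numberedD(5)[OF num that nz[OF that]] by blast
    show "num (partner z) < num w" if "z \<in> C" "w \<in> C" "num z < num w" "w \<noteq> partner z" for z w
      using numberedD(6)[OF num _ nz] that by blast
  qed
qed

end

section \<open>Running times of programs\<close>

fun writes :: "com \<Rightarrow> nat set" where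
  "writes Skip = {}"
| "writes (Assign a i x) = {a}"
| "writes (Seq p q) = writes p \<union> writes q"
| "writes (Cond b p q) = writes p \<union> writes q"
| "writes (Loop b p) = writes p"

definition agrees_off :: "nat set \<Rightarrow> store \<Rightarrow> store \<Rightarrow> bool" where
  "agrees_off X s t \<longleftrightarrow> (\<forall>k. k \<notin> X \<longrightarrow> t k = s k)"

lemma agrees_offD: "agrees_off X s t \<Longrightarrow> k \<notin> X \<Longrightarrow> t k = s k"
  by (simp add: agrees_off_def)

lemma agrees_off_refl [simp]: "agrees_off X s s"
  by (simp add: agrees_off_def)

lemma agrees_off_trans: "agrees_off X s t \<Longrightarrow> agrees_off Y t u \<Longrightarrow> X \<union> Y \<subseteq> Z \<Longrightarrow> agrees_off Z s u"
  unfolding agrees_off_def by (metis UnCI subsetD)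

lemma exec_agrees_off: "exec p s t s' \<Longrightarrow> agrees_off (writes p) s s'"
  by (induction rule: exec.induct) (auto simp: agrees_off_def)

fun loop_free :: "com \<Rightarrow> bool" where
  "loop_free (Seq p q) \<longleftrightarrow> loop_free p \<and> loop_free q"
| "loop_free (Cond b p q) \<longleftrightarrow> loop_free p \<and> loop_free q"
| "loop_free (Loop b p) \<longleftrightarrow> False"
| "loop_free _ \<longleftrightarrow> True"

fun effect :: "com \<Rightarrow> store \<Rightarrow> store" where
  "effect Skip s = s"
| "effect (Assign a i x) s = s(a := (s a)(aval i s := aval x s))"
| "effect (Seq p q) s = effect q (effect p s)"
| "effect (Cond b p q) s = (if aval b s \<noteq> 0 then effect p s else effect q s)"
| "effect (Loop b p) s = s"

fun cost :: "com \<Rightarrow> nat" where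
  "cost Skip = 1"
| "cost (Assign a i x) = 1 + acost i + acost x"
| "cost (Seq p q) = cost p + cost q"
| "cost (Cond b p q) = 1 + acost b + (cost p + cost q)"
| "cost (Loop b p) = 0"

lemma effect_agrees_off: "agrees_off (writes p) s (effect p s)"
  by (induction p arbitrary: s) (simp_all add: agrees_off_def)

lemma effect_other: "k \<notin> writes p \<Longrightarrow> effect p s k = s k"
  by (rule agrees_offD[OF effect_agrees_off])

definition runs :: "com \<Rightarrow> store \<Rightarrow> nat \<Rightarrow> (store \<Rightarrow> bool) \<Rightarrow> bool" where
  "runs p s T Q \<longleftrightarrow> (\<exists>t s'. exec p s t s' \<and> t \<le> T \<and> Q s')"

lemma runsI: "exec p s t s' \<Longrightarrow> t \<le> T \<Longrightarrow> Q s' \<Longrightarrow> runs p s T Q"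
  by (auto simp: runs_def)

lemma runs_mono: "runs p s T Q \<Longrightarrow> T \<le> T' \<Longrightarrow> (\<And>s'. Q s' \<Longrightarrow> R s') \<Longrightarrow> runs p s T' R"
  unfolding runs_def by (blast intro: le_trans)

lemma runs_agrees_off: "runs p s T Q \<Longrightarrow> runs p s T (\<lambda>s'. Q s' \<and> agrees_off (writes p) s s')"
  unfolding runs_def using exec_agrees_off by blast

lemma runs_Seq:
  assumes "runs p s T Q" "\<And>s'. Q s' \<Longrightarrow> agrees_off (writes p) s s' \<Longrightarrow> runs q s' T' R"
  shows "runs (Seq p q) s (T + T') R"
proof -
  from assms(1) obtain t s' where p: "exec p s t s'" "t \<le> T" "Q s'" by (auto simp: runs_def)
  from assms(2)[OF p(3) exec_agrees_off[OF p(1)]]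
  obtain t' s'' where q: "exec q s' t' s''" "t' \<le> T'" "R s''" by (auto simp: runs_def)
  from exec_Seq[OF p(1) q(1)] show ?thesis using p(2) q(2,3) by (auto intro: runsI)
qed

lemma runs_Cond:
  assumes "aval b s \<noteq> 0 \<Longrightarrow> runs p s T Q" "aval b s = 0 \<Longrightarrow> runs q s T Q"
  shows "runs (Cond b p q) s (1 + acost b + T) Q"
proof (cases "aval b s = 0")
  case True
  from assms(2)[OF this] obtain t s' where "exec q s t s'" "t \<le> T" "Q s'" by (auto simp: runs_def)
  then show ?thesis by (intro runsI[OF exec_CondFalse[OF True]]) auto
next
  case False
  from assms(1)[OF this] obtain t s' where "exec p s t s'" "t \<le> T" "Q s'" by (auto simp: runs_def)
  then show ?thesis by (intro runsI[OF exec_CondTrue[OF False]]) auto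
qed

lemma runs_loop_free: "loop_free p \<Longrightarrow> Q (effect p s) \<Longrightarrow> runs p s (cost p) Q"
proof (induction p arbitrary: s Q)
  case Skip
  then show ?case by (intro runsI[OF exec_Skip]) auto
next
  case (Assign a i x)
  then show ?case by (intro runsI[OF exec_Assign]) simp_all
next
  case (Seq p q)
  then show ?case by (auto intro: runs_Seq[where Q = "\<lambda>t. t = effect p s"])
next
  case (Cond b p q)
  have "runs (Cond b p q) s (1 + acost b + (cost p + cost q)) Q"
    by (rule runs_Cond; rule runs_mono[OF Cond.IH(1)] runs_mono[OF Cond.IH(2)]) (use Cond.prems in auto)
  then show ?case by simp
qed simp

lemma runs_Seq_loop_free:
  assumes "loop_free p" "runs q (effect p s) T R"
  shows "runs (Seq p q) s (cost p + T) R"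
  by (rule runs_Seq[where Q = "\<lambda>t. t = effect p s"]) (use assms runs_loop_free in auto)

lemma runs_Loop:
  fixes \<Phi> :: "store \<Rightarrow> nat"
  assumes "I s"
    and step: "\<And>t. I t \<Longrightarrow> aval b t \<noteq> 0 \<Longrightarrow> agrees_off (writes p) s t \<Longrightarrow>
      \<exists>T. runs p t T (\<lambda>t'. I t' \<and> 1 + acost b + T + \<Phi> t' \<le> \<Phi> t)"
  shows "runs (Loop b p) s (1 + acost b + \<Phi> s) (\<lambda>t. I t \<and> aval b t = 0)"
proof -
  have "runs (Loop b p) t (1 + acost b + \<Phi> t) (\<lambda>t. I t \<and> aval b t = 0)"
    if "I t" "agrees_off (writes p) s t" for t
    using that
  proof (induction "\<Phi> t" arbitrary: t rule: less_induct)
    case less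
    show ?case
    proof (cases "aval b t = 0")
      case True
      with less.prems show ?thesis by (intro runsI[OF exec_LoopFalse]) auto
    next
      case False
      from runs_agrees_off obtain T u t' where body: "exec p t u t'" "u \<le> T" "I t'"
        "1 + acost b + T + \<Phi> t' \<le> \<Phi> t" "agrees_off (writes p) t t'"
        using step[OF less.prems(1) False less.prems(2)] exec_agrees_off unfolding runs_def by blast
      have "agrees_off (writes p) s t'" using less.prems(2) body(5) by (rule agrees_off_trans) simp
      then obtain u' t'' where "exec (Loop b p) t' u' t''" "u' \<le> 1 + acost b + \<Phi> t'" "I t''"
        "aval b t'' = 0"
        using less.hyps[of t'] body unfolding runs_def by auto
      then show ?thesis using exec_LoopTrue[OF False body(1)] body(2,4) by (intro runsI) auto
    qed
  qed
  with assms(1) show ?thesis by simp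
qed

lemma runs_Loop_loop_free:
  fixes \<mu> :: "store \<Rightarrow> nat"
  assumes "loop_free p" "I s"
    and step: "\<And>t. I t \<Longrightarrow> aval b t \<noteq> 0 \<Longrightarrow> agrees_off (writes p) s t \<Longrightarrow> I (effect p t) \<and> \<mu> (effect p t) < \<mu> t"
  shows "runs (Loop b p) s ((1 + acost b + cost p) * (\<mu> s + 1)) (\<lambda>t. I t \<and> aval b t = 0)"
proof -
  let ?c = "1 + acost b + cost p"
  have "runs (Loop b p) s (1 + acost b + ?c * \<mu> s) (\<lambda>t. I t \<and> aval b t = 0)"
  proof (rule runs_Loop[where I = I, OF assms(2)])
    fix t assume t: "I t" "aval b t \<noteq> 0" "agrees_off (writes p) s t"
    have "?c * (\<mu> (effect p t) + 1) \<le> ?c * \<mu> t" using step[OF t] by (intro mult_le_mono2) simp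
    then show "\<exists>T. runs p t T (\<lambda>t'. I t' \<and> 1 + acost b + T + ?c * \<mu> t' \<le> ?c * \<mu> t)"
      using step[OF t] by (intro exI[of _ "cost p"] runs_loop_free[OF assms(1)]) auto
  qed
  then show ?thesis by (rule runs_mono) auto
qed

abbreviation var :: "nat \<Rightarrow> aexp" where "var x \<equiv> Cell x (Const 0)"
abbreviation set_var :: "nat \<Rightarrow> aexp \<Rightarrow> com" where "set_var x e \<equiv> Assign x (Const 0) e"
abbreviation incr :: "nat \<Rightarrow> com" where "incr x \<equiv> set_var x (Add (var x) (Const 1))"
abbreviation store_var :: "store \<Rightarrow> nat \<Rightarrow> nat \<Rightarrow> store" where "store_var s x c \<equiv> s(x := (s x)(0 := c))"

definition neq :: "aexp \<Rightarrow> aexp \<Rightarrow> aexp" where "neq x y = Add (Sub x y) (Sub y x)"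

lemma aval_neq [simp]: "aval (neq x y) s = 0 \<longleftrightarrow> aval x s = aval y s"
  by (auto simp: neq_def)

section \<open>Iteration over vertices and neighbors\<close>

text \<open>
  Arrays \<open>0\<close> to \<open>5\<close> are input and output, and arrays from 20 on are variables, used at index \<open>0\<close> only.
\<close>

abbreviation (input) INFO :: nat where "INFO \<equiv> 0"
abbreviation (input) G_OFF :: nat where "G_OFF \<equiv> 1"
abbreviation (input) G_ADJ :: nat where "G_ADJ \<equiv> 2"
abbreviation (input) H_OFF :: nat where "H_OFF \<equiv> 3"
abbreviation (input) H_ADJ :: nat where "H_ADJ \<equiv> 4"
abbreviation (input) CUR :: nat where "CUR \<equiv> 20"
abbreviation (input) NBR :: nat where "NBR \<equiv> 21"
abbreviation (input) VTX :: nat where "VTX \<equiv> 27"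

definition for_vertices :: "com \<Rightarrow> com" where
  "for_vertices p = Seq (set_var VTX (Const 0)) (Loop (Sub (var INFO) (var VTX)) (Seq p (incr VTX)))"

lemma writes_for_vertices [simp]: "writes (for_vertices p) = insert VTX (writes p)"
  by (auto simp: for_vertices_def)

lemma runs_for_vertices:
  fixes \<Phi> :: "store \<Rightarrow> nat"
  assumes "s INFO 0 = n" "INFO \<notin> writes p" "VTX \<notin> writes p" "J 0 s"
    and J: "\<And>i t f. J i (t(VTX := f)) \<longleftrightarrow> J i t" and \<Phi>: "\<And>t f. \<Phi> (t(VTX := f)) = \<Phi> t"
    and step: "\<And>i t. i < n \<Longrightarrow> t VTX 0 = i \<Longrightarrow> J i t \<Longrightarrow> agrees_off (insert VTX (writes p)) s t \<Longrightarrow>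
      \<exists>T. runs p t T (\<lambda>t'. J (Suc i) t' \<and> T + \<Phi> t' \<le> \<Phi> t + c)"
  shows "runs (for_vertices p) s (9 + (12 + c) * n + \<Phi> s) (J n)"
proof -
  let ?b = "Sub (var INFO) (var VTX)" and ?s = "store_var s VTX 0"
  let ?I = "\<lambda>t. J (t VTX 0) t \<and> t VTX 0 \<le> n"
  let ?\<Psi> = "\<lambda>t. (12 + c) * (n - t VTX 0) + \<Phi> t"
  let ?Q = "\<lambda>t T t'. ?I t' \<and> 1 + acost ?b + T + ?\<Psi> t' \<le> ?\<Psi> t"
  have "runs (Loop ?b (Seq p (incr VTX))) ?s (1 + acost ?b + ?\<Psi> ?s) (\<lambda>t. ?I t \<and> aval ?b t = 0)"
  proof (rule runs_Loop)
    fix t assume t: "?I t" "aval ?b t \<noteq> 0" "agrees_off (writes (Seq p (incr VTX))) ?s t"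
    have off: "agrees_off (insert VTX (writes p)) s t" using t(3) by (simp add: agrees_off_def)
    define i where "i = t VTX 0"
    have i: "i < n" using t(2) agrees_offD[OF off, of INFO] assms(1,2) by (simp add: i_def)
    obtain T where "runs p t T (\<lambda>t'. J (Suc i) t' \<and> T + \<Phi> t' \<le> \<Phi> t + c)"
      using step[OF i i_def[symmetric] _ off] t(1) by (auto simp: i_def)
    then have "runs (Seq p (incr VTX)) t (T + cost (incr VTX)) (?Q t (T + cost (incr VTX)))"
    proof (rule runs_Seq)
      fix t' assume t': "J (Suc i) t' \<and> T + \<Phi> t' \<le> \<Phi> t + c" "agrees_off (writes p) t t'"
      have "t' VTX 0 = i" using agrees_offD[OF t'(2) assms(3)] by (simp add: i_def)
      moreover have "n - i = Suc (n - Suc i)" using i by simp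
      ultimately show "runs (incr VTX) t' (cost (incr VTX)) (?Q t (T + cost (incr VTX)))"
        using t'(1) i by (intro runs_loop_free) (simp_all add: J \<Phi> i_def[symmetric])
    qed
    then show "\<exists>T. runs (Seq p (incr VTX)) t T (?Q t T)" by blast
  qed (use assms(4) in \<open>simp only: J fun_upd_same le0 simp_thms\<close>)
  then have "runs (Loop ?b (Seq p (incr VTX))) ?s (1 + acost ?b + ?\<Psi> ?s) (J n)"
  proof (rule runs_mono[OF runs_agrees_off])
    fix t assume t: "(?I t \<and> aval ?b t = 0) \<and> agrees_off (writes (Loop ?b (Seq p (incr VTX)))) ?s t"
    then have "t INFO = s INFO" using assms(2) by (simp add: agrees_off_def)
    then have "t VTX 0 = n" using t assms(1) by simp
    then show "J n t" using t by simp
  qed simp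
  then have "runs (for_vertices p) s (cost (set_var VTX (Const 0)) + (1 + acost ?b + ?\<Psi> ?s)) (J n)"
    unfolding for_vertices_def by (intro runs_Seq_loop_free) simp_all
  then show ?thesis by (rule runs_mono) (simp_all add: \<Phi>)
qed

corollary runs_for_vertices_loop_free:
  assumes "s INFO 0 = n" "INFO \<notin> writes p" "VTX \<notin> writes p" "loop_free p" "J 0 s"
    and J: "\<And>i t f. J i (t(VTX := f)) \<longleftrightarrow> J i t"
    and step: "\<And>i t. i < n \<Longrightarrow> t VTX 0 = i \<Longrightarrow> J i t \<Longrightarrow> agrees_off (insert VTX (writes p)) s t \<Longrightarrow>
      J (Suc i) (effect p t)"
  shows "runs (for_vertices p) s (9 + (12 + cost p) * n) (J n)"
proof (rule runs_mono)
  show "runs (for_vertices p) s (9 + (12 + cost p) * n + 0) (J n)"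
  proof (rule runs_for_vertices[where J = J, OF assms(1-3,5) J])
    fix i t assume "i < n" "t VTX 0 = i" "J i t" "agrees_off (insert VTX (writes p)) s t"
    then show "\<exists>T. runs p t T (\<lambda>t'. J (Suc i) t' \<and> T + 0 \<le> 0 + cost p)"
      using step by (intro exI[of _ "cost p"] runs_loop_free[OF assms(4)]) auto
  qed simp
qed simp_all

text \<open>
  The iteration is unrolled for lists of length at most four, so that loop bodies containing it take
  constant time.
\<close>

definition adj_item :: "nat \<Rightarrow> nat \<Rightarrow> nat \<Rightarrow> com \<Rightarrow> nat \<Rightarrow> com" where
  "adj_item off dat w p i =
     Cond (Sub (Sub (Cell off (Add (var CUR) (Const 1))) (Cell off (var CUR))) (Const i))
       (Seq (set_var w (Cell dat (Add (Cell off (var CUR)) (Const i)))) p) Skip"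

definition for_adj :: "nat \<Rightarrow> nat \<Rightarrow> nat \<Rightarrow> com \<Rightarrow> com" where
  "for_adj off dat w p = Seq (adj_item off dat w p 0) (Seq (adj_item off dat w p 1)
     (Seq (adj_item off dat w p 2) (adj_item off dat w p 3)))"

lemma loop_free_for_adj [simp]: "loop_free (for_adj off dat w p) \<longleftrightarrow> loop_free p"
  by (auto simp: for_adj_def adj_item_def)

lemma writes_for_adj [simp]: "writes (for_adj off dat w p) = insert w (writes p)"
  by (auto simp: for_adj_def adj_item_def)

lemma array_of_offsets: "v \<le> length adj \<Longrightarrow> array_of (offsets adj) v = length (concat (take v adj))"
  by (simp add: array_of_def offsets_def nth_append del: upt_Suc)

lemma array_of_offsets_Suc:
  "v < length adj \<Longrightarrow> array_of (offsets adj) (Suc v) = array_of (offsets adj) v + length (adj ! v)"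
  by (simp add: array_of_offsets take_Suc_conv_app_nth)

lemma array_of_concat:
  assumes "v < length adj" "i < length (adj ! v)"
  shows "array_of (concat adj) (array_of (offsets adj) v + i) = adj ! v ! i"
proof -
  have "concat adj = concat (take v adj) @ adj ! v @ concat (drop (Suc v) adj)"
    using id_take_nth_drop[OF assms(1)] by (metis concat.simps(2) concat_append)
  then show ?thesis
    unfolding array_of_offsets[OF less_imp_le[OF assms(1)]] using assms(2)
    by (simp add: array_of_def nth_append)
qed

lemma effect_for_adj:
  assumes off: "s off = array_of (offsets adj)" and dat: "s dat = array_of (concat adj)"
    and v: "s CUR 0 = v" "v < length adj" "length (adj ! v) \<le> 4" "distinct (adj ! v)"
    and frame: "{off, dat, CUR} \<inter> insert w (writes p) = {}"
    and init: "I {} s"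
    and step: "\<And>D x t. x \<in> set (adj ! v) \<Longrightarrow> D \<subseteq> set (adj ! v) \<Longrightarrow> x \<notin> D \<Longrightarrow> I D t \<Longrightarrow>
      agrees_off (insert w (writes p)) s t \<Longrightarrow> I (insert x D) (effect p (store_var t w x))"
  shows "I (set (adj ! v)) (effect (for_adj off dat w p) s)"
proof -
  let ?xs = "adj ! v"
  define J where "J i t \<longleftrightarrow> I (set (take i ?xs)) t \<and> agrees_off (insert w (writes p)) s t" for i t
  have item: "J (Suc i) (effect (adj_item off dat w p i) t)" if "J i t" for i t
  proof -
    have eqs: "t off = s off" "t dat = s dat" "t CUR = s CUR"
      using that frame agrees_offD by (fastforce simp: J_def)+
    have deg: "s off (Suc v) - s off v = length ?xs" using v by (simp add: off array_of_offsets_Suc)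
    show ?thesis
    proof (cases "i < length ?xs")
      case True
      have x: "s dat (s off v + i) = ?xs ! i" using v True by (simp add: off dat array_of_concat)
      have "effect (adj_item off dat w p i) t = effect p (store_var t w (?xs ! i))"
        using True deg x v eqs by (simp add: adj_item_def)
      moreover have "I (insert (?xs ! i) (set (take i ?xs))) (effect p (store_var t w (?xs ! i)))"
        using that True v(4) unfolding J_def
        by (intro step) (auto simp: in_set_conv_nth nth_eq_iff_index_eq dest: in_set_takeD)
      moreover have "agrees_off (insert w (writes p)) s (effect p (store_var t w (?xs ! i)))"
        using that effect_agrees_off[of p "store_var t w (?xs ! i)"]
        by (auto simp: J_def agrees_off_def)
      ultimately show ?thesis using True by (simp add: J_def take_Suc_conv_app_nth)
    next
      case False
      then have "effect (adj_item off dat w p i) t = t" using deg v eqs by (simp add: adj_item_def)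
      then show ?thesis using that False by (simp add: J_def)
    qed
  qed
  have "J 0 s" by (simp add: J_def init)
  then have "J 4 (effect (for_adj off dat w p) s)"
    unfolding for_adj_def using item[of 0] item[of 1] item[of 2] item[of 3]
    by (simp add: numeral_eq_Suc)
  then show ?thesis using v by (simp add: J_def)
qed

definition for_neighbors :: "com \<Rightarrow> com" where
  "for_neighbors = for_adj G_OFF G_ADJ NBR"

definition for_backbone :: "nat \<Rightarrow> com \<Rightarrow> com" where
  "for_backbone = for_adj H_OFF H_ADJ"

lemma loop_free_for_neighbors [simp]: "loop_free (for_neighbors p) \<longleftrightarrow> loop_free p"
  and writes_for_neighbors [simp]: "writes (for_neighbors p) = insert NBR (writes p)"
  and loop_free_for_backbone [simp]: "loop_free (for_backbone w p) \<longleftrightarrow> loop_free p"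
  and writes_for_backbone [simp]: "writes (for_backbone w p) = insert w (writes p)"
  by (simp_all add: for_neighbors_def for_backbone_def)

locale input = bounded_backbone G H for G H :: "nat ugraph" +
  fixes lam :: nat and adjG adjH :: "nat list list"
  assumes adjG: "adjacency_lists G adjG" and adjH: "adjacency_lists H adjH"
begin

abbreviation n :: nat where "n \<equiv> card V"

lemma length_adj [simp]: "length adjG = n" "length adjH = n"
  and V_eq: "V = {..<n}"
proof -
  show "length adjG = n" using adjG by (simp add: adjacency_lists_def)
  then show "V = {..<n}" using adjG by (simp add: adjacency_lists_def)
  show "length adjH = n" using adjH spanning
    by (simp add: adjacency_lists_def spanning_subgraph_def) (metis card_lessThan)
qed

lemma in_V_iff: "v \<in> V \<longleftrightarrow> v < n"
  using V_eq by auto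

lemma adj_nth:
  assumes "v < n"
  shows "set (adjG ! v) = N v" "distinct (adjG ! v)" "length (adjG ! v) = card (N v)"
    "set (adjH ! v) = B v" "distinct (adjH ! v)" "length (adjH ! v) = card (B v)"
proof -
  show "set (adjG ! v) = N v" "distinct (adjG ! v)" "set (adjH ! v) = B v" "distinct (adjH ! v)"
    using adjG adjH assms length_adj by (auto simp: adjacency_lists_def neighbors_def)
  then show "length (adjG ! v) = card (N v)" "length (adjH ! v) = card (B v)"
    by (metis distinct_card)+
qed

definition has_input :: "store \<Rightarrow> bool" where
  "has_input s \<longleftrightarrow> agrees_off {5..} (input_store lam adjG adjH) s"

lemma has_inputD:
  assumes "has_input s"
  shows "s INFO 0 = n" "s INFO (Suc 0) = lam" "s (Suc 0) = array_of (offsets adjG)"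
    "s G_ADJ = array_of (concat adjG)"
    "s H_OFF = array_of (offsets adjH)" "s H_ADJ = array_of (concat adjH)"
  using assms by (auto simp: has_input_def agrees_off_def input_store_def array_of_def)

lemma has_input_store: "has_input (input_store lam adjG adjH)"
  by (simp add: has_input_def)

lemma has_input_agrees_off: "has_input s \<Longrightarrow> agrees_off X s t \<Longrightarrow> X \<subseteq> {5..} \<Longrightarrow> has_input t"
  unfolding has_input_def by (erule agrees_off_trans) auto

lemma has_input_update [simp]: "5 \<le> k \<Longrightarrow> has_input (s(k := f)) \<longleftrightarrow> has_input s"
  by (auto simp: has_input_def agrees_off_def)

lemma degree_cells:
  assumes "has_input s" "v < n"
  shows "s (Suc 0) (Suc v) - s (Suc 0) v = card (N v)" "s H_OFF (Suc v) - s H_OFF v = card (B v)"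
  using assms by (simp_all add: has_inputD array_of_offsets_Suc adj_nth)

lemma effect_for_neighbors:
  assumes "has_input s" "s CUR 0 = v" "v \<in> V" "writes p \<subseteq> {5..} - {CUR}" "I {} s"
    and "\<And>D x t. x \<in> N v \<Longrightarrow> D \<subseteq> N v \<Longrightarrow> x \<notin> D \<Longrightarrow> I D t \<Longrightarrow>
      agrees_off (insert NBR (writes p)) s t \<Longrightarrow> I (insert x D) (effect p (store_var t NBR x))"
  shows "I (N v) (effect (for_neighbors p) s)"
proof -
  have "v < n" using assms(3) by (simp add: in_V_iff)
  note adj = adj_nth[OF this]
  show ?thesis unfolding for_neighbors_def adj(1)[symmetric]
  proof (rule effect_for_adj)
    show "s G_OFF = array_of (offsets adjG)" "s G_ADJ = array_of (concat adjG)"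
      using has_inputD[OF assms(1)] by simp_all
    show "I (insert x D) (effect p (store_var t NBR x))"
      if "x \<in> set (adjG ! v)" "D \<subseteq> set (adjG ! v)" "x \<notin> D" "I D t"
        "agrees_off (insert NBR (writes p)) s t" for D x t
      using assms(6) that unfolding adj(1) by blast
    show "{G_OFF, G_ADJ, CUR} \<inter> insert NBR (writes p) = {}" using assms(4) by auto
  qed (simp_all add: assms(2,5) adj card_N \<open>v < n\<close>)
qed

lemma effect_for_backbone:
  assumes "has_input s" "s CUR 0 = v" "v \<in> V" "writes p \<subseteq> {5..} - {CUR}" "w \<in> {5..} - {CUR}" "I {} s"
    and "\<And>D x t. x \<in> B v \<Longrightarrow> D \<subseteq> B v \<Longrightarrow> x \<notin> D \<Longrightarrow> I D t \<Longrightarrow>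
      agrees_off (insert w (writes p)) s t \<Longrightarrow> I (insert x D) (effect p (store_var t w x))"
  shows "I (B v) (effect (for_backbone w p) s)"
proof -
  have "v < n" using assms(3) by (simp add: in_V_iff)
  note adj = adj_nth[OF this]
  have "card (B v) \<le> 4" using card_mono[OF finite_N B_subset, of v] card_N[of v] by simp
  show ?thesis unfolding for_backbone_def adj(4)[symmetric]
  proof (rule effect_for_adj)
    show "s H_OFF = array_of (offsets adjH)" "s H_ADJ = array_of (concat adjH)"
      using has_inputD[OF assms(1)] by simp_all
    show "I (insert x D) (effect p (store_var t w x))"
      if "x \<in> set (adjH ! v)" "D \<subseteq> set (adjH ! v)" "x \<notin> D" "I D t"
        "agrees_off (insert w (writes p)) s t" for D x t
      using assms(7) that unfolding adj(4) by blast
    show "{H_OFF, H_ADJ, CUR} \<inter> insert w (writes p) = {}" using assms(4,5) by auto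
  qed (simp_all add: assms(2,6) adj \<open>v < n\<close> \<open>card (B v) \<le> 4\<close>)
qed

end

section \<open>The two passes as a program\<close>

abbreviation (input) OUT :: nat where "OUT \<equiv> 5"
abbreviation (input) COL :: nat where "COL \<equiv> 6"
abbreviation (input) LOW :: nat where "LOW \<equiv> 7"
abbreviation (input) HIGH :: nat where "HIGH \<equiv> 8"
abbreviation (input) ORD :: nat where "ORD \<equiv> 9"
abbreviation (input) FORB :: nat where "FORB \<equiv> 10"
abbreviation (input) TAB :: nat where "TAB \<equiv> 11"
abbreviation (input) FLAG :: nat where "FLAG \<equiv> 22"
abbreviation (input) MATE :: nat where "MATE \<equiv> 23"
abbreviation (input) POS :: nat where "POS \<equiv> 24"
abbreviation (input) PICK :: nat where "PICK \<equiv> 25"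
abbreviation (input) LEN :: nat where "LEN \<equiv> 26"

definition clear :: com where
  "clear = Seq (Assign FORB (Const 1) (Const 0)) (Seq (Assign FORB (Const 2) (Const 0))
     (Seq (Assign FORB (Const 3) (Const 0)) (Seq (Assign FORB (Const 4) (Const 0))
     (Seq (Assign FORB (Const 5) (Const 0)) (Assign FORB (Const 6) (Const 0))))))"

definition test_backbone :: com where
  "test_backbone = Seq (set_var FLAG (Const 0))
     (for_backbone MATE (Cond (neq (var MATE) (var NBR)) Skip (set_var FLAG (Const 1))))"

definition mark :: com where
  "mark = Seq test_backbone
     (Cond (Cell COL (var NBR))
       (Seq (Assign FORB (Cell COL (var NBR)) (Const 1))
         (Cond (var FLAG)
           (Seq (Assign FORB (Add (Cell COL (var NBR)) (Const 1)) (Const 1))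
                (Assign FORB (Sub (Cell COL (var NBR)) (Const 1)) (Const 1))) Skip))
       (Cond (Cell LOW (var NBR))
         (Cond (var FLAG)
           (Seq (Assign FORB (Add (Cell LOW (var NBR)) (Const 1)) (Const 1))
                (Assign FORB (Cell HIGH (var NBR)) (Const 1)))
           (Assign FORB (Cell LOW (var NBR)) (Const 1))) Skip))"

fun pick :: "nat \<Rightarrow> nat \<Rightarrow> com" where
  "pick c 0 = set_var PICK (Const c)"
| "pick c (Suc k) = Cond (Cell FORB (Const c)) (pick (Suc c) k) (set_var PICK (Const c))"

definition choose_color :: "nat \<Rightarrow> com" where
  "choose_color K = Seq clear (Seq (for_neighbors mark) (pick 1 (K - 1)))"

definition elimination_step :: "nat \<Rightarrow> com" where
  "elimination_step K = Seq (set_var POS (Sub (var POS) (Const 1))) (Seq (set_var CUR (Cell ORD (var POS)))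
     (Seq (choose_color K) (Seq (Assign LOW (var CUR) (var PICK))
     (Cond (if 6 \<le> K then Const 1 else Cell FORB (Add (var PICK) (Const 1)))
        (Assign HIGH (var CUR) (Add (var PICK) (Const 1))) (Assign HIGH (var CUR) (var PICK))))))"

definition elimination_pass :: "nat \<Rightarrow> com" where
  "elimination_pass K = Seq (set_var POS (var LEN)) (Loop (var POS) (elimination_step K))"

definition paint_step :: "nat \<Rightarrow> com" where
  "paint_step K = Seq (set_var CUR (Cell ORD (var POS))) (Seq (choose_color K)
     (Seq (Assign COL (var CUR) (var PICK)) (incr POS)))"

definition paint_pass :: "nat \<Rightarrow> com" where
  "paint_pass K = Seq (set_var POS (Const 0)) (Loop (Sub (var LEN) (var POS)) (paint_step K))"

definition fill_table :: com where
  "fill_table = Seq (Assign TAB (Const 1) (Const 1)) (Seq (Assign TAB (Const 2) (Const 2))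
     (Seq (Assign TAB (Const 3) (Add (Cell INFO (Const 1)) (Const 1)))
     (Seq (Assign TAB (Const 4) (Add (Cell INFO (Const 1)) (Const 2)))
     (Seq (Assign TAB (Const 5) (Add (Add (Cell INFO (Const 1)) (Cell INFO (Const 1))) (Const 1)))
     (Assign TAB (Const 6) (Add (Add (Cell INFO (Const 1)) (Cell INFO (Const 1))) (Const 2)))))))"

definition write_color :: com where
  "write_color = Assign OUT (var VTX) (Cell TAB (Cell COL (var VTX)))"

definition write_colors :: com where
  "write_colors = Seq fill_table (for_vertices write_color)"

definition two_pass :: "nat \<Rightarrow> com" where
  "two_pass K = Seq (elimination_pass K) (Seq (paint_pass K) write_colors)"

definition elimination_cost :: "nat \<Rightarrow> nat \<Rightarrow> nat" where
  "elimination_cost K m = 5 + (3 + cost (elimination_step K)) * (m + 1)"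

definition paint_cost :: "nat \<Rightarrow> nat \<Rightarrow> nat" where
  "paint_cost K m = 3 + (6 + cost (paint_step K)) * (m + 1)"

definition write_cost :: "nat \<Rightarrow> nat" where
  "write_cost m = cost fill_table + (9 + (12 + cost write_color) * m)"

definition two_pass_cost :: "nat \<Rightarrow> nat" where
  "two_pass_cost K = 12 + elimination_cost K 0 + paint_cost K 0 + write_cost 0 + cost write_color"

lemma loop_free_pick [simp]: "loop_free (pick c k)"
  and writes_pick [simp]: "writes (pick c k) = {PICK}"
  by (induction k arbitrary: c) auto

lemma loop_free_test_backbone [simp]: "loop_free test_backbone"
  and writes_test_backbone [simp]: "writes test_backbone = {FLAG, MATE}"
  by (auto simp: test_backbone_def)

lemma loop_free_mark [simp]: "loop_free mark"
  and writes_mark [simp]: "writes mark = {FORB, FLAG, MATE}"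
  by (auto simp: mark_def)

lemma writes_clear [simp]: "writes clear = {FORB}"
  by (auto simp: clear_def)

lemma loop_free_choose_color [simp]: "loop_free (choose_color K)"
  and writes_choose_color [simp]: "writes (choose_color K) = {FORB, NBR, FLAG, MATE, PICK}"
  by (auto simp: choose_color_def clear_def)

lemma loop_free_elimination_step [simp]: "loop_free (elimination_step K)"
  and writes_elimination_step [simp]:
    "writes (elimination_step K) = {LOW, HIGH, FORB, CUR, NBR, FLAG, MATE, POS, PICK}"
  by (auto simp: elimination_step_def)

lemma loop_free_paint_step [simp]: "loop_free (paint_step K)"
  and writes_paint_step [simp]: "writes (paint_step K) = {COL, FORB, CUR, NBR, FLAG, MATE, POS, PICK}"
  by (auto simp: paint_step_def)

lemma writes_passes [simp]:
  "writes (elimination_pass K) = {LOW, HIGH, FORB, CUR, NBR, FLAG, MATE, POS, PICK}"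
  "writes (paint_pass K) = {COL, FORB, CUR, NBR, FLAG, MATE, POS, PICK}"
  by (auto simp: elimination_pass_def paint_pass_def)

lemma effect_pick: "effect (pick c k) s PICK 0 = Min (insert (c + k) {d \<in> {c..c + k}. s FORB d = 0})"
proof (induction k arbitrary: c)
  case 0
  have "Min (insert (c + 0) {d \<in> {c..c + 0}. s FORB d = 0}) = c" by (intro Min_eqI) auto
  then show ?case by simp
next
  case (Suc k)
  show ?case
  proof (cases "s FORB c = 0")
    case True
    then have "Min (insert (c + Suc k) {d \<in> {c..c + Suc k}. s FORB d = 0}) = c"
      by (intro Min_eqI) auto
    then show ?thesis using True by simp
  next
    case False
    then have "{d \<in> {c..c + Suc k}. s FORB d = 0} = {d \<in> {Suc c..Suc c + k}. s FORB d = 0}"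
      by (auto simp: le_less Suc_le_eq)
    then show ?thesis using False Suc.IH[of "Suc c"] by simp
  qed
qed

definition stretch :: "nat \<Rightarrow> nat \<Rightarrow> nat" where
  "stretch lam c = (if c \<le> 2 then c else if c \<le> 4 then lam + (c - 2) else 2 * lam + (c - 4))"

lemma atLeastAtMost_1_6: "{1..6::nat} = {1, 2, 3, 4, 5, 6}"
  by auto

lemma stretch_range:
  assumes "2 \<le> lam" "c \<in> {1..K}" "K \<in> {5, 6}"
  shows "stretch lam c \<in> {1..2 * lam + (K - 4)}"
  using assms by (auto simp: stretch_def)

lemma stretch_no_conflict:
  assumes "2 \<le> lam" "c \<in> {1..6}" "d \<in> {1..6}" "\<not> conflict h c d"
  shows "stretch lam c \<noteq> stretch lam d \<and> (h \<longrightarrow> int lam \<le> \<bar>int (stretch lam c) - int (stretch lam d)\<bar>)"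
  using assms unfolding atLeastAtMost_1_6
  by (elim insertE emptyE; cases h; simp add: stretch_def conflict_def)

lemma (in backbone) backbone_k_coloring_stretch:
  assumes "2 \<le> lam" "K \<in> {5, 6}" "conflict_free col"
    and col: "\<And>v. v \<in> V \<Longrightarrow> col v \<in> {1..K} \<and> c v = stretch lam (col v)"
  shows "backbone_k_coloring lam (2 * lam + (K - 4)) G H c"
proof -
  have "c u \<noteq> c v \<and> ({u, v} \<in> edges H \<longrightarrow> int lam \<le> \<bar>int (c u) - int (c v)\<bar>)"
    if "{u, v} \<in> edges G" for u v
  proof -
    have v: "v \<in> N u" using that by (simp add: neighbors_def)
    then have uv: "u \<in> V" "v \<in> V" using N_D by auto
    then have "col u \<in> {1..6}" "col v \<in> {1..6}" "col u \<noteq> 0" "col v \<noteq> 0" using col assms(2) by fastforce+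
    then show ?thesis
      using stretch_no_conflict[OF assms(1), of "col u" "col v" "v \<in> B u"] assms(3) v col uv
      by (simp add: conflict_free_def neighbors_def)
  qed
  moreover have "c v \<in> {1..2 * lam + (K - 4)}" if "v \<in> V" for v
    using col[OF that] stretch_range[OF assms(1)] assms(2) by auto
  ultimately show ?thesis using spanning
    unfolding backbone_k_coloring_def backbone_coloring_def spanning_subgraph_def by auto
qed

context input
begin

lemma effect_test_backbone:
  assumes "has_input s" "s CUR 0 = v" "v \<in> V" "s NBR 0 = w"
  shows "effect test_backbone s FLAG 0 \<noteq> 0 \<longleftrightarrow> w \<in> B v"
proof -
  let ?p = "Cond (neq (var MATE) (var NBR)) Skip (set_var FLAG (Const 1))"
  let ?I = "\<lambda>D t. t FLAG 0 \<noteq> (0::nat) \<longleftrightarrow> w \<in> D"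
  have "?I (B v) (effect (for_backbone MATE ?p) (store_var s FLAG 0))"
  proof (rule effect_for_backbone)
    show "has_input (store_var s FLAG 0)" using assms(1) by simp
    fix D x t assume "?I D t" "agrees_off (insert MATE (writes ?p)) (store_var s FLAG 0) t"
    then show "?I (insert x D) (effect ?p (store_var t MATE x))"
      using assms(4) by (auto simp: agrees_off_def)
  qed (use assms in auto)
  then show ?thesis by (simp add: test_backbone_def)
qed

lemma effect_mark:
  assumes "has_input s" "s CUR 0 = v" "v \<in> V" "s NBR 0 = w"
  shows "effect mark s FORB c \<noteq> 0 \<longleftrightarrow> s FORB c \<noteq> 0 \<or> excludes (s COL) (s LOW) (s HIGH) v w c"
proof -
  let ?t = "effect test_backbone s"
  have eqs: "?t COL = s COL" "?t LOW = s LOW" "?t HIGH = s HIGH" "?t FORB = s FORB" "?t NBR = s NBR"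
    by (simp_all add: effect_other)
  have flag: "?t FLAG 0 = 0 \<longleftrightarrow> w \<notin> B v" using effect_test_backbone[OF assms] by auto
  have "c = s COL w - Suc 0 \<longleftrightarrow> s COL w = Suc c" if "s COL w \<noteq> 0" using that by auto
  then show ?thesis
    by (cases "s COL w = 0"; cases "s LOW w = 0"; cases "w \<in> B v";
        simp add: mark_def excludes_def conflict_def eqs assms(4) flag)
qed

lemma effect_choose_color:
  assumes "has_input s" "s CUR 0 = v" "v \<in> V" "1 \<le> K" "K \<le> 6"
  shows "c \<in> {1..6} \<Longrightarrow>
      effect (choose_color K) s FORB c \<noteq> 0 \<longleftrightarrow> (\<exists>w\<in>N v. excludes (s COL) (s LOW) (s HIGH) v w c)"
    and "effect (choose_color K) s PICK 0 = least_avail K (s COL) (s LOW) (s HIGH) v"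
proof -
  let ?s = "effect clear s"
  let ?t = "effect (for_neighbors mark) ?s"
  let ?excl = "\<lambda>w. excludes (s COL) (s LOW) (s HIGH) v w"
  have clear: "agrees_off {FORB} s ?s" using effect_agrees_off[of clear s] by simp
  let ?I = "\<lambda>D t. \<forall>c\<in>{1..6}. t FORB c \<noteq> (0::nat) \<longleftrightarrow> (\<exists>w\<in>D. ?excl w c)"
  have "?I (N v) ?t"
  proof (rule effect_for_neighbors)
    show "has_input ?s" by (rule has_input_agrees_off[OF assms(1) clear]) simp
    show "?s CUR 0 = v" using assms(2) agrees_offD[OF clear] by simp
    show "?I {} ?s" unfolding atLeastAtMost_1_6 by (simp add: clear_def)
    fix D x t assume x: "x \<in> N v" and I: "?I D t" and t: "agrees_off (insert NBR (writes mark)) ?s t"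
    have off: "agrees_off {FORB, NBR, FLAG, MATE} s t" by (rule agrees_off_trans[OF clear t]) auto
    define u where "u = store_var t NBR x"
    have u: "has_input u" "u CUR 0 = v" "u NBR 0 = x"
      using has_input_agrees_off[OF assms(1) off] agrees_offD[OF off] assms(2) by (auto simp: u_def)
    have "u COL = s COL" "u LOW = s LOW" "u HIGH = s HIGH" "u FORB = t FORB"
      using agrees_offD[OF off] by (simp_all add: u_def)
    then show "?I (insert x D) (effect mark (store_var t NBR x))"
      using I effect_mark[OF u(1,2) assms(3) u(3)] unfolding u_def[symmetric] by auto
  qed (use assms in auto)
  then have forb: "?t FORB c \<noteq> 0 \<longleftrightarrow> (\<exists>w\<in>N v. ?excl w c)" if "c \<in> {1..6}" for c using that by blast
  have eff: "effect (choose_color K) s = effect (pick 1 (K - 1)) ?t" by (simp add: choose_color_def)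
  show "effect (choose_color K) s FORB c \<noteq> 0 \<longleftrightarrow> (\<exists>w\<in>N v. ?excl w c)" if "c \<in> {1..6}"
    using forb[OF that] by (simp add: eff effect_other)
  have "{d \<in> {1..K}. ?t FORB d = 0} = avail K (s COL) (s LOW) (s HIGH) v"
    using forb assms(5) by (force simp: avail_def)
  then show "effect (choose_color K) s PICK 0 = least_avail K (s COL) (s LOW) (s HIGH) v"
    unfolding eff effect_pick least_avail_def using assms(4) by simp
qed

lemma effect_elimination_step:
  assumes "has_input s" "s POS 0 = Suc j" "s ORD j = v" "v \<in> V" "1 \<le> K" "K \<le> 6"
    and elim: "eliminate K (s COL) es = (s LOW, s HIGH)"
  shows "effect (elimination_step K) s POS 0 = j"
    and "eliminate K (s COL) (v # es) =
      (effect (elimination_step K) s LOW, effect (elimination_step K) s HIGH)"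
proof -
  let ?s = "s(POS := (s POS)(0 := j), CUR := (s CUR)(0 := v))"
  define t where "t = effect (choose_color K) ?s"
  define c where "c = least_avail K (s COL) (s LOW) (s HIGH) v"
  let ?b = "if 6 \<le> K then Const 1 else Cell FORB (Add (var PICK) (Const 1))"
  have "has_input ?s" using assms(1) by simp
  note ch = effect_choose_color[OF this _ assms(4-6), folded t_def, simplified]
  have eqs: "t LOW = s LOW" "t HIGH = s HIGH" "t POS 0 = j" "t CUR 0 = v" "t PICK 0 = c"
    using ch(2) by (simp_all add: t_def effect_other c_def)
  have "c + 1 \<in> {1..6}" if "\<not> 6 \<le> K"
    using least_avail_range[OF assms(5), of "s COL" "s LOW" "s HIGH" v, folded c_def] that by auto
  then have test: "aval ?b (t(LOW := (t LOW)(v := c))) \<noteq> 0 \<longleftrightarrow>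
      6 \<le> K \<or> (\<exists>w\<in>N v. excludes (s COL) (s LOW) (s HIGH) v w (c + 1))"
    using ch(1)[of "Suc c"] by (auto simp: eqs)
  have step: "effect (elimination_step K) s =
      effect (Cond ?b (Assign HIGH (var CUR) (Add (var PICK) (Const 1))) (Assign HIGH (var CUR) (var PICK)))
        (t(LOW := (t LOW)(v := c)))"
    using assms(2,3) by (simp add: elimination_step_def t_def[symmetric] eqs)
  show "effect (elimination_step K) s POS 0 = j" by (simp add: step eqs)
  show "eliminate K (s COL) (v # es) =
      (effect (elimination_step K) s LOW, effect (elimination_step K) s HIGH)"
    unfolding step effect.simps(4) test prod_eq_iff low_Cons high_Cons elim
    by (auto simp: eqs c_def Let_def fun_eq_iff)
qed

lemma runs_elimination_pass:
  assumes "has_input s" "s LOW = (\<lambda>_. 0)" "s HIGH = (\<lambda>_. 0)" "s LEN 0 = m" "1 \<le> K" "K \<le> 6"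
    and vs: "vs = map (s ORD) [0..<m]" "set vs \<subseteq> V"
  shows "runs (elimination_pass K) s (elimination_cost K m)
    (\<lambda>t. eliminate K (s COL) vs = (t LOW, t HIGH))"
proof -
  let ?I = "\<lambda>t. t POS 0 \<le> m \<and> eliminate K (s COL) (drop (t POS 0) vs) = (t LOW, t HIGH)"
  let ?p = "elimination_step K" and ?s = "store_var s POS m"
  have "runs (Loop (var POS) ?p) ?s ((1 + acost (var POS) + cost ?p) * (?s POS 0 + 1))
      (\<lambda>t. ?I t \<and> aval (var POS) t = 0)"
  proof (rule runs_Loop_loop_free[where \<mu> = "\<lambda>t. t POS 0"])
    show "?I ?s" using assms(2,3) vs(1) by simp
    fix t assume t: "?I t" "aval (var POS) t \<noteq> 0" "agrees_off (writes ?p) ?s t"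
    have off: "agrees_off (writes ?p) s t" using t(3) by (simp add: agrees_off_def)
    obtain j where j: "t POS 0 = Suc j" "j < m" using t(1,2) by (cases "t POS 0") auto
    have eqs: "t ORD = s ORD" "t COL = s COL" using agrees_offD[OF off] by simp_all
    have len: "length vs = m" and nth: "vs ! j = s ORD j" using vs(1) j(2) by auto
    have inp: "has_input t" by (rule has_input_agrees_off[OF assms(1) off]) auto
    have ordV: "s ORD j \<in> V" using vs(2) len nth j(2) by (metis nth_mem subsetD)
    have "eliminate K (t COL) (drop (Suc j) vs) = (t LOW, t HIGH)" using t(1) j(1) by (simp add: eqs)
    note effect_elimination_step[OF inp j(1) _ ordV assms(5,6) this, unfolded eqs, OF refl]
    moreover have "drop j vs = s ORD j # drop (Suc j) vs"
      using Cons_nth_drop_Suc[of j vs] len nth j(2) by simp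
    ultimately show "?I (effect ?p t) \<and> effect ?p t POS 0 < t POS 0" using j by simp
  qed simp
  then have "runs (elimination_pass K) s
      (cost (set_var POS (var LEN)) + (1 + acost (var POS) + cost ?p) * (?s POS 0 + 1))
      (\<lambda>t. ?I t \<and> aval (var POS) t = 0)"
    unfolding elimination_pass_def using assms(4) by (intro runs_Seq_loop_free) simp_all
  then show ?thesis by (rule runs_mono) (auto simp: elimination_cost_def algebra_simps)
qed

lemma effect_paint_step:
  assumes "has_input s" "s POS 0 = j" "s ORD j = v" "v \<in> V" "1 \<le> K" "K \<le> 6"
  shows "effect (paint_step K) s POS 0 = Suc j"
    and "effect (paint_step K) s COL = (s COL)(v := least_avail K (s COL) (s LOW) (s HIGH) v)"
proof -
  let ?s = "store_var s CUR v"
  define t where "t = effect (choose_color K) ?s"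
  have "has_input ?s" using assms(1) by simp
  note ch = effect_choose_color(2)[OF this _ assms(4-6), folded t_def, simplified]
  have eqs: "t POS 0 = j" "t CUR 0 = v" "t COL = s COL"
    using assms(2) by (simp_all add: t_def effect_other)
  have "effect (paint_step K) s = store_var (t(COL := (t COL)(v := t PICK 0))) POS (Suc j)"
    using assms(2,3) by (simp add: paint_step_def t_def[symmetric] eqs)
  then show "effect (paint_step K) s POS 0 = Suc j"
    "effect (paint_step K) s COL = (s COL)(v := least_avail K (s COL) (s LOW) (s HIGH) v)"
    by (simp_all add: eqs ch)
qed

lemma runs_paint_pass:
  assumes "has_input s" "s LEN 0 = m" "1 \<le> K" "K \<le> 6" and vs: "vs = map (s ORD) [0..<m]" "set vs \<subseteq> V"
  shows "runs (paint_pass K) s (paint_cost K m)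
    (\<lambda>t. t COL = paint K (s LOW) (s HIGH) (s COL) vs)"
proof -
  let ?I = "\<lambda>t. t POS 0 \<le> m \<and> t COL = paint K (s LOW) (s HIGH) (s COL) (take (t POS 0) vs)"
  let ?p = "paint_step K" and ?s = "store_var s POS 0" and ?b = "Sub (var LEN) (var POS)"
  have "runs (Loop ?b ?p) ?s ((1 + acost ?b + cost ?p) * ((m - ?s POS 0) + 1)) (\<lambda>t. ?I t \<and> aval ?b t = 0)"
  proof (rule runs_Loop_loop_free[where \<mu> = "\<lambda>t. m - t POS 0"])
    fix t assume t: "?I t" "aval ?b t \<noteq> 0" "agrees_off (writes ?p) ?s t"
    have off: "agrees_off (writes ?p) s t" using t(3) by (simp add: agrees_off_def)
    have eqs: "t ORD = s ORD" "t LOW = s LOW" "t HIGH = s HIGH" "t LEN = s LEN"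
      using agrees_offD[OF off] by simp_all
    define j where "j = t POS 0"
    have j: "j < m" using t(2) assms(2) by (simp add: eqs j_def)
    have len: "length vs = m" and nth: "vs ! j = s ORD j" using vs(1) j by auto
    have inp: "has_input t" by (rule has_input_agrees_off[OF assms(1) off]) auto
    have ordV: "s ORD j \<in> V" using vs(2) len nth j by (metis nth_mem subsetD)
    note effect_paint_step[OF inp j_def[symmetric] _ ordV assms(3,4), unfolded eqs, OF refl]
    moreover have "take (Suc j) vs = take j vs @ [s ORD j]"
      using len nth j by (simp add: take_Suc_conv_app_nth)
    ultimately show "?I (effect ?p t) \<and> m - effect ?p t POS 0 < m - t POS 0"
      using j t(1) by (simp add: paint_snoc j_def[symmetric] del: fun_upd_apply)
  qed simp_all
  then have "runs (Loop ?b ?p) ?s ((1 + acost ?b + cost ?p) * ((m - ?s POS 0) + 1))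
      (\<lambda>t. t COL = paint K (s LOW) (s HIGH) (s COL) vs)"
  proof (rule runs_mono[OF runs_agrees_off])
    fix t assume t: "(?I t \<and> aval ?b t = 0) \<and> agrees_off (writes (Loop ?b ?p)) ?s t"
    then have "t LEN = s LEN" by (simp add: agrees_off_def)
    then have "t POS 0 = m" using t assms(2) by simp
    then show "t COL = paint K (s LOW) (s HIGH) (s COL) vs" using t vs(1) by simp
  qed simp
  then have "runs (paint_pass K) s
      (cost (set_var POS (Const 0)) + (1 + acost ?b + cost ?p) * ((m - ?s POS 0) + 1))
      (\<lambda>t. t COL = paint K (s LOW) (s HIGH) (s COL) vs)"
    unfolding paint_pass_def by (intro runs_Seq_loop_free) simp_all
  then show ?thesis by (rule runs_mono) (auto simp: paint_cost_def algebra_simps)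
qed

lemma runs_write_colors:
  assumes "has_input s" "\<And>v. v \<in> V \<Longrightarrow> s COL v \<in> {1..6}"
  shows "runs write_colors s (write_cost n) (\<lambda>t. \<forall>v\<in>V. t OUT v = stretch lam (s COL v))"
  unfolding write_colors_def write_cost_def
proof (rule runs_Seq_loop_free)
  let ?s = "effect fill_table s"
  let ?J = "\<lambda>i t. \<forall>v<i. t OUT v = stretch lam (s COL v)"
  have tab: "?s TAB c = stretch lam c" if "c \<in> {1..6}" for c
    using that assms(1) unfolding atLeastAtMost_1_6
    by (auto simp: fill_table_def stretch_def has_inputD)
  have s: "?s COL = s COL" "?s INFO = s INFO" by (simp_all add: effect_other fill_table_def)
  have "runs (for_vertices write_color) ?s (9 + (12 + cost write_color) * n) (?J n)"
  proof (rule runs_for_vertices_loop_free)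
    fix i t assume i: "i < n" "t VTX 0 = i" "?J i t" "agrees_off (insert VTX (writes write_color)) ?s t"
    have "t TAB = ?s TAB" "t COL = s COL"
      using agrees_offD[OF i(4)] s(1) by (simp_all add: write_color_def)
    moreover have "s COL i \<in> {1..6}" using assms(2) i(1) in_V_iff by blast
    ultimately show "?J (Suc i) (effect write_color t)"
      using i(2,3) tab by (auto simp: write_color_def less_Suc_eq)
  qed (use assms(1) in \<open>simp_all add: write_color_def s has_inputD\<close>)
  then show "runs (for_vertices write_color) ?s (9 + (12 + cost write_color) * n)
      (\<lambda>t. \<forall>v\<in>V. t OUT v = stretch lam (s COL v))"
    by (rule runs_mono) (auto simp: in_V_iff)
qed (simp add: fill_table_def)

lemma runs_two_pass:
  assumes s: "has_input s" "s LOW = (\<lambda>_. 0)" "s HIGH = (\<lambda>_. 0)" and K: "K \<in> {5, 6}" and lam: "2 \<le> lam"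
    and vs: "vs = map (s ORD) [0..<s LEN 0]" "distinct vs" "set vs = {v \<in> V. s COL v = 0}"
    and col: "conflict_free (s COL)" "\<And>v. s COL v \<le> K" "at_splits (colorable K (s COL)) vs"
  shows "runs (two_pass K) s (two_pass_cost K * (n + 1))
    (\<lambda>t. backbone_k_coloring lam (2 * lam + (K - 4)) G H (t OUT))"
    (is "runs _ _ _ ?Q")
proof -
  define m where "m = s LEN 0"
  have K': "1 \<le> K" "K \<le> 6" using K by auto
  have V: "set vs \<subseteq> V" using vs(3) by auto
  let ?col = "paint K (low K (s COL) vs) (high K (s COL) vs) (s COL) vs"
  note painted = two_pass_coloring[OF vs(2,3) K'(1) col]
  have "runs (two_pass K) s (elimination_cost K m + (paint_cost K m + write_cost n)) ?Q"
    unfolding two_pass_def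
  proof (rule runs_Seq[OF runs_elimination_pass[OF s m_def[symmetric] K' vs(1)[folded m_def] V]])
    fix t assume t: "eliminate K (s COL) vs = (t LOW, t HIGH)" "agrees_off (writes (elimination_pass K)) s t"
    have eqs: "t ORD = s ORD" "t COL = s COL" "t LEN 0 = m"
      using agrees_offD[OF t(2)] by (simp_all add: m_def)
    have inp: "has_input t" by (rule has_input_agrees_off[OF s(1) t(2)]) auto
    have "vs = map (t ORD) [0..<m]" using vs(1) eqs by (simp add: m_def)
    note pass = runs_paint_pass[OF inp eqs(3) K' this V]
    show "runs (Seq (paint_pass K) write_colors) t (paint_cost K m + write_cost n) ?Q"
    proof (rule runs_Seq[OF pass])
      fix t' assume "t' COL = paint K (t LOW) (t HIGH) (t COL) vs"
        and off: "agrees_off (writes (paint_pass K)) t t'"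
      then have col': "t' COL = ?col" using t(1) eqs by simp
      have "has_input t'" by (rule has_input_agrees_off[OF inp off]) auto
      then show "runs write_colors t' (write_cost n) ?Q"
      proof (rule runs_mono[OF runs_write_colors])
        show "t' COL v \<in> {1..6}" if "v \<in> V" for v using painted(2)[OF that] K' col' by auto
        show "?Q u" if "\<forall>v\<in>V. u OUT v = stretch lam (t' COL v)" for u
          using that painted col' by (intro backbone_k_coloring_stretch[OF lam K painted(1)]) simp
      qed simp
    qed
  qed
  moreover have "m \<le> n"
    using card_mono[OF finite_V V] distinct_card[OF vs(2)] vs(1) by (simp add: m_def)
  then have "elimination_cost K m \<le> elimination_cost K n" "paint_cost K m \<le> paint_cost K n"
    by (simp_all add: elimination_cost_def paint_cost_def)
  ultimately show ?thesis
    by (elim runs_mono)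
      (simp_all add: two_pass_cost_def elimination_cost_def paint_cost_def write_cost_def algebra_simps)
qed

end

section \<open>Forest backbones\<close>

abbreviation (input) VIS :: nat where "VIS \<equiv> 12"
abbreviation (input) FREE :: nat where "FREE \<equiv> 28"
abbreviation (input) COUNT :: nat where "COUNT \<equiv> 29"
abbreviation (input) LAST :: nat where "LAST \<equiv> 30"

definition count_remaining :: com where
  "count_remaining = Seq (set_var COUNT (Const 0))
     (for_backbone NBR (Cond (Cell VIS (var NBR)) Skip (Seq (incr COUNT) (set_var LAST (var NBR)))))"

text \<open>
  The order is filled from its end. After the removal of \<open>var CUR\<close> the only remaining neighbor may have
  become a leaf and is examined next, otherwise the scan proceeds to the next vertex \<open>var VTX\<close>.
\<close>

definition peel_step :: com where
  "peel_step = Seq count_remaining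
     (Cond (Add (Cell VIS (var CUR)) (Sub (var COUNT) (Const 1)))
       (Seq (incr VTX) (set_var CUR (var VTX)))
       (Seq (set_var FREE (Sub (var FREE) (Const 1)))
       (Seq (Assign ORD (var FREE) (var CUR))
       (Seq (Assign VIS (var CUR) (Const 1))
       (Cond (var COUNT) (set_var CUR (var LAST)) Skip)))))"

definition peel :: com where
  "peel = Seq (set_var FREE (var INFO)) (Loop (Sub (var INFO) (var VTX)) peel_step)"

definition forest_program :: com where
  "forest_program = Seq peel (Seq (set_var LEN (var INFO)) (two_pass 6))"

definition forest_cost :: nat where
  "forest_cost = 20 + 2 * cost peel_step + two_pass_cost 6"

lemma loop_free_count_remaining [simp]: "loop_free count_remaining"
  and writes_count_remaining [simp]: "writes count_remaining = {NBR, COUNT, LAST}"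
  by (auto simp: count_remaining_def)

lemma loop_free_peel_step [simp]: "loop_free peel_step"
  and writes_peel_step [simp]: "writes peel_step = {ORD, VIS, CUR, NBR, VTX, FREE, COUNT, LAST}"
  by (auto simp: peel_step_def)

lemma writes_peel [simp]: "writes peel = {ORD, VIS, CUR, NBR, VTX, FREE, COUNT, LAST}"
  by (auto simp: peel_def)

lemma degenerate_neighbors:
  assumes "degenerate d G" "finite (edges G)" "S \<subseteq> verts G" "S \<noteq> {}"
  shows "\<exists>v\<in>S. card (neighbors G v \<inter> S) \<le> d"
proof -
  let ?I = "induced_subgraph G S"
  obtain v where v: "v \<in> S" "degree ?I v \<le> d" using assms(1,3,4) unfolding degenerate_def by blast
  have "finite (edges ?I)" using assms(2) by (simp add: induced_subgraph_def)
  moreover have "neighbors G v \<inter> S = neighbors ?I v"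
    using v(1) by (auto simp: neighbors_def induced_subgraph_def)
  ultimately have "card (neighbors G v \<inter> S) \<le> d" using card_neighbors_le_degree[of ?I v] v(2) by simp
  then show ?thesis using v(1) by blast
qed

context input
begin

definition peel_order :: "nat list \<Rightarrow> bool" where
  "peel_order es \<longleftrightarrow> distinct es \<and> set es \<subseteq> V \<and> at_splits (\<lambda>_ v xs. card (B v - set xs) \<le> 1) es"

lemma peel_order_colorable:
  assumes "peel_order vs" "set vs = V"
  shows "at_splits (colorable 6 (\<lambda>_. 0)) vs"
proof -
  have "at_splits (\<lambda>_ v xs. card (B v - set xs) \<le> 1) vs" using assms(1) by (simp add: peel_order_def)
  then show ?thesis
  proof (rule at_splits_mono)
    fix ps v es assume vs: "vs = ps @ v # es" and v: "card (B v - set es) \<le> 1"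
    have dist: "distinct (ps @ v # es)" using assms(1) vs by (simp add: peel_order_def)
    have "card (B v \<inter> set ps) \<le> card (B v - set es)" using dist by (intro card_mono) auto
    with v show "colorable 6 (\<lambda>_. 0) ps v es" using vs assms(2) by (intro colorable_six[OF dist]) auto
  qed
qed

definition peel_state :: "nat list \<Rightarrow> nat \<Rightarrow> nat \<Rightarrow> bool" where
  "peel_state es i u \<longleftrightarrow> peel_order es \<and> i \<le> n \<and> (if i < n then u < n else u = n) \<and>
     (\<forall>z<n. z \<le> i \<and> z \<notin> set es \<and> z \<noteq> u \<longrightarrow> 2 \<le> card (B z - set es))"

lemma peel_state_skip:
  assumes "peel_state es i u" "i < n" "u \<in> set es \<or> 2 \<le> card (B u - set es)"
  shows "peel_state es (Suc i) (Suc i)"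
  using assms unfolding peel_state_def by (auto simp: le_Suc_eq)

lemma peel_state_remove:
  assumes "peel_state es i u" "i < n" "u \<notin> set es" "card (B u - set es) \<le> 1"
    and u': "if B u - set es = {} then u' = u else u' \<in> B u - set es"
  shows "peel_state (u # es) i u'"
proof -
  have "2 \<le> card (B z - set (u # es))" if z: "z < n" "z \<le> i" "z \<notin> set (u # es)" "z \<noteq> u'" for z
  proof -
    have "u \<notin> B z"
    proof
      assume "u \<in> B z"
      then have "z \<in> B u - set es" using neighbors_sym[of u H z] z(3) by auto
      moreover from this have "u' \<in> B u - set es" using u' by (metis empty_iff)
      ultimately show False using assms(4) z(4) card_le_Suc0_iff_eq[of "B u - set es"] by auto
    qed
    then have "B z - set (u # es) = B z - set es" by auto
    then show ?thesis using assms(1) z by (simp add: peel_state_def)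
  qed
  moreover have "u' < n"
    using u' assms(1,2) N_D B_subset in_V_iff by (fastforce simp: peel_state_def split: if_splits)
  moreover have "peel_order (u # es)" using assms by (auto simp: peel_state_def peel_order_def in_V_iff)
  ultimately show ?thesis using assms(1,2) by (simp add: peel_state_def)
qed

lemma peel_state_complete:
  assumes "peel_state es n n" "degenerate 1 H"
  shows "set es = V"
proof (rule ccontr)
  assume "set es \<noteq> V"
  then have S: "V - set es \<subseteq> verts H" "V - set es \<noteq> {}"
    using assms(1) spanning by (auto simp: peel_state_def peel_order_def spanning_subgraph_def)
  have "finite (edges H)"
    using spanning simple_graph_finite_edges[OF simple]
    by (auto simp: spanning_subgraph_def intro: finite_subset)
  from degenerate_neighbors[OF assms(2) this S]
  obtain v where v: "v \<in> V - set es" "card (B v \<inter> (V - set es)) \<le> 1" by blast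
  have "B v \<inter> (V - set es) = B v - set es" using B_subset N_D by blast
  moreover have "2 \<le> card (B v - set es)" using assms(1) v(1) in_V_iff by (auto simp: peel_state_def)
  ultimately show False using v(2) by simp
qed

lemma effect_count_remaining:
  assumes "has_input s" "s CUR 0 = u" "u \<in> V"
  defines "R \<equiv> {w \<in> B u. s VIS w = 0}"
  shows "effect count_remaining s COUNT 0 = card R"
    and "R \<noteq> {} \<Longrightarrow> effect count_remaining s LAST 0 \<in> R"
proof -
  let ?p = "Cond (Cell VIS (var NBR)) Skip (Seq (incr COUNT) (set_var LAST (var NBR)))"
  let ?R = "\<lambda>D. {w \<in> D. s VIS w = 0}"
  let ?I = "\<lambda>D t. t COUNT 0 = card (?R D) \<and> (?R D \<noteq> {} \<longrightarrow> t LAST 0 \<in> ?R D)"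
  have "?I (B u) (effect (for_backbone NBR ?p) (store_var s COUNT 0))"
  proof (rule effect_for_backbone)
    show "has_input (store_var s COUNT 0)" using assms(1) by simp
    fix D x t assume D: "D \<subseteq> B u" "x \<notin> D" and I: "?I D t"
      and off: "agrees_off (insert NBR (writes ?p)) (store_var s COUNT 0) t"
    have fin: "finite (?R D)" using finite_subset[OF D(1)] by simp
    have vis: "t VIS = s VIS" using agrees_offD[OF off, of VIS] by simp
    show "?I (insert x D) (effect ?p (store_var t NBR x))"
    proof (cases "s VIS x = 0")
      case True
      then have "?R (insert x D) = insert x (?R D)" by auto
      then show ?thesis using I D(2) fin True by (simp add: vis)
    next
      case False
      then have "?R (insert x D) = ?R D" by auto
      then show ?thesis using I False by (simp add: vis)
    qed
  qed (use assms in auto)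
  then show "effect count_remaining s COUNT 0 = card R" "R \<noteq> {} \<Longrightarrow> effect count_remaining s LAST 0 \<in> R"
    by (simp_all add: count_remaining_def R_def)
qed

definition peel_inv :: "store \<Rightarrow> bool" where
  "peel_inv t \<longleftrightarrow> t FREE 0 \<le> n \<and> (\<forall>v. t VIS v \<noteq> 0 \<longleftrightarrow> v \<in> set (map (t ORD) [t FREE 0..<n])) \<and>
     peel_state (map (t ORD) [t FREE 0..<n]) (t VTX 0) (t CUR 0)"

lemma effect_peel_step:
  assumes "has_input t" "t CUR 0 = u" "u \<in> V"
  defines "R \<equiv> {w \<in> B u. t VIS w = 0}" and "t' \<equiv> effect peel_step t"
  shows "t VIS u \<noteq> 0 \<or> 2 \<le> card R \<Longrightarrow> t' VIS = t VIS \<and> t' ORD = t ORD \<and>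
      t' FREE 0 = t FREE 0 \<and> t' VTX 0 = Suc (t VTX 0) \<and> t' CUR 0 = Suc (t VTX 0)"
    and "t VIS u = 0 \<Longrightarrow> card R \<le> 1 \<Longrightarrow> t' VIS = (t VIS)(u := 1) \<and> t' ORD = (t ORD)(t FREE 0 - 1 := u) \<and>
      t' FREE 0 = t FREE 0 - 1 \<and> t' VTX 0 = t VTX 0 \<and> (if R = {} then t' CUR 0 = u else t' CUR 0 \<in> R)"
proof -
  define c where "c = effect count_remaining t"
  note count = effect_count_remaining[OF assms(1-3), folded c_def R_def]
  have eqs: "c VIS = t VIS" "c ORD = t ORD" "c CUR 0 = u" "c VTX = t VTX" "c FREE = t FREE"
    using assms(2) by (simp_all add: c_def effect_other)
  have "R = {} \<longleftrightarrow> card R = 0" by (simp add: R_def)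
  note step = t'_def peel_step_def c_def[symmetric] eqs count(1) this
  show "t' VIS = t VIS \<and> t' ORD = t ORD \<and>
      t' FREE 0 = t FREE 0 \<and> t' VTX 0 = Suc (t VTX 0) \<and> t' CUR 0 = Suc (t VTX 0)"
    if "t VIS u \<noteq> 0 \<or> 2 \<le> card R"
    using that by (auto simp: step)
  show "t' VIS = (t VIS)(u := 1) \<and> t' ORD = (t ORD)(t FREE 0 - 1 := u) \<and>
      t' FREE 0 = t FREE 0 - 1 \<and> t' VTX 0 = t VTX 0 \<and> (if R = {} then t' CUR 0 = u else t' CUR 0 \<in> R)"
    if "t VIS u = 0" "card R \<le> 1"
    using that count(2) by (auto simp: step)
qed

lemma peel_inv_step:
  assumes "has_input t" "peel_inv t" "t VTX 0 < n"
  defines "t' \<equiv> effect peel_step t"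
  shows "peel_inv t' \<and> (n - t' VTX 0) + t' FREE 0 < (n - t VTX 0) + t FREE 0"
proof -
  define i u k es where "i = t VTX 0" and "u = t CUR 0" and "k = t FREE 0"
    and "es = map (t ORD) [k..<n]"
  have inv: "k \<le> n" "\<And>v. t VIS v \<noteq> 0 \<longleftrightarrow> v \<in> set es" "peel_state es i u"
    using assms(2) by (simp_all add: peel_inv_def i_def u_def k_def es_def)
  have i: "i < n" "u \<in> V" using assms(3) inv(3) by (auto simp: i_def peel_state_def in_V_iff)
  have R: "{w \<in> B u. t VIS w = 0} = B u - set es" using inv(2) by blast
  note step = effect_peel_step[OF assms(1) u_def[symmetric] i(2), unfolded R, folded t'_def i_def k_def]
  show ?thesis
  proof (cases "u \<in> set es \<or> 2 \<le> card (B u - set es)")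
    case True
    then have t': "t' VIS = t VIS" "t' ORD = t ORD" "t' VTX 0 = Suc i" "t' CUR 0 = Suc i"
      "t' FREE 0 = k"
      using step(1) inv(2)[of u] by simp_all
    have "peel_inv t'"
      unfolding peel_inv_def t' using inv(1,2) peel_state_skip[OF inv(3) i(1) True]
      by (simp add: es_def)
    then show ?thesis using i(1) by (simp add: t' i_def k_def)
  next
    case False
    then have u: "u \<notin> set es" "card (B u - set es) \<le> 1" by simp_all
    have "distinct es" "set es \<subset> V" using inv(3) u(1) i(2) by (auto simp: peel_state_def peel_order_def)
    then have "length es < n" using psubset_card_mono[OF finite_V] distinct_card by metis
    then obtain j where j: "k = Suc j" "j < n" using inv(1) by (cases k) (auto simp: es_def)
    have t': "t' VIS = (t VIS)(u := 1)" "t' ORD = (t ORD)(j := u)" "t' VTX 0 = i" "t' FREE 0 = j"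
      "if B u - set es = {} then t' CUR 0 = u else t' CUR 0 \<in> B u - set es"
      using step(2) u inv(2)[of u] j(1) by (simp_all split: if_splits)
    have "[j..<n] = j # [k..<n]" using j by (simp add: upt_conv_Cons)
    then have es': "map (t' ORD) [t' FREE 0..<n] = u # es" using j(1) by (simp add: t'(2,4) es_def)
    have "peel_state (u # es) i (t' CUR 0)" by (rule peel_state_remove[OF inv(3) i(1) u t'(5)])
    then have "peel_inv t'" unfolding peel_inv_def es' using inv(2) j(2) by (auto simp: t'(1,3,4))
    then show ?thesis using j(1) by (simp add: t'(3,4) i_def k_def)
  qed
qed

lemma runs_peel:
  assumes s: "s = input_store lam adjG adjH" and forest: "degenerate 1 H"
  shows "runs peel s (4 + (6 + cost peel_step) * (2 * n + 1))
    (\<lambda>t. peel_order (map (t ORD) [0..<n]) \<and> set (map (t ORD) [0..<n]) = V)"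
proof -
  have inp: "has_input s" by (simp add: s has_input_store)
  have zero: "s k = (\<lambda>_. 0)" if "5 \<le> k" for k using that by (auto simp: s input_store_def)
  let ?s = "store_var s FREE n" and ?b = "Sub (var INFO) (var VTX)"
  let ?\<mu> = "\<lambda>t. (n - t VTX 0) + t FREE 0"
  have "runs (Loop ?b peel_step) ?s ((1 + acost ?b + cost peel_step) * (?\<mu> ?s + 1))
      (\<lambda>t. peel_inv t \<and> aval ?b t = 0)"
  proof (rule runs_Loop_loop_free)
    show "peel_inv ?s" by (simp add: peel_inv_def peel_state_def peel_order_def zero)
    fix t assume t: "peel_inv t" "aval ?b t \<noteq> 0" "agrees_off (writes peel_step) ?s t"
    have "has_input t" by (rule has_input_agrees_off[OF _ t(3)]) (use inp in auto)
    moreover from this have "t VTX 0 < n" using t(2) by (simp add: has_inputD)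
    ultimately show "peel_inv (effect peel_step t) \<and> ?\<mu> (effect peel_step t) < ?\<mu> t"
      using peel_inv_step t(1) by blast
  qed simp
  then have "runs peel s (cost (set_var FREE (var INFO)) + (1 + acost ?b + cost peel_step) * (?\<mu> ?s + 1))
      (\<lambda>t. peel_inv t \<and> aval ?b t = 0)"
    unfolding peel_def by (intro runs_Seq_loop_free) (simp_all add: has_inputD[OF inp])
  then show ?thesis
  proof (rule runs_mono[OF runs_agrees_off])
    show "cost (set_var FREE (var INFO)) + (1 + acost ?b + cost peel_step) * (?\<mu> ?s + 1)
        \<le> 4 + (6 + cost peel_step) * (2 * n + 1)"
      by (simp add: zero algebra_simps)
    fix t assume t: "(peel_inv t \<and> aval ?b t = 0) \<and> agrees_off (writes peel) s t"
    let ?es = "map (t ORD) [t FREE 0..<n]"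
    have "t INFO = s INFO" using t by (simp add: agrees_off_def)
    then have "n \<le> t VTX 0" using t by (simp add: has_inputD[OF inp])
    then have state: "peel_state ?es n n" using t by (auto simp: peel_inv_def peel_state_def)
    have V: "set ?es = V" by (rule peel_state_complete[OF state forest])
    have order: "peel_order ?es" using state by (simp add: peel_state_def)
    then have "length ?es = n" using V distinct_card by (metis peel_order_def)
    then have "n = 0 \<or> t FREE 0 = 0" by simp arith
    then have "[t FREE 0..<n] = [0..<n]" by auto
    then show "peel_order (map (t ORD) [0..<n]) \<and> set (map (t ORD) [0..<n]) = V" using V order by metis
  qed
qed

theorem runs_forest_program:
  assumes "2 \<le> lam" "degenerate 1 H"
  shows "runs forest_program (input_store lam adjG adjH) (forest_cost * (n + 1))
    (\<lambda>t. backbone_k_coloring lam (2 * lam + 2) G H (t OUT))"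
proof -
  let ?s = "input_store lam adjG adjH"
  have "runs forest_program ?s ((4 + (6 + cost peel_step) * (2 * n + 1)) +
      (cost (set_var LEN (var INFO)) + two_pass_cost 6 * (n + 1)))
      (\<lambda>t. backbone_k_coloring lam (2 * lam + (6 - 4)) G H (t OUT))"
    unfolding forest_program_def
  proof (rule runs_Seq[OF runs_peel[OF refl assms(2)]])
    fix t assume t: "peel_order (map (t ORD) [0..<n]) \<and> set (map (t ORD) [0..<n]) = V"
      and off: "agrees_off (writes peel) ?s t"
    have inp: "has_input t" by (rule has_input_agrees_off[OF has_input_store off]) auto
    have zero: "t COL = (\<lambda>_. 0)" "t LOW = (\<lambda>_. 0)" "t HIGH = (\<lambda>_. 0)"
      using agrees_offD[OF off] by (simp_all add: input_store_def)
    have colorable: "at_splits (colorable 6 (\<lambda>_. 0)) (map (t ORD) [0..<n])"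
      using peel_order_colorable t by blast
    have "runs (two_pass 6) (store_var t LEN n) (two_pass_cost 6 * (n + 1))
        (\<lambda>t. backbone_k_coloring lam (2 * lam + (6 - 4)) G H (t OUT))"
      by (rule runs_two_pass[OF _ _ _ _ assms(1) refl])
        (use t inp zero colorable in \<open>simp_all add: peel_order_def conflict_free_def\<close>)
    then show "runs (Seq (set_var LEN (var INFO)) (two_pass 6)) t
        (cost (set_var LEN (var INFO)) + two_pass_cost 6 * (n + 1))
        (\<lambda>t. backbone_k_coloring lam (2 * lam + (6 - 4)) G H (t OUT))"
      by (intro runs_Seq_loop_free) (simp_all add: has_inputD[OF inp])
  qed
  then show ?thesis by (rule runs_mono) (simp_all add: forest_cost_def algebra_simps)
qed

end

section \<open>Searches\<close>

abbreviation (input) NUM :: nat where "NUM \<equiv> 13"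
abbreviation (input) HEAD :: nat where "HEAD \<equiv> 28"
abbreviation (input) BRANCH :: nat where "BRANCH \<equiv> 31"
abbreviation (input) CHILD :: nat where "CHILD \<equiv> 32"
abbreviation (input) START :: nat where "START \<equiv> 33"

definition expand :: "com \<Rightarrow> com" where
  "expand p = Seq (set_var CUR (Cell ORD (var HEAD))) (Seq (for_neighbors p) (incr HEAD))"

definition search :: "com \<Rightarrow> com" where
  "search p = Loop (Sub (var LEN) (var HEAD)) (expand p)"

definition push :: "aexp \<Rightarrow> com" where
  "push e = Seq (Assign VIS e (Const 1)) (Seq (Assign ORD (var LEN) e) (incr LEN))"

definition visit :: com where
  "visit = Cond (Cell VIS (var NBR)) Skip (push (var NBR))"

definition partner_of :: "aexp \<Rightarrow> aexp" where
  "partner_of e = Cell H_ADJ (Cell H_OFF e)"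

definition number :: "aexp \<Rightarrow> com" where
  "number e = Seq (Assign ORD (var LEN) e) (Seq (incr LEN) (Assign NUM e (var LEN)))"

definition number_pair :: "aexp \<Rightarrow> com" where
  "number_pair e = Seq (number e) (number (partner_of e))"

definition record_branch :: com where
  "record_branch = Cond (Sub (Cell NUM (var NBR)) (Cell NUM (var CUR)))
     (Cond (neq (var NBR) (partner_of (var CUR)))
       (Seq (set_var BRANCH (var CUR)) (set_var CHILD (var NBR))) Skip) Skip"

definition discover :: com where
  "discover = Seq (Cond (Cell NUM (var NBR)) Skip (number_pair (var NBR))) record_branch"

lemma loop_free_push [simp]: "loop_free (push e)"
  and writes_push [simp]: "writes (push e) = {ORD, VIS, LEN}"
  by (auto simp: push_def)

lemma loop_free_visit [simp]: "loop_free visit"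
  and writes_visit [simp]: "writes visit = {ORD, VIS, LEN}"
  by (auto simp: visit_def)

lemma loop_free_number_pair [simp]: "loop_free (number_pair e)"
  and writes_number_pair [simp]: "writes (number_pair e) = {ORD, NUM, LEN}"
  by (auto simp: number_pair_def number_def)

lemma loop_free_discover [simp]: "loop_free discover"
  and writes_discover [simp]: "writes discover = {ORD, NUM, LEN, BRANCH, CHILD}"
  by (auto simp: discover_def record_branch_def)

lemma loop_free_expand [simp]: "loop_free (expand p) \<longleftrightarrow> loop_free p"
  and writes_expand [simp]: "writes (expand p) = {CUR, NBR, HEAD} \<union> writes p"
  by (auto simp: expand_def)

lemma writes_search [simp]: "writes (search p) = {CUR, NBR, HEAD} \<union> writes p"
  by (simp add: search_def)

lemma effect_expand_HEAD: "HEAD \<notin> writes p \<Longrightarrow> effect (expand p) t HEAD 0 = Suc (t HEAD 0)"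
  by (simp add: expand_def effect_other)

context input
begin

lemma effect_expand:
  assumes t: "has_input t" "t ORD (t HEAD 0) = v" "v \<in> V" and p: "writes p \<subseteq> {5..} - {CUR, HEAD}"
    and init: "J {} (store_var t CUR v)"
    and step: "\<And>D x u. x \<in> N v \<Longrightarrow> D \<subseteq> N v \<Longrightarrow> J D u \<Longrightarrow> u CUR 0 = v \<Longrightarrow> has_input u \<Longrightarrow>
      agrees_off ({CUR, NBR} \<union> writes p) t u \<Longrightarrow> J (insert x D) (effect p (store_var u NBR x))"
  obtains u where "effect (expand p) t = store_var u HEAD (Suc (t HEAD 0))" "J (N v) u"
    "u HEAD 0 = t HEAD 0"
proof -
  let ?s = "store_var t CUR v"
  define u where "u = effect (for_neighbors p) ?s"
  have "HEAD \<notin> writes (for_neighbors p)" using p by auto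
  then have head: "u HEAD 0 = t HEAD 0" by (simp add: u_def effect_other)
  then have eff: "effect (expand p) t = store_var u HEAD (Suc (t HEAD 0))"
    using t(2) head by (simp add: expand_def u_def)
  have s: "has_input ?s" using t(1) by simp
  have "J (N v) u" unfolding u_def
  proof (rule effect_for_neighbors[where I = J, OF s _ t(3) _ init])
    fix D x u assume x: "x \<in> N v" "D \<subseteq> N v" "J D u" and off: "agrees_off (insert NBR (writes p)) ?s u"
    have "agrees_off ({CUR, NBR} \<union> writes p) t u" using off by (auto simp: agrees_off_def)
    moreover have "CUR \<notin> insert NBR (writes p)" using p by auto
    then have "u CUR 0 = v" using agrees_offD[OF off] by simp
    moreover have "has_input u" by (rule has_input_agrees_off[OF s off]) (use p in auto)
    ultimately show "J (insert x D) (effect p (store_var u NBR x))" using step x by blast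
  qed (use p in auto)
  from that[OF eff this head] show thesis .
qed

lemma runs_search:
  assumes p: "loop_free p" "HEAD \<notin> writes p" and s: "has_input s" "I s" "writes p \<subseteq> {5..}"
    and bound: "\<And>t. I t \<Longrightarrow> t HEAD 0 \<le> t LEN 0 \<and> t LEN 0 \<le> s HEAD 0 + k"
    and step: "\<And>t. I t \<Longrightarrow> t HEAD 0 < t LEN 0 \<Longrightarrow> has_input t \<Longrightarrow> agrees_off (writes (expand p)) s t \<Longrightarrow>
      I (effect (expand p) t)"
  shows "runs (search p) s ((6 + cost (expand p)) * (k + 1)) (\<lambda>t. I t \<and> t HEAD 0 = t LEN 0)"
proof -
  let ?b = "Sub (var LEN) (var HEAD)" and ?\<mu> = "\<lambda>t. s HEAD 0 + k - t HEAD 0"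
  have "runs (search p) s ((1 + acost ?b + cost (expand p)) * (?\<mu> s + 1)) (\<lambda>t. I t \<and> aval ?b t = 0)"
    unfolding search_def
  proof (rule runs_Loop_loop_free[where \<mu> = ?\<mu>])
    fix t assume t: "I t" "aval ?b t \<noteq> 0" "agrees_off (writes (expand p)) s t"
    have inp: "has_input t" by (rule has_input_agrees_off[OF s(1) t(3)]) (use s(3) in auto)
    show "I (effect (expand p) t) \<and> ?\<mu> (effect (expand p) t) < ?\<mu> t"
      using step[OF t(1) _ inp t(3)] t(2) bound[OF t(1)] effect_expand_HEAD[OF p(2)] by auto
  qed (use p s in auto)
  then show ?thesis
  proof (rule runs_mono)
    show "I t \<and> t HEAD 0 = t LEN 0" if "I t \<and> aval ?b t = 0" for t using that bound[of t] by auto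
  qed (simp add: algebra_simps)
qed

end

locale matching_input = input G H lam adjG adjH + matching_backbone G H
  for G H :: "nat ugraph" and lam :: nat and adjG adjH :: "nat list list"
begin

text \<open>
  A search started in \<open>R\<close> and confined to \<open>D\<close> has appended the vertices \<open>cs\<close> to the order \<open>ps\<close>. The
  vertices in \<open>X\<close> had been visited before.
\<close>

definition search_inv :: "nat list \<Rightarrow> nat set \<Rightarrow> nat set \<Rightarrow> nat set \<Rightarrow> nat list \<Rightarrow> store \<Rightarrow> bool" where
  "search_inv ps X D R cs t \<longleftrightarrow> map (t ORD) [0..<t LEN 0] = ps @ cs \<and> search_order R cs \<and> set cs \<subseteq> D - X \<and>
     (\<forall>v\<in>V. t VIS v \<noteq> 0 \<longleftrightarrow> v \<in> set cs \<union> X) \<and> length ps \<le> t HEAD 0 \<and> t HEAD 0 \<le> t LEN 0 \<and>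
     (\<forall>v\<in>set (take (t HEAD 0 - length ps) cs). N v \<subseteq> set cs \<union> X)"

lemma search_inv_LEN: "search_inv ps X D R cs t \<Longrightarrow> t LEN 0 = length ps + length cs"
  unfolding search_inv_def by (metis diff_zero length_append length_map length_upt)

lemma search_inv_VIS: "search_inv ps X D R cs t \<Longrightarrow> v \<in> V \<Longrightarrow> t VIS v \<noteq> 0 \<longleftrightarrow> v \<in> set cs \<union> X"
  by (simp add: search_inv_def)

lemma search_inv_HEAD: "search_inv ps X D R cs t \<Longrightarrow> length ps \<le> t HEAD 0 \<and> t HEAD 0 \<le> t LEN 0"
  by (simp add: search_inv_def)

lemma search_inv_head:
  assumes "search_inv ps X D R cs t" "t HEAD 0 < t LEN 0"
  shows "t HEAD 0 - length ps < length cs" "t ORD (t HEAD 0) = cs ! (t HEAD 0 - length ps)"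
proof -
  note len = search_inv_LEN[OF assms(1)]
  have head: "length ps \<le> t HEAD 0" using assms(1) by (simp add: search_inv_def)
  show "t HEAD 0 - length ps < length cs" using head assms(2) len by simp
  have "t ORD (t HEAD 0) = map (t ORD) [0..<t LEN 0] ! t HEAD 0" using assms(2) by simp
  also have "\<dots> = cs ! (t HEAD 0 - length ps)"
    using assms(1) head by (simp add: search_inv_def nth_append)
  finally show "t ORD (t HEAD 0) = cs ! (t HEAD 0 - length ps)" .
qed

lemma search_inv_cong:
  assumes "search_inv ps X D R cs t" "u ORD = t ORD" "u VIS = t VIS" "u LEN 0 = t LEN 0"
    "u HEAD 0 = t HEAD 0"
  shows "search_inv ps X D R cs u"
  using assms by (simp add: search_inv_def)

lemma search_inv_push:
  assumes inv: "search_inv ps X D R cs t" and w: "w \<in> D" "w \<in> V" "t VIS w = 0"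
    "w \<in> R \<or> N w \<inter> set cs \<noteq> {}"
    and u: "u ORD = (t ORD)(t LEN 0 := w)" "u VIS = (t VIS)(w := 1)" "u LEN 0 = Suc (t LEN 0)"
      "u HEAD 0 = t HEAD 0"
  shows "search_inv ps X D R (cs @ [w]) u"
proof -
  have new: "w \<notin> set cs \<union> X" using search_inv_VIS[OF inv w(2)] w(3) by blast
  have "map (u ORD) [0..<u LEN 0] = ps @ cs @ [w]" using inv by (simp add: u search_inv_def)
  moreover have "search_order R (cs @ [w])"
    using inv w(4) new by (simp add: search_inv_def search_order_def)
  moreover have "t HEAD 0 - length ps \<le> length cs"
    using search_inv_HEAD[OF inv] search_inv_LEN[OF inv] by arith
  ultimately show ?thesis using inv w new unfolding search_inv_def u by auto
qed

lemma search_inv_visit: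
  assumes inv: "search_inv ps X D R cs t" and v: "v \<in> set cs" and x: "x \<in> N v" "x \<in> D \<union> X" "t NBR 0 = x"
  obtains ws where "search_inv ps X D R (cs @ ws) (effect visit t)" "x \<in> set (cs @ ws) \<union> X"
proof (cases "t VIS x = 0")
  case True
  have xV: "x \<in> V" and vx: "v \<in> N x" using x(1) N_D by blast+
  have xD: "x \<in> D" using x(2) True search_inv_VIS[OF inv xV] by blast
  have "search_inv ps X D R (cs @ [x]) (effect visit t)"
    by (rule search_inv_push[OF inv xD xV True])
      (use vx v x(3) True in \<open>auto simp: visit_def push_def fun_eq_iff\<close>)
  with that[of "[x]"] show thesis by simp
next
  case False
  have "x \<in> V" using x(1) N_D by blast
  then have "x \<in> set cs \<union> X" using False search_inv_VIS[OF inv] by blast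
  moreover have "search_inv ps X D R cs (effect visit t)"
    by (rule search_inv_cong[OF inv]) (use False x(3) in \<open>simp_all add: visit_def\<close>)
  ultimately show thesis using that[of "[]"] by simp
qed

lemma search_inv_expand:
  assumes inv: "search_inv ps X D R cs t" "t HEAD 0 < t LEN 0" and t: "has_input t"
    and D: "D \<subseteq> V" "\<And>v. v \<in> D \<Longrightarrow> N v \<subseteq> D \<union> X"
  shows "\<exists>ws. search_inv ps X D R (cs @ ws) (effect (expand visit) t)"
proof -
  define j where "j = t HEAD 0 - length ps"
  define v where "v = cs ! j"
  have j: "j < length cs" "t ORD (t HEAD 0) = v" "t HEAD 0 = length ps + j"
    using search_inv_head[OF inv] inv(1) by (simp_all add: j_def v_def search_inv_def)
  have v: "v \<in> set cs" using j(1) by (simp add: v_def)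
  then have vD: "v \<in> D" using inv(1) by (auto simp: search_inv_def)
  let ?J = "\<lambda>E u. \<exists>ws. search_inv ps X D R (cs @ ws) u \<and> E \<subseteq> set (cs @ ws) \<union> X"
  obtain u where u: "effect (expand visit) t = store_var u HEAD (Suc (t HEAD 0))" "?J (N v) u"
    "u HEAD 0 = t HEAD 0"
  proof (rule effect_expand[where J = ?J and v = v, OF t j(2)])
    have "search_inv ps X D R (cs @ []) (store_var t CUR v)" using search_inv_cong[OF inv(1)] by simp
    then show "?J {} (store_var t CUR v)" by (intro exI[of _ "[]"]) simp
    fix E x u assume x: "x \<in> N v" "?J E u"
    then obtain ws where ws: "search_inv ps X D R (cs @ ws) u" "E \<subseteq> set (cs @ ws) \<union> X" by blast
    have "search_inv ps X D R (cs @ ws) (store_var u NBR x)"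
      by (rule search_inv_cong[OF ws(1)]) simp_all
    then obtain ws' where ws': "search_inv ps X D R ((cs @ ws) @ ws') (effect visit (store_var u NBR x))"
      "x \<in> set ((cs @ ws) @ ws') \<union> X"
      by (rule search_inv_visit[of _ _ _ _ _ _ v x]) (use v vD x(1) D(2) in auto)
    then show "?J (insert x E) (effect visit (store_var u NBR x))"
      using ws(2) by (intro exI[of _ "ws @ ws'"]) auto
  qed (use vD D in auto)
  then obtain ws where ws: "search_inv ps X D R (cs @ ws) u" "N v \<subseteq> set (cs @ ws) \<union> X" by blast
  have "take (Suc j) (cs @ ws) = take j (cs @ ws) @ [v]"
    using j(1) by (simp add: take_Suc_conv_app_nth nth_append v_def)
  then have "search_inv ps X D R (cs @ ws) (effect (expand visit) t)"
    using ws inv(2) search_inv_LEN[OF ws(1)] j u(1,3) by (auto simp: search_inv_def Suc_diff_le)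
  then show ?thesis by blast
qed

lemma runs_search_visit:
  assumes s: "has_input s" "search_inv ps X D R cs s" "s HEAD 0 = length ps"
    and D: "D \<subseteq> V" "\<And>v. v \<in> D \<Longrightarrow> N v \<subseteq> D \<union> X"
  shows "runs (search visit) s ((6 + cost (expand visit)) * (card D + 1))
    (\<lambda>t. \<exists>ws. search_inv ps X D R (cs @ ws) t \<and> t HEAD 0 = t LEN 0 \<and>
      (\<forall>v\<in>set (cs @ ws). N v \<subseteq> set (cs @ ws) \<union> X))"
proof -
  let ?I = "\<lambda>t. \<exists>ws. search_inv ps X D R (cs @ ws) t"
  have "runs (search visit) s ((6 + cost (expand visit)) * (card D + 1)) (\<lambda>t. ?I t \<and> t HEAD 0 = t LEN 0)"
  proof (rule runs_search[where I = ?I])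
    show "?I s" using s(2) by (intro exI[of _ "[]"]) simp
    fix t assume "?I t"
    then obtain ws where ws: "search_inv ps X D R (cs @ ws) t" by blast
    have "length (cs @ ws) \<le> card D"
      using ws card_mono[OF finite_subset[OF D(1) finite_V], of "set (cs @ ws)"] distinct_card[of "cs @ ws"]
      by (auto simp: search_inv_def search_order_def)
    then show "t HEAD 0 \<le> t LEN 0 \<and> t LEN 0 \<le> s HEAD 0 + card D"
      using ws search_inv_LEN[OF ws] s(3) by (simp add: search_inv_def)
    show "?I (effect (expand visit) t)" if "t HEAD 0 < t LEN 0" "has_input t"
      using search_inv_expand[OF ws that D] by (metis append.assoc)
  qed (use s(1) in auto)
  then show ?thesis
  proof (rule runs_mono)
    fix t assume "?I t \<and> t HEAD 0 = t LEN 0"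
    then obtain ws where ws: "search_inv ps X D R (cs @ ws) t" "t HEAD 0 = t LEN 0" by blast
    then have "\<forall>v\<in>set (cs @ ws). N v \<subseteq> set (cs @ ws) \<union> X"
      using search_inv_LEN[OF ws(1)] by (simp add: search_inv_def)
    with ws show "\<exists>ws. search_inv ps X D R (cs @ ws) t \<and> t HEAD 0 = t LEN 0 \<and>
        (\<forall>v\<in>set (cs @ ws). N v \<subseteq> set (cs @ ws) \<union> X)" by blast
  qed simp
qed

lemma aval_partner_of:
  assumes "has_input t" "aval e t = v" "v \<in> V" "B v \<noteq> {}"
  shows "aval (partner_of e) t = partner v"
proof -
  have v: "v < n" using assms(3) by (simp add: in_V_iff)
  have "length (adjH ! v) \<noteq> 0" using adj_nth(4)[OF v] assms(4) by auto
  then have "t H_ADJ (t H_OFF v) = adjH ! v ! 0"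
    using array_of_concat[of v adjH 0] v by (simp add: has_inputD[OF assms(1)])
  moreover have "adjH ! v ! 0 \<in> B v"
    using adj_nth(4)[OF v] \<open>length (adjH ! v) \<noteq> 0\<close> by (metis nth_mem neq0_conv)
  ultimately show ?thesis using B_partner[OF assms(4)] assms(2) by (simp add: partner_of_def)
qed

lemma effect_number_pair:
  assumes "has_input t" "t x 0 = w" "w \<in> V" "B w \<noteq> {}" "20 \<le> x" "x \<noteq> LEN"
  defines "t' \<equiv> effect (number_pair (var x)) t" and "m \<equiv> t LEN 0"
  shows "t' NUM = (t NUM)(w := Suc m, partner w := Suc (Suc m))"
    and "t' ORD = (t ORD)(m := w, Suc m := partner w)" and "t' LEN 0 = Suc (Suc m)"
proof -
  let ?t = "effect (number (var x)) t"
  have x: "x \<notin> {ORD, NUM, LEN}" using assms(5,6) by auto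
  have off: "agrees_off {ORD, NUM, LEN} t ?t"
    using effect_agrees_off[of "number (var x)" t] by (simp add: number_def insert_commute)
  have "has_input ?t" by (rule has_input_agrees_off[OF assms(1) off]) auto
  moreover have "aval (var x) ?t = w" using agrees_offD[OF off x] assms(2) by simp
  ultimately have p: "aval (partner_of (var x)) ?t = partner w"
    using assms(3,4) by (rule aval_partner_of)
  have t: "?t NUM = (t NUM)(w := Suc m)" "?t ORD = (t ORD)(m := w)" "?t LEN 0 = Suc m"
    using assms(2) x by (simp_all add: number_def m_def)
  have p': "aval (partner_of (var x)) (u(ORD := f, LEN := g)) = aval (partner_of (var x)) u" for u f g
    using x by (simp add: partner_of_def)
  show "t' NUM = (t NUM)(w := Suc m, partner w := Suc (Suc m))"
    "t' ORD = (t ORD)(m := w, Suc m := partner w)" "t' LEN 0 = Suc (Suc m)"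
    unfolding t'_def number_pair_def effect.simps(3) number_def[of "partner_of (var x)"]
    using p by (simp_all add: t p')
qed

definition numbering_core :: "nat set \<Rightarrow> nat \<Rightarrow> nat list \<Rightarrow> (nat \<Rightarrow> nat) \<Rightarrow> store \<Rightarrow> bool" where
  "numbering_core C r vs f t \<longleftrightarrow> map (t ORD) [0..<length vs] = vs \<and> (\<forall>z. z \<notin> C \<longrightarrow> t NUM z = f z) \<and>
     numbered C r (length vs) (t NUM) (t ORD) (t LEN 0) \<and> length vs \<le> t HEAD 0 \<and> t HEAD 0 \<le> t LEN 0 \<and>
     (\<forall>z\<in>expanded C (t NUM) (t HEAD 0). \<forall>w\<in>N z. t NUM w \<noteq> 0)"

definition branch_recorded :: "nat set \<Rightarrow> store \<Rightarrow> bool" where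
  "branch_recorded E t \<longleftrightarrow> t BRANCH 0 \<in> E \<and> last_branch E (t NUM) (t BRANCH 0) (t CHILD 0)"

lemma numbering_core_cong:
  assumes "numbering_core C r vs f t" "u ORD = t ORD" "u NUM = t NUM" "u LEN 0 = t LEN 0"
    "u HEAD 0 = t HEAD 0"
  shows "numbering_core C r vs f u"
  using assms by (simp add: numbering_core_def)

context
  fixes C :: "nat set" and r :: nat and vs :: "nat list" and f :: "nat \<Rightarrow> nat"
  assumes C: "tight C"
begin

private abbreviation (input) expanded_in :: "store \<Rightarrow> nat set" where
  "expanded_in t \<equiv> expanded C (t NUM) (t HEAD 0)"

lemma numbering_core_push:
  assumes core: "numbering_core C r vs f t" and w: "w \<in> C" "t NUM w = 0" "w = r \<or> (\<exists>v\<in>N w. t NUM v \<noteq> 0)"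
    and u: "u NUM = (t NUM)(w := Suc (t LEN 0), partner w := Suc (Suc (t LEN 0)))"
      "u ORD = (t ORD)(t LEN 0 := w, Suc (t LEN 0) := partner w)" "u LEN 0 = Suc (Suc (t LEN 0))"
      "u HEAD 0 = t HEAD 0"
  shows "numbering_core C r vs f u" and "expanded_in u = expanded_in t"
    and "\<And>z. t NUM z \<noteq> 0 \<Longrightarrow> u NUM z = t NUM z"
proof -
  note core' = core[unfolded numbering_core_def]
  have num: "numbered C r (length vs) (t NUM) (t ORD) (t LEN 0)" using core' by blast
  note pw = tight_partner(1,5)[OF C w(1)]
  then have pw0: "t NUM (partner w) = 0" using numberedD(4)[OF num pw(1)] w(2) by auto
  show old: "u NUM z = t NUM z" if "t NUM z \<noteq> 0" for z using that w(2) pw0 by (auto simp: u)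
  show exp: "expanded_in u = expanded_in t"
    using core' old w(2) pw0 by (auto simp: expanded_def u)
  have "numbered C r (length vs) (u NUM) (u ORD) (u LEN 0)"
    unfolding u(1-3) by (rule numbered_push[OF num C w])
  moreover have "map (u ORD) [0..<length vs] = map (t ORD) [0..<length vs]"
    using core' by (auto simp: u)
  moreover have "u NUM z = f z" if "z \<notin> C" for z using core' that w(1) pw(1) by (auto simp: u)
  moreover have "u NUM w' \<noteq> 0" if "z \<in> expanded_in u" "w' \<in> N z" for z w'
    using that core' old unfolding exp by metis
  ultimately show "numbering_core C r vs f u" using core' unfolding numbering_core_def u(3,4) by auto
qed

definition numbering_inv :: "store \<Rightarrow> bool" where
  "numbering_inv t \<longleftrightarrow> numbering_core C r vs f t \<and> (expanded_in t = {} \<or> branch_recorded (expanded_in t) t)"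

definition new_branch :: "nat \<Rightarrow> store \<Rightarrow> bool" where
  "new_branch v t \<longleftrightarrow> t BRANCH 0 = v \<and> t CHILD 0 \<in> N v \<and> t CHILD 0 \<noteq> partner v \<and> t NUM v < t NUM (t CHILD 0)"

definition discovering :: "nat \<Rightarrow> nat set \<Rightarrow> store \<Rightarrow> bool" where
  "discovering v D t \<longleftrightarrow> numbering_core C r vs f t \<and> t HEAD 0 < t LEN 0 \<and> t ORD (t HEAD 0) = v \<and>
     (\<forall>w\<in>D. t NUM w \<noteq> 0) \<and>
     (new_branch v t \<or>
      (expanded_in t = {} \<or> branch_recorded (expanded_in t) t) \<and> (\<forall>w\<in>D. w \<noteq> partner v \<longrightarrow> \<not> t NUM v < t NUM w))"

lemma discovering_head:
  assumes "discovering v D t"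
  shows "numbered C r (length vs) (t NUM) (t ORD) (t LEN 0)" "length vs \<le> t HEAD 0" "t HEAD 0 < t LEN 0"
    "v \<in> C" "t NUM v = Suc (t HEAD 0)" "t ORD (t HEAD 0) = v"
proof -
  show num: "numbered C r (length vs) (t NUM) (t ORD) (t LEN 0)" and h: "length vs \<le> t HEAD 0"
    "t HEAD 0 < t LEN 0"
    and v: "t ORD (t HEAD 0) = v"
    using assms by (simp_all add: discovering_def numbering_core_def)
  show "v \<in> C" "t NUM v = Suc (t HEAD 0)" using numbered_ord[OF num h] v by simp_all
qed

lemma discovering_cong:
  assumes "discovering v D t" "u ORD = t ORD" "u NUM = t NUM" "u LEN 0 = t LEN 0" "u HEAD 0 = t HEAD 0"
    "u BRANCH 0 = t BRANCH 0" "u CHILD 0 = t CHILD 0"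
  shows "discovering v D u"
  using assms by (simp add: discovering_def numbering_core_def new_branch_def branch_recorded_def)

lemma discovering_number_pair:
  assumes t: "discovering v D t" and x: "x \<in> N v" "t NUM x = 0"
    and u: "u NUM = (t NUM)(x := Suc (t LEN 0), partner x := Suc (Suc (t LEN 0)))"
      "u ORD = (t ORD)(t LEN 0 := x, Suc (t LEN 0) := partner x)" "u LEN 0 = Suc (Suc (t LEN 0))"
      "u HEAD 0 = t HEAD 0"
      "u BRANCH 0 = t BRANCH 0" "u CHILD 0 = t CHILD 0"
  shows "discovering v D u"
proof -
  have core: "numbering_core C r vs f t" using t by (simp add: discovering_def)
  note head = discovering_head[OF t]
  have "x \<in> C" "v \<in> N x" using tightD(1)[OF C head(4)] x(1) N_D by auto
  then have "x = r \<or> (\<exists>v\<in>N x. t NUM v \<noteq> 0)" using head(5) by (intro disjI2 bexI[of _ v]) simp_all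
  note push = numbering_core_push[OF core \<open>x \<in> C\<close> x(2) this u(1-4)]
  have old: "u NUM z = t NUM z" if "t NUM z \<noteq> 0" for z using push(3) that by blast
  have branch: "branch_recorded (expanded_in u) u" if "branch_recorded (expanded_in t) t"
  proof -
    have "u NUM w = t NUM w" if "z \<in> expanded_in t" "w \<in> insert z (N z)" for z w
      using that core by (intro old) (auto simp: numbering_core_def expanded_def)
    then show ?thesis
      using that last_branch_cong[of "t BRANCH 0" "expanded_in t" "u NUM" "t NUM"] push(2) u(5,6)
      by (auto simp: branch_recorded_def)
  qed
  have v: "u NUM v = t NUM v" using old head(5) by simp
  have new: "new_branch v u" if "new_branch v t"
    using that old[of "t CHILD 0"] v u(5,6) by (auto simp: new_branch_def)
  have "u ORD (u HEAD 0) = v" using head(3,6) by (simp add: u)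
  then show ?thesis
    using t branch new push(1,2) old v u(3,4) unfolding discovering_def by auto
qed

lemma discovering_record_branch:
  assumes t: "discovering v D t" "has_input t" "t CUR 0 = v" "t NBR 0 = x" and x: "x \<in> N v"
    "t NUM x \<noteq> 0"
  shows "discovering v (insert x D) (effect record_branch t)"
proof -
  note head = discovering_head[OF t(1)]
  have "aval (partner_of (var CUR)) t = partner v"
    using aval_partner_of[OF t(2), of "var CUR" v] t(3) tightD[OF C head(4)] by simp
  then have eff: "effect record_branch t = (if t NUM v < t NUM x \<and> x \<noteq> partner v
      then store_var (store_var t BRANCH v) CHILD x else t)"
    using t(3,4) by (simp add: record_branch_def)
  show ?thesis
  proof (cases "t NUM v < t NUM x \<and> x \<noteq> partner v")
    case True
    let ?u = "store_var (store_var t BRANCH v) CHILD x"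
    have "numbering_core C r vs f ?u"
      by (rule numbering_core_cong[of C r vs f t]) (use t(1) in \<open>simp_all add: discovering_def\<close>)
    moreover have "new_branch v ?u" using True x(1) by (simp add: new_branch_def)
    ultimately show ?thesis using t(1) x(2) True by (simp add: eff discovering_def)
  next
    case False
    then show ?thesis using t(1) x(2) unfolding eff discovering_def by auto
  qed
qed

lemma discovering_discover:
  assumes t: "discovering v D t" "has_input t" "t CUR 0 = v" "t NBR 0 = x" and x: "x \<in> N v"
  shows "discovering v (insert x D) (effect discover t)"
proof -
  define u where "u = effect (Cond (Cell NUM (var NBR)) Skip (number_pair (var NBR))) t"
  have off: "agrees_off {ORD, NUM, LEN} t u"
    using effect_agrees_off[of "Cond (Cell NUM (var NBR)) Skip (number_pair (var NBR))" t]
    by (simp add: u_def)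
  have eqs: "u CUR 0 = v" "u NBR 0 = x" using agrees_offD[OF off] t(3,4) by simp_all
  have inp: "has_input u" by (rule has_input_agrees_off[OF t(2) off]) auto
  have "discovering v D u \<and> u NUM x \<noteq> 0"
  proof (cases "t NUM x = 0")
    case True
    have "x \<in> C" using tightD(1)[OF C discovering_head(4)[OF t(1)]] x by blast
    have eff: "u = effect (number_pair (var NBR)) t" using True t(4) by (simp add: u_def)
    note pair = effect_number_pair[OF t(2,4) tightD(4,3)[OF C \<open>x \<in> C\<close>], simplified, folded eff]
    have "discovering v D u"
      by (rule discovering_number_pair[OF t(1) x True pair]) (use agrees_offD[OF off] in simp_all)
    moreover have "u NUM x \<noteq> 0" by (simp add: pair(1))
    ultimately show ?thesis ..
  next
    case False
    then show ?thesis using t(1,4) by (simp add: u_def)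
  qed
  then show ?thesis
    using discovering_record_branch[OF _ inp eqs x] by (simp add: discover_def u_def)
qed

lemma numbering_inv_expand:
  assumes t: "numbering_inv t" "t HEAD 0 < t LEN 0" "has_input t"
  shows "numbering_inv (effect (expand discover) t)"
proof -
  define v where "v = t ORD (t HEAD 0)"
  have start: "discovering v {} t" using t(1,2) by (simp add: numbering_inv_def discovering_def v_def)
  have vC: "v \<in> C" by (rule discovering_head[OF start])
  obtain u where u: "effect (expand discover) t = store_var u HEAD (Suc (t HEAD 0))"
    "discovering v (N v) u" "u HEAD 0 = t HEAD 0"
  proof (rule effect_expand[where J = "discovering v" and v = v, OF t(3) v_def[symmetric]])
    show "discovering v {} (store_var t CUR v)" by (rule discovering_cong[OF start]) simp_all
    fix D x u assume u: "x \<in> N v" "discovering v D u" "u CUR 0 = v" "has_input u"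
    have "discovering v D (store_var u NBR x)" by (rule discovering_cong[OF u(2)]) simp_all
    then show "discovering v (insert x D) (effect discover (store_var u NBR x))"
      using u by (intro discovering_discover) simp_all
  qed (use tightD(4)[OF C vC] in auto)
  note head = discovering_head[OF u(2)]
  let ?t = "store_var u HEAD (Suc (t HEAD 0))"
  have exp: "expanded_in ?t = insert v (expanded_in u)" using expanded_Suc[OF head(1-3)] head(6) u(3) by simp
  have closed: "u NUM w \<noteq> 0" if "w \<in> N v" for w using that u(2) by (simp add: discovering_def)
  have "numbering_core C r vs f ?t"
  proof -
    have core: "numbering_core C r vs f u" using u(2) by (simp add: discovering_def)
    then have "\<forall>z\<in>expanded_in ?t. \<forall>w\<in>N z. u NUM w \<noteq> 0" using closed unfolding exp numbering_core_def by blast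
    then show ?thesis using core head(3) u(3) by (simp add: numbering_core_def)
  qed
  moreover have "branch_recorded (expanded_in ?t) ?t"
  proof (cases "new_branch v u")
    case True
    then show ?thesis
      using last_branch_new[OF head(1-3), of "u CHILD 0"] head(5,6) u(3)
      by (simp add: new_branch_def branch_recorded_def)
  next
    case False
    then have old: "expanded_in u = {} \<or> branch_recorded (expanded_in u) u"
      "\<And>w. w \<in> N v \<Longrightarrow> w \<noteq> partner v \<Longrightarrow> \<not> u NUM v < u NUM w"
      using u(2) by (auto simp: discovering_def)
    show ?thesis
      using last_branch_expand[OF head(1-3) C, of "u BRANCH 0" "u CHILD 0"] closed old head(5,6) u(3)
      by (simp add: branch_recorded_def)
  qed
  ultimately show ?thesis by (simp add: u(1) numbering_inv_def)
qed

end

end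

section \<open>Matching backbones\<close>

definition push_slack :: com where
  "push_slack = Cond (Add
       (Sub (Const 1) (Sub (Cell H_OFF (Add (var VTX) (Const 1))) (Cell H_OFF (var VTX))))
       (Sub (Const 4) (Sub (Cell G_OFF (Add (var VTX) (Const 1))) (Cell G_OFF (var VTX)))))
     (push (var VTX)) Skip"

definition search_from_slack :: com where
  "search_from_slack = Seq (for_vertices push_slack) (search visit)"

definition number_component :: com where
  "number_component = Seq (number_pair (var VTX)) (search discover)"

definition remove_branch :: com where
  "remove_branch = Seq (set_var LEN (var START)) (Seq (set_var HEAD (var START))
     (Seq (Assign COL (var CHILD) (Const 2)) (Seq (Assign COL (partner_of (var CHILD)) (Const 4))
     (Seq (Assign VIS (var CHILD) (Const 1)) (Seq (Assign VIS (partner_of (var CHILD)) (Const 1))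
     (Seq (Assign VIS (var BRANCH) (Const 1)) (push (partner_of (var BRANCH)))))))))"

definition push_branch :: com where
  "push_branch = Seq (push (var BRANCH)) (incr HEAD)"

definition order_component :: com where
  "order_component = Seq remove_branch (Seq (search visit) push_branch)"

definition arrange_component :: com where
  "arrange_component = Seq (set_var START (var LEN)) (Seq number_component order_component)"

definition arrange_unvisited :: com where
  "arrange_unvisited = Cond (Cell VIS (var VTX)) Skip arrange_component"

definition matching_program :: com where
  "matching_program = Seq search_from_slack (Seq (for_vertices arrange_unvisited) (two_pass 5))"

lemma loop_free_push_slack [simp]: "loop_free push_slack"
  and writes_push_slack [simp]: "writes push_slack = {ORD, VIS, LEN}"
  by (auto simp: push_slack_def)

lemma writes_search_from_slack [simp]:
  "writes search_from_slack = {ORD, VIS, CUR, NBR, VTX, LEN, HEAD}"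
  by (auto simp: search_from_slack_def)

lemma writes_number_component [simp]:
  "writes number_component = {ORD, NUM, CUR, NBR, LEN, HEAD, BRANCH, CHILD}"
  by (auto simp: number_component_def)

lemma loop_free_remove_branch [simp]: "loop_free remove_branch"
  and writes_remove_branch [simp]: "writes remove_branch = {COL, ORD, VIS, LEN, HEAD}"
  by (auto simp: remove_branch_def)

lemma loop_free_push_branch [simp]: "loop_free push_branch"
  and writes_push_branch [simp]: "writes push_branch = {ORD, VIS, LEN, HEAD}"
  by (auto simp: push_branch_def)

lemma writes_arrange_unvisited [simp]:
  "writes arrange_unvisited = {COL, ORD, VIS, NUM, CUR, NBR, LEN, HEAD, BRANCH, CHILD, START}"
  by (auto simp: arrange_unvisited_def arrange_component_def order_component_def)

definition number_cost :: "nat \<Rightarrow> nat" where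
  "number_cost k = cost (number_pair (var VTX)) + (6 + cost (expand discover)) * (k + 1)"

definition order_cost :: "nat \<Rightarrow> nat" where
  "order_cost k = cost remove_branch + ((6 + cost (expand visit)) * (k + 1) + cost push_branch)"

definition arrange_vertex_cost :: nat where
  "arrange_vertex_cost = 12 + cost (expand discover) + cost (expand visit)"

definition arrange_cost :: nat where
  "arrange_cost = 8 + number_cost 0 + order_cost 0"

definition matching_cost :: nat where
  "matching_cost =
     36 + cost push_slack + cost (expand visit) + arrange_cost + arrange_vertex_cost + two_pass_cost 5"

context matching_input
begin

definition component_numbered :: "nat set \<Rightarrow> nat \<Rightarrow> nat list \<Rightarrow> (nat \<Rightarrow> nat) \<Rightarrow> store \<Rightarrow> bool" where
  "component_numbered C r vs f t \<longleftrightarrow> map (t ORD) [0..<length vs] = vs \<and> (\<forall>z. z \<notin> C \<longrightarrow> t NUM z = f z) \<and>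
     search_numbering C r (t NUM) \<and> branch_recorded C t"

lemma component_numbered_complete:
  assumes inv: "numbering_inv C r vs f t" and t: "length vs < t LEN 0" "t HEAD 0 = t LEN 0"
    and C: "tight C" "C = component r"
  shows "component_numbered C r vs f t"
proof -
  have core: "numbering_core C r vs f t" using inv by (simp add: numbering_inv_def[OF C(1)])
  then have num: "numbered C r (length vs) (t NUM) (t ORD) (t LEN 0)" by (simp add: numbering_core_def)
  have root: "t NUM r \<noteq> 0" using numbered_root[OF num t(1)] tightD(1)[OF C(1)] by blast
  have closed: "t NUM w \<noteq> 0" if "z \<in> expanded C (t NUM) (t LEN 0)" "w \<in> N z" for z w
    using that core t(2) by (simp add: numbering_core_def)
  have complete: "search_numbering C r (t NUM)" "expanded C (t NUM) (t LEN 0) = C"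
    by (rule search_numbering_complete[OF num C(2) root], rule closed, assumption+)+
  have "r \<in> C" unfolding C(2) by (rule component_root)
  then have "branch_recorded C t"
    using inv complete(2) t(2) by (auto simp: numbering_inv_def[OF C(1)])
  then show ?thesis using core complete(1) by (simp add: component_numbered_def numbering_core_def)
qed

lemma runs_number_component:
  assumes s: "has_input s" "s VTX 0 = r" "s LEN 0 = length vs" "s HEAD 0 = length vs"
    "map (s ORD) [0..<length vs] = vs"
    and C: "tight C" "C = component r" and num: "\<And>z. z \<in> C \<Longrightarrow> s NUM z = 0"
  shows "runs number_component s (number_cost (card C)) (component_numbered C r vs (s NUM))"
  unfolding number_component_def number_cost_def
proof (rule runs_Seq_loop_free)
  let ?u = "effect (number_pair (var VTX)) s"
  let ?I = "\<lambda>t. numbering_inv C r vs (s NUM) t \<and> length vs < t LEN 0"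
  have off: "agrees_off {ORD, NUM, LEN} s ?u"
    using effect_agrees_off[of "number_pair (var VTX)" s] by simp
  have head: "?u HEAD 0 = length vs" using agrees_offD[OF off] s(4) by simp
  have r: "r \<in> C" using C(2) component_root by simp
  note pair = effect_number_pair[OF s(1,2) tightD(4,3)[OF C(1) r]]
  have "numbering_core C r vs (s NUM) s"
    using s(3-5) num by (auto simp: numbering_core_def numbered_def expanded_def)
  note push = numbering_core_push[OF C(1) this r num[OF r]]
  have core: "numbering_core C r vs (s NUM) ?u" and exp: "expanded C (?u NUM) (?u HEAD 0) = {}"
    using push(1,2)[where u = ?u] pair head s(4) num by (simp_all add: expanded_def)
  have "runs (search discover) ?u ((6 + cost (expand discover)) * (card C + 1))
      (\<lambda>t. ?I t \<and> t HEAD 0 = t LEN 0)"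
  proof (rule runs_search[where I = ?I])
    show "has_input ?u" by (rule has_input_agrees_off[OF s(1) off]) auto
    show "?I ?u" using core exp pair(3) s(3) by (simp add: numbering_inv_def[OF C(1)])
    fix t assume t: "?I t"
    then have core: "numbering_core C r vs (s NUM) t" by (simp add: numbering_inv_def[OF C(1)])
    then show "t HEAD 0 \<le> t LEN 0 \<and> t LEN 0 \<le> ?u HEAD 0 + card C"
      using numbered_length finite_subset[OF tight_subset[OF C(1)] finite_V]
      by (auto simp: numbering_core_def head)
    assume t': "t HEAD 0 < t LEN 0" "has_input t"
    let ?t = "effect (expand discover) t"
    have inv: "numbering_inv C r vs (s NUM) ?t" using numbering_inv_expand[OF C(1) _ t'] t by blast
    then have "length vs < ?t LEN 0"
      using core effect_expand_HEAD[of discover t]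
      by (simp add: numbering_inv_def[OF C(1)] numbering_core_def)
    then show "?I ?t" using inv by blast
  qed auto
  then show "runs (search discover) ?u ((6 + cost (expand discover)) * (card C + 1))
      (component_numbered C r vs (s NUM))"
    by (rule runs_mono) (use component_numbered_complete C in auto)
qed simp

definition arranged :: "nat list \<Rightarrow> store \<Rightarrow> bool" where
  "arranged vs t \<longleftrightarrow> map (t ORD) [0..<t LEN 0] = vs \<and> t HEAD 0 = t LEN 0 \<and> arrangement (t COL) vs \<and>
     (\<forall>v\<in>V. t VIS v \<noteq> 0 \<longleftrightarrow> v \<in> covered (t COL) vs) \<and>
     (\<forall>v\<in>V. slack v \<or> t NUM v \<noteq> 0 \<longrightarrow> v \<in> covered (t COL) vs)"

lemma arrangedD:
  assumes "arranged vs t"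
  shows "map (t ORD) [0..<t LEN 0] = vs" "t LEN 0 = length vs" "t HEAD 0 = length vs"
    "arrangement (t COL) vs"
    "v \<in> V \<Longrightarrow> t VIS v \<noteq> 0 \<longleftrightarrow> v \<in> covered (t COL) vs"
    "v \<in> V \<Longrightarrow> slack v \<Longrightarrow> v \<in> covered (t COL) vs" "v \<in> V \<Longrightarrow> t NUM v \<noteq> 0 \<Longrightarrow> v \<in> covered (t COL) vs"
  using assms by (auto simp: arranged_def)

lemma tight_component_unvisited:
  assumes t: "arranged vs t" and r: "r \<in> V" "t VIS r = 0"
  shows "tight (component r)" "component r \<inter> covered (t COL) vs = {}"
proof -
  let ?U = "V - covered (t COL) vs"
  note arr = arrangementD[OF arrangedD(4)[OF t]]
  have U: "component r \<subseteq> ?U"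
  proof (rule component_least)
    show "r \<in> ?U" using r arrangedD(5)[OF t] by blast
    show "N z \<subseteq> ?U" if "z \<in> ?U" for z using that arr(6) N_D by blast
  qed
  then show "component r \<inter> covered (t COL) vs = {}" by auto
  show "tight (component r)"
    unfolding tight_def using component_closed arrangedD(6)[OF t] U by blast
qed

lemma branch_recordedD:
  assumes "branch_recorded C t" and C: "tight C"
  defines "u \<equiv> t BRANCH 0" and "x \<equiv> t CHILD 0"
  shows "u \<in> C" "x \<in> C" "x \<in> N u" "x \<noteq> partner u" "last_branch C (t NUM) u x"
    "partner u \<notin> {x, partner x, u}" "partner x \<notin> {x, u}"
proof -
  show u: "u \<in> C" and branch: "last_branch C (t NUM) u x"
    using assms(1) by (simp_all add: branch_recorded_def u_def x_def)
  show x: "x \<in> N u" "x \<noteq> partner u" using last_branchD[OF branch] by simp_all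
  show xC: "x \<in> C" using tightD(1)[OF C u] x(1) by blast
  have "x \<noteq> u" using x(1) N_D by blast
  then show "partner u \<notin> {x, partner x, u}" "partner x \<notin> {x, u}"
    using x(2) tight_partner(3,5)[OF C u] tight_partner(3,5)[OF C xC] by auto
qed

lemma effect_remove_branch:
  assumes s: "arranged vs s" "has_input t" "t START 0 = length vs" "map (t ORD) [0..<length vs] = vs"
      "t COL = s COL" "t VIS = s VIS"
    and C: "C \<inter> covered (s COL) vs = {}" "tight C" and branch: "branch_recorded C t"
  defines "u \<equiv> t BRANCH 0" and "x \<equiv> t CHILD 0" and "t' \<equiv> effect remove_branch t"
  shows "search_inv vs (covered (s COL) vs \<union> {x, partner x, u}) C {partner u} [partner u] t'"
    and "t' HEAD 0 = length vs" and "t' COL = precolor (s COL) x (partner x)"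
proof -
  note ux = branch_recordedD[OF branch C(2), folded u_def x_def]
  have p: "aval (partner_of (var CHILD)) t = partner x" "aval (partner_of (var BRANCH)) t = partner u"
    using tightD(3,4)[OF C(2) ux(1)] tightD(3,4)[OF C(2) ux(2)] aval_partner_of[OF s(2)]
    by (simp_all add: u_def x_def)
  have t': "t' ORD = (t ORD)(length vs := partner u)" "t' LEN 0 = Suc (length vs)"
    "t' HEAD 0 = length vs"
    "t' VIS = (t VIS)(x := 1, partner x := 1, u := 1, partner u := 1)"
    "t' COL = (t COL)(x := 2, partner x := 4)"
    using p s(3) by (auto simp: t'_def remove_branch_def push_def partner_of_def u_def x_def fun_eq_iff)
  show "t' HEAD 0 = length vs" "t' COL = precolor (s COL) x (partner x)"
    using t' s(5) by (simp_all add: precolor_def)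
  have pu: "partner u \<in> C" by (rule tight_partner[OF C(2) ux(1)])
  have "map (t' ORD) [0..<t' LEN 0] = vs @ [partner u]" using s(4) by (simp add: t')
  moreover have "partner u \<notin> covered (s COL) vs" using pu C(1) by blast
  moreover have "t' VIS v \<noteq> 0 \<longleftrightarrow> v \<in> {partner u} \<union> (covered (s COL) vs \<union> {x, partner x, u})"
    if "v \<in> V" for v
    using arrangedD(5)[OF s(1) that] by (auto simp: t' s(6))
  ultimately show "search_inv vs (covered (s COL) vs \<union> {x, partner x, u}) C {partner u} [partner u] t'"
    using pu ux(6) by (simp add: search_inv_def search_order_def t'(2,3))
qed

lemma arranged_extend:
  assumes s: "arranged vs s" and C: "C \<inter> covered (s COL) vs = {}" "tight C"
    and t: "component_numbered C r vs (s NUM) t"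
  defines "u \<equiv> t BRANCH 0" and "x \<equiv> t CHILD 0"
  defines "X \<equiv> covered (s COL) vs \<union> {x, partner x, u}"
  assumes w: "w NUM = t NUM" "w BRANCH = t BRANCH" "w COL = precolor (s COL) x (partner x)"
    "w HEAD 0 = w LEN 0"
    and cs: "search_inv vs X C {partner u} cs w" "partner u \<in> set cs"
      "\<And>z. z \<in> set cs \<Longrightarrow> N z \<subseteq> set cs \<union> X"
  defines "w' \<equiv> effect push_branch w"
  shows "arranged (vs @ cs @ [u]) w'" and "covered (w' COL) (vs @ cs @ [u]) = covered (s COL) vs \<union> C"
proof -
  have num: "search_numbering C r (t NUM)" "\<And>z. z \<notin> C \<Longrightarrow> t NUM z = s NUM z"
    and branch: "branch_recorded C t"
    using t by (simp_all add: component_numbered_def)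
  note ux = branch_recordedD[OF branch C(2), folded u_def x_def]
  note pu = tight_partner[OF C(2) ux(1)] and px = tight_partner[OF C(2) ux(2)]
  have order: "search_order {partner u} cs" "set cs \<subseteq> C - {x, partner x, u}"
    using cs(1) by (auto simp: search_inv_def X_def)
  have "C - {x, partner x, u} \<subseteq> set cs"
  proof (rule connected_without_last_branch[OF num(1) C(2) ux(1,5) cs(2)])
    fix z w assume "z \<in> set cs" "w \<in> N z" "w \<notin> {x, partner x, u}"
    then show "w \<in> set cs" using cs(3) order(2) tightD(1)[OF C(2)] C(1) unfolding X_def by blast
  qed
  with order(2) have set_cs: "set cs = C - {x, partner x, u}" by blast
  note extend = arrangedD(4)[OF s] C(1) tight_subset[OF C(2)] tightD(1)[OF C(2)] ux(1) pu(6) ux(3,4) px(6)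
    order(1) set_cs cs(2)
  have w': "w' ORD = (w ORD)(w LEN 0 := u)" "w' VIS = (w VIS)(u := 1)" "w' LEN 0 = Suc (w LEN 0)"
    "w' HEAD 0 = Suc (w HEAD 0)" "w' COL = precolor (s COL) x (partner x)" "w' NUM = t NUM"
    using w(1-3) by (auto simp: w'_def push_branch_def push_def u_def fun_eq_iff)
  show cov: "covered (w' COL) (vs @ cs @ [u]) = covered (s COL) vs \<union> C"
    unfolding w' by (rule covered_extend[OF extend])
  have "map (w' ORD) [0..<w' LEN 0] = vs @ cs @ [u]" using cs(1) by (simp add: w' search_inv_def)
  moreover have "w' VIS v \<noteq> 0 \<longleftrightarrow> v \<in> covered (s COL) vs \<union> C" if "v \<in> V" for v
    using search_inv_VIS[OF cs(1) that] set_cs ux(1,2) px(1) by (auto simp: w' X_def)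
  moreover have "v \<in> covered (s COL) vs \<union> C" if "v \<in> V" "slack v \<or> t NUM v \<noteq> 0" for v
    using that arrangedD(6,7)[OF s that(1)] num(2)[of v] by auto
  moreover have "arrangement (w' COL) (vs @ cs @ [u])"
    unfolding w'(5) by (rule arrangement_extend[OF extend])
  ultimately show "arranged (vs @ cs @ [u]) w'" using w(4) by (simp add: arranged_def cov w'(3,4,6))
qed

lemma runs_order_component:
  assumes s: "arranged vs s" "has_input t" "t START 0 = length vs" "t COL = s COL" "t VIS = s VIS"
    and C: "C \<inter> covered (s COL) vs = {}" "tight C" and t: "component_numbered C r vs (s NUM) t"
  shows "runs order_component t (order_cost (card C))
    (\<lambda>t'. \<exists>vs'. arranged vs' t' \<and> covered (t' COL) vs' = covered (s COL) vs \<union> C)"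
    (is "runs _ _ _ ?Q")
  unfolding order_component_def order_cost_def
proof (rule runs_Seq_loop_free)
  define u x where "u = t BRANCH 0" and "x = t CHILD 0"
  define X where "X = covered (s COL) vs \<union> {x, partner x, u}"
  define t' where "t' = effect remove_branch t"
  have off: "agrees_off (writes remove_branch) t t'" unfolding t'_def by (rule effect_agrees_off)
  have inp: "has_input t'" by (rule has_input_agrees_off[OF s(2) off]) auto
  have ord: "map (t ORD) [0..<length vs] = vs" and branch: "branch_recorded C t"
    using t by (simp_all add: component_numbered_def)
  note remove = effect_remove_branch[OF s(1-3) ord s(4,5) C branch, folded u_def x_def, folded X_def t'_def]
  have closed: "N z \<subseteq> C \<union> X" if "z \<in> C" for z using tightD(1)[OF C(2) that] by blast
  show "runs (Seq (search visit) push_branch) (effect remove_branch t)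
      ((6 + cost (expand visit)) * (card C + 1) + cost push_branch) ?Q"
    unfolding t'_def[symmetric]
  proof (rule runs_Seq[OF runs_search_visit[OF inp remove(1,2) tight_subset[OF C(2)] closed]])
    fix w assume "\<exists>ws. search_inv vs X C {partner u} ([partner u] @ ws) w \<and> w HEAD 0 = w LEN 0 \<and>
        (\<forall>z\<in>set ([partner u] @ ws). N z \<subseteq> set ([partner u] @ ws) \<union> X)"
      and off': "agrees_off (writes (search visit)) t' w"
    then obtain ws where ws: "search_inv vs X C {partner u} ([partner u] @ ws) w" "w HEAD 0 = w LEN 0"
      "\<And>z. z \<in> set ([partner u] @ ws) \<Longrightarrow> N z \<subseteq> set ([partner u] @ ws) \<union> X" by blast
    have w: "w NUM = t NUM" "w BRANCH = t BRANCH" "w COL = precolor (s COL) x (partner x)"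
      using agrees_offD[OF off'] agrees_offD[OF off] remove(3) by simp_all
    have "?Q (effect push_branch w)"
      using arranged_extend[OF s(1) C t, folded u_def x_def, folded X_def, OF w ws(2,1) _ ws(3)]
      by (intro exI[of _ "vs @ ([partner u] @ ws) @ [u]"]) simp
    then show "runs push_branch w (cost push_branch) ?Q" by (intro runs_loop_free) simp_all
  qed
qed simp

lemma runs_arrange_component:
  assumes s: "has_input s" "arranged vs s" "s VTX 0 = r" "r \<in> V" "s VIS r = 0"
  defines "C \<equiv> component r"
  shows "runs arrange_component s (4 + number_cost (card C) + order_cost (card C))
    (\<lambda>t. \<exists>vs'. arranged vs' t \<and> covered (t COL) vs' = covered (s COL) vs \<union> C)"
    (is "runs _ _ _ ?Q")
proof -
  note C = tight_component_unvisited[OF s(2,4,5), folded C_def]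
  note arr = arrangedD[OF s(2)]
  let ?s = "store_var s START (length vs)"
  have num: "?s NUM z = 0" if "z \<in> C" for z using arr(7)[of z] C(2) tightD(4)[OF C(1) that] that by auto
  have "runs (Seq number_component order_component) ?s (number_cost (card C) + order_cost (card C)) ?Q"
  proof (rule runs_Seq)
    show "runs number_component ?s (number_cost (card C)) (component_numbered C r vs (?s NUM))"
      using s(1,3) arr(1-3) by (intro runs_number_component C(1) num) (auto simp: C_def)
    fix t assume t: "component_numbered C r vs (?s NUM) t" "agrees_off (writes number_component) ?s t"
    have "has_input t" by (rule has_input_agrees_off[OF _ t(2)]) (use s(1) in auto)
    then show "runs order_component t (order_cost (card C)) ?Q"
      using t(1) agrees_offD[OF t(2)] by (intro runs_order_component[OF s(2)] C) simp_all
  qed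
  then have "runs arrange_component s
      (cost (set_var START (var LEN)) + (number_cost (card C) + order_cost (card C))) ?Q"
    unfolding arrange_component_def using arr(2) by (intro runs_Seq_loop_free) simp_all
  then show ?thesis by (rule runs_mono) simp_all
qed

definition unvisited :: "store \<Rightarrow> nat set" where
  "unvisited t = {v \<in> V. t VIS v = 0}"

lemma card_unvisited:
  assumes "arranged vs t" "arranged vs' t'" "covered (t' COL) vs' = covered (t COL) vs \<union> C"
    and C: "C \<inter> covered (t COL) vs = {}" "C \<subseteq> V"
  shows "card (unvisited t) = card (unvisited t') + card C"
proof -
  note visited = arrangedD(5)[OF assms(1)] arrangedD(5)[OF assms(2)]
  have "unvisited t = unvisited t' \<union> C" "unvisited t' \<inter> C = {}"
    using visited assms(3) C unfolding unvisited_def by blast+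
  moreover have "finite (unvisited t')" "finite C"
    using finite_V finite_subset[OF C(2)] by (simp_all add: unvisited_def)
  ultimately show ?thesis by (simp add: card_Un_disjoint)
qed

lemma runs_arrange_unvisited:
  assumes t: "has_input t" "arranged vs t" "t VTX 0 = i" "i \<in> V"
  shows "\<exists>T. runs arrange_unvisited t T (\<lambda>t'.
      (\<exists>vs'. arranged vs' t' \<and> insert i (covered (t COL) vs) \<subseteq> covered (t' COL) vs') \<and>
      T + arrange_vertex_cost * card (unvisited t')
        \<le> arrange_vertex_cost * card (unvisited t) + arrange_cost)"
    (is "\<exists>T. runs _ _ _ (?Q T)")
proof (cases "t VIS i = 0")
  case False
  then have "i \<in> covered (t COL) vs" using arrangedD(5)[OF t(2,4)] by blast
  then have "runs arrange_unvisited t (1 + acost (Cell VIS (var VTX)) + cost Skip) (?Q 5)"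
    unfolding arrange_unvisited_def
    using t(2,3) False by (intro runs_Cond runs_loop_free) (auto simp: arrange_cost_def)
  then show ?thesis by (intro exI[of _ 5], elim runs_mono) simp_all
next
  case True
  define k where "k = card (component i)"
  let ?T = "4 + number_cost k + order_cost k"
  note C = tight_component_unvisited[OF t(2,4) True]
  have "runs arrange_component t ?T (?Q (4 + ?T))"
    unfolding k_def using runs_arrange_component[OF t True]
  proof (rule runs_mono)
    fix t' assume "\<exists>vs'. arranged vs' t' \<and> covered (t' COL) vs' = covered (t COL) vs \<union> component i"
    then obtain vs' where vs': "arranged vs' t'"
      "covered (t' COL) vs' = covered (t COL) vs \<union> component i" by blast
    have "card (unvisited t) = card (unvisited t') + k"
      unfolding k_def by (rule card_unvisited[OF t(2) vs' C(2) tight_subset[OF C(1)]])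
    then show "?Q (4 + (4 + number_cost (card (component i)) + order_cost (card (component i)))) t'"
      using vs' component_root[of i]
      by (auto simp: k_def number_cost_def order_cost_def arrange_cost_def arrange_vertex_cost_def
          algebra_simps)
  qed simp
  then have "runs arrange_unvisited t (1 + acost (Cell VIS (var VTX)) + ?T) (?Q (4 + ?T))"
    unfolding arrange_unvisited_def using t(3) True by (intro runs_Cond) simp_all
  then show ?thesis by (intro exI[of _ "4 + ?T"]) simp
qed

lemma runs_arrange_components:
  assumes s: "has_input s" "arranged vs s"
  shows "runs (for_vertices arrange_unvisited) s (9 + (12 + arrange_cost + arrange_vertex_cost) * n)
    (\<lambda>t. \<exists>vs'. arranged vs' t \<and> V \<subseteq> covered (t COL) vs')"
proof -
  let ?\<Phi> = "\<lambda>t. arrange_vertex_cost * card (unvisited t)"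
  let ?J = "\<lambda>i t. \<exists>vs'. arranged vs' t \<and> {..<i} \<subseteq> covered (t COL) vs'"
  have "runs (for_vertices arrange_unvisited) s (9 + (12 + arrange_cost) * n + ?\<Phi> s) (?J n)"
  proof (rule runs_for_vertices[where \<Phi> = ?\<Phi>])
    fix i t assume i: "i < n" "t VTX 0 = i" "?J i t"
      "agrees_off (insert VTX (writes arrange_unvisited)) s t"
    obtain vs where vs: "arranged vs t" "{..<i} \<subseteq> covered (t COL) vs" using i(3) by blast
    have inp: "has_input t" by (rule has_input_agrees_off[OF s(1) i(4)]) auto
    have "i \<in> V" using i(1) in_V_iff by blast
    from runs_arrange_unvisited[OF inp vs(1) i(2) this]
    show "\<exists>T. runs arrange_unvisited t T (\<lambda>t'. ?J (Suc i) t' \<and> T + ?\<Phi> t' \<le> ?\<Phi> t + arrange_cost)"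
      using vs(2) by (elim exE, intro exI, elim runs_mono) (auto simp: lessThan_Suc)
  qed (use s has_inputD[OF s(1)] in \<open>auto simp: arranged_def unvisited_def\<close>)
  then show ?thesis
  proof (rule runs_mono)
    have "card (unvisited s) \<le> n" unfolding unvisited_def using finite_V by (intro card_mono) auto
    then have "?\<Phi> s \<le> arrange_vertex_cost * n" by (rule mult_le_mono2)
    then show "9 + (12 + arrange_cost) * n + ?\<Phi> s \<le> 9 + (12 + arrange_cost + arrange_vertex_cost) * n"
      by (simp add: algebra_simps)
  qed (simp add: V_eq[symmetric])
qed

lemma effect_push_slack:
  assumes "has_input t" "t VTX 0 = i" "i < n"
  shows "effect push_slack t = (if slack i then effect (push (var VTX)) t else t)"
proof -
  note deg = degree_cells[OF assms(1,3)]
  have "card (B i) = 0 \<longleftrightarrow> B i = {}" by simp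
  then have "slack i \<longleftrightarrow> card (B i) = 0 \<or> card (N i) < 4" by (simp add: slack_def)
  then show ?thesis using deg assms(2) by (auto simp: push_slack_def Suc_le_eq)
qed

lemma runs_push_slack:
  assumes s: "s = input_store lam adjG adjH"
  shows "runs (for_vertices push_slack) s (9 + (12 + cost push_slack) * n)
    (\<lambda>t. \<exists>cs. search_inv [] {} V {v. slack v} cs t \<and> t HEAD 0 = 0 \<and> set cs = {v \<in> V. slack v})"
proof -
  have inp: "has_input s" by (simp add: s has_input_store)
  let ?J = "\<lambda>i t. \<exists>cs. search_inv [] {} V {v. slack v} cs t \<and> t HEAD 0 = 0 \<and> set cs = {v \<in> {..<i}. slack v}"
  have "runs (for_vertices push_slack) s (9 + (12 + cost push_slack) * n) (?J n)"
  proof (rule runs_for_vertices_loop_free)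
    show "?J 0 s" by (auto simp: s search_inv_def search_order_def input_store_def)
    show "?J i (t(VTX := f)) \<longleftrightarrow> ?J i t" for i t f by (simp add: search_inv_def)
    fix i t assume i: "i < n" "t VTX 0 = i" "?J i t" "agrees_off (insert VTX (writes push_slack)) s t"
    then obtain cs where cs: "search_inv [] {} V {v. slack v} cs t" "t HEAD 0 = 0"
      "set cs = {v \<in> {..<i}. slack v}"
      by blast
    have "has_input t" by (rule has_input_agrees_off[OF inp i(4)]) auto
    note eff = effect_push_slack[OF this i(2,1)]
    have iV: "i \<in> V" using i(1) in_V_iff by blast
    show "?J (Suc i) (effect push_slack t)"
    proof (cases "slack i")
      case True
      have "t VIS i = 0" using search_inv_VIS[OF cs(1) iV] cs(3) by auto
      then have "search_inv [] {} V {v. slack v} (cs @ [i]) (effect push_slack t)"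
        by (intro search_inv_push[OF cs(1) iV iV]) (use True i(2) in \<open>auto simp: eff push_def fun_eq_iff\<close>)
      moreover have "set (cs @ [i]) = {v \<in> {..<Suc i}. slack v}"
        using cs(3) True by (auto simp: less_Suc_eq)
      moreover have "effect push_slack t HEAD 0 = 0" using cs(2) by (simp add: effect_other)
      ultimately show ?thesis by blast
    next
      case False
      then have "set cs = {v \<in> {..<Suc i}. slack v}" using cs(3) by (auto simp: less_Suc_eq)
      then show ?thesis using cs(1,2) False by (auto simp: eff)
    qed
  qed (simp_all add: has_inputD[OF inp])
  then show ?thesis unfolding V_eq[symmetric] .
qed

lemma runs_search_from_slack:
  assumes s: "s = input_store lam adjG adjH"
  shows "runs search_from_slack s (9 + (12 + cost push_slack) * n + (6 + cost (expand visit)) * (n + 1))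
    (\<lambda>t. \<exists>vs. arranged vs t)"
  unfolding search_from_slack_def
proof (rule runs_Seq[OF runs_push_slack[OF s]])
  fix t assume "\<exists>cs. search_inv [] {} V {v. slack v} cs t \<and> t HEAD 0 = 0 \<and> set cs = {v \<in> V. slack v}"
    and off: "agrees_off (writes (for_vertices push_slack)) s t"
  then obtain cs where cs: "search_inv [] {} V {v. slack v} cs t" "t HEAD 0 = length ([] :: nat list)"
    "set cs = {v \<in> V. slack v}" by auto
  have inp: "has_input t" by (rule has_input_agrees_off[OF has_input_store off[unfolded s]]) auto
  have V: "N v \<subseteq> V \<union> {}" for v using N_D by blast
  from runs_agrees_off[OF runs_search_visit[OF inp cs(1,2) order_refl V]]
  show "runs (search visit) t ((6 + cost (expand visit)) * (n + 1)) (\<lambda>t. \<exists>vs. arranged vs t)"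
  proof (rule runs_mono)
    fix u assume "(\<exists>ws. search_inv [] {} V {v. slack v} (cs @ ws) u \<and> u HEAD 0 = u LEN 0 \<and>
        (\<forall>v\<in>set (cs @ ws). N v \<subseteq> set (cs @ ws) \<union> {})) \<and> agrees_off (writes (search visit)) t u"
    then obtain vs where vs: "search_inv [] {} V {v. slack v} vs u" "u HEAD 0 = u LEN 0"
      "set cs \<subseteq> set vs"
      "\<And>v. v \<in> set vs \<Longrightarrow> N v \<subseteq> set vs" and off': "agrees_off (writes (search visit)) t u"
      by (metis Un_empty_right set_append sup_ge1)
    have zero: "u COL = (\<lambda>_. 0)" "u NUM = (\<lambda>_. 0)"
      using agrees_offD[OF off] agrees_offD[OF off'] by (simp_all add: s input_store_def)
    have "arrangement (u COL) vs"
      unfolding zero using vs by (intro arrangement_search_order) (auto simp: search_inv_def)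
    then have "arranged vs u"
      using vs cs(3) search_inv_VIS[OF vs(1)]
      by (auto simp: arranged_def zero covered_def search_inv_def)
    then show "\<exists>vs. arranged vs u" ..
  qed simp
qed

theorem runs_matching_program:
  assumes "2 \<le> lam"
  shows "runs matching_program (input_store lam adjG adjH) (matching_cost * (n + 1))
    (\<lambda>t. backbone_k_coloring lam (2 * lam + 1) G H (t OUT))"
proof -
  let ?s = "input_store lam adjG adjH"
  let ?Q = "\<lambda>t. backbone_k_coloring lam (2 * lam + (5 - 4)) G H (t OUT)"
  have "runs matching_program ?s (9 + (12 + cost push_slack) * n + (6 + cost (expand visit)) * (n + 1) +
      (9 + (12 + arrange_cost + arrange_vertex_cost) * n + two_pass_cost 5 * (n + 1))) ?Q"
    unfolding matching_program_def
  proof (rule runs_Seq[OF runs_search_from_slack[OF refl]])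
    fix t assume t: "\<exists>vs. arranged vs t" "agrees_off (writes search_from_slack) ?s t"
    then obtain vs where vs: "arranged vs t" by blast
    have inp: "has_input t" by (rule has_input_agrees_off[OF has_input_store t(2)]) auto
    show "runs (Seq (for_vertices arrange_unvisited) (two_pass 5)) t
        (9 + (12 + arrange_cost + arrange_vertex_cost) * n + two_pass_cost 5 * (n + 1)) ?Q"
    proof (rule runs_Seq[OF runs_arrange_components[OF inp vs]])
      fix u assume "\<exists>vs. arranged vs u \<and> V \<subseteq> covered (u COL) vs"
        and off: "agrees_off (writes (for_vertices arrange_unvisited)) t u"
      then obtain vs where vs: "arranged vs u" "V \<subseteq> covered (u COL) vs" by blast
      note order = arrangedD(1)[OF vs(1)] and arr = arrangedD(4)[OF vs(1)]
      have zero: "u LOW = (\<lambda>_. 0)" "u HIGH = (\<lambda>_. 0)"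
        using agrees_offD[OF t(2)] agrees_offD[OF off] by (simp_all add: input_store_def)
      have "has_input u" by (rule has_input_agrees_off[OF inp off]) auto
      moreover have "u COL v \<le> 5" for v using arrangementD(3)[OF arr, of v] by auto
      ultimately show "runs (two_pass 5) u (two_pass_cost 5 * (n + 1)) ?Q"
        using zero assms order arrangementD(1,4)[OF arr] arrangement_colorable[OF arr vs(2)]
        by (intro runs_two_pass[of u 5 vs]) auto
    qed
  qed
  then show ?thesis by (rule runs_mono) (simp_all add: matching_cost_def algebra_simps)
qed

end

section \<open>Graphs on arbitrary vertices\<close>

lemma spanning_subgraph_spanned_by: "matching G M \<Longrightarrow> spanning_subgraph (spanned_by G M) G"
  by (simp add: spanning_subgraph_def spanned_by_def matching_def)

lemma neighbors_matching_unique: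
  assumes "matching G M" "u \<in> neighbors (spanned_by G M) v" "w \<in> neighbors (spanned_by G M) v"
  shows "u = w"
proof (rule ccontr)
  assume "u \<noteq> w"
  then have "{v, u} \<noteq> {v, w}" by (auto simp: doubleton_eq_iff)
  moreover have "pairwise disjnt M" "{v, u} \<in> M" "{v, w} \<in> M"
    using assms by (auto simp: matching_def neighbors_def spanned_by_def)
  ultimately have "disjnt {v, u} {v, w}" by (metis pairwiseD)
  then show False by (simp add: disjnt_def)
qed

lemma finds_coloring_in_time_matching:
  assumes "simple_graph G" "max_degree G \<le> 4" "2 \<le> lam" "matching G M"
  shows "finds_coloring_in_time matching_program (\<lambda>n. matching_cost * (n + 1)) lam (2 * lam + 1)
    G (spanned_by G M)"
  unfolding finds_coloring_in_time_def
proof (intro allI impI)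
  fix adjG adjH assume adj: "adjacency_lists G adjG \<and> adjacency_lists (spanned_by G M) adjH"
  interpret matching_input G "spanned_by G M" lam adjG adjH
  proof
    show "u = w" if "u \<in> neighbors (spanned_by G M) v" "w \<in> neighbors (spanned_by G M) v" for u v w
      using that by (rule neighbors_matching_unique[OF assms(4)])
  qed (use assms(1,2) adj spanning_subgraph_spanned_by[OF assms(4)] in simp_all)
  show "\<exists>t s. exec matching_program (input_store lam adjG adjH) t s \<and> t \<le> matching_cost * (n + 1) \<and>
      backbone_k_coloring lam (2 * lam + 1) G (spanned_by G M) (s OUT)"
    using runs_matching_program[OF assms(3)] by (simp only: runs_def)
qed

lemma finds_coloring_in_time_forest:
  assumes "simple_graph G" "max_degree G \<le> 4" "2 \<le> lam" "spanning_subgraph H G" "degenerate 1 H"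
  shows "finds_coloring_in_time forest_program (\<lambda>n. forest_cost * (n + 1)) lam (2 * lam + 2) G H"
  unfolding finds_coloring_in_time_def
proof (intro allI impI)
  fix adjG adjH assume adj: "adjacency_lists G adjG \<and> adjacency_lists H adjH"
  interpret input G H lam adjG adjH by unfold_locales (use assms adj in simp_all)
  show "\<exists>t s. exec forest_program (input_store lam adjG adjH) t s \<and> t \<le> forest_cost * (n + 1) \<and>
      backbone_k_coloring lam (2 * lam + 2) G H (s OUT)"
    using runs_forest_program[OF assms(3,5)] by (simp only: runs_def)
qed

lemma ex_adjacency_lists:
  fixes G :: "nat ugraph"
  assumes "finite (edges G)" "verts G = {..<n}"
  shows "\<exists>adj. adjacency_lists G adj"
proof
  show "adjacency_lists G (map (\<lambda>v. sorted_list_of_set (neighbors G v)) [0..<n])"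
    using finite_neighbors[OF assms(1)] assms(2) by (simp add: adjacency_lists_def neighbors_def)
qed

lemma spanning_subgraph_simple: "spanning_subgraph H G \<Longrightarrow> simple_graph G \<Longrightarrow> simple_graph H"
  by (auto simp: spanning_subgraph_def simple_graph_def)

lemma finds_coloring_in_time_ex_coloring:
  assumes "finds_coloring_in_time p T lam k G H" "simple_graph G" "verts G = {..<n}"
    "spanning_subgraph H G"
  shows "\<exists>c. backbone_k_coloring lam k G H c"
proof -
  have "finite (edges G)" "finite (edges H)"
    by (rule simple_graph_finite_edges, rule assms(2) spanning_subgraph_simple[OF assms(4,2)])+
  moreover have "verts H = {..<n}" using assms(3,4) by (simp add: spanning_subgraph_def)
  ultimately obtain adjG adjH where "adjacency_lists G adjG" "adjacency_lists H adjH"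
    using ex_adjacency_lists[of G] ex_adjacency_lists[of H] assms(3) by blast
  then show ?thesis using assms(1) unfolding finds_coloring_in_time_def by blast
qed

definition relabel :: "('a \<Rightarrow> 'b) \<Rightarrow> 'a ugraph \<Rightarrow> 'b ugraph" where
  "relabel f G = \<lparr>verts = f ` verts G, edges = (`) f ` edges G\<rparr>"

lemma simple_graph_relabel: "simple_graph G \<Longrightarrow> inj_on f (verts G) \<Longrightarrow> simple_graph (relabel f G)"
  unfolding simple_graph_def relabel_def by (auto simp: card_image inj_on_subset)

lemma degree_relabel_le:
  assumes "finite (edges G)" "\<And>e. e \<in> edges G \<Longrightarrow> e \<subseteq> A" "inj_on f A" "v \<in> A"
  shows "degree (relabel f G) (f v) \<le> degree G v"
proof -
  have "f v \<in> f ` e \<longleftrightarrow> v \<in> e" if "e \<in> edges G" for e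
    using assms(2)[OF that] assms(3,4) by (intro inj_on_image_mem_iff[of f A]) auto
  then have "{e \<in> edges (relabel f G). f v \<in> e} = (`) f ` {e \<in> edges G. v \<in> e}"
    by (auto simp: relabel_def)
  then show ?thesis unfolding degree_def using assms(1) by (simp add: card_image_le)
qed

lemma max_degree_relabel_le:
  assumes "simple_graph G" "inj_on f (verts G)"
  shows "max_degree (relabel f G) \<le> max_degree G"
proof -
  have V: "finite (verts G)" using assms(1) by (simp add: simple_graph_def)
  have "degree (relabel f G) (f v) \<le> max_degree G" if "v \<in> verts G" for v
    using degree_relabel_le[OF simple_graph_finite_edges[OF assms(1)] _ assms(2) that]
      degree_le_max_degree[OF V that] assms(1) by (force simp: simple_graph_def)
  then show ?thesis unfolding max_degree_def[of "relabel f G"] using V by (auto simp: relabel_def)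
qed

lemma induced_subgraph_relabel:
  assumes "simple_graph G" "inj_on f (verts G)" "T \<subseteq> verts G"
  shows "induced_subgraph (relabel f G) (f ` T) = relabel f (induced_subgraph G T)"
proof -
  have "f ` e \<subseteq> f ` T \<longleftrightarrow> e \<subseteq> T" if "e \<in> edges G" for e
  proof
    assume "f ` e \<subseteq> f ` T"
    moreover have "e \<subseteq> verts G" using assms(1) that by (simp add: simple_graph_def)
    ultimately show "e \<subseteq> T" using inj_on_image_mem_iff[OF assms(2) _ assms(3)] by blast
  qed blast
  then show ?thesis by (auto simp: induced_subgraph_def relabel_def)
qed

lemma degenerate_relabel:
  assumes "simple_graph G" "inj_on f (verts G)" "degenerate d G"
  shows "degenerate d (relabel f G)"
  unfolding degenerate_def
proof (intro allI impI)
  fix S assume S: "S \<subseteq> verts (relabel f G) \<and> S \<noteq> {}"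
  then obtain T where T: "T \<subseteq> verts G" "S = f ` T" by (auto simp: relabel_def subset_image_iff)
  then obtain v where v: "v \<in> T" "degree (induced_subgraph G T) v \<le> d"
    using assms(3) S unfolding degenerate_def by blast
  have "degree (relabel f (induced_subgraph G T)) (f v) \<le> degree (induced_subgraph G T) v"
    using simple_graph_finite_edges[OF assms(1)] inj_on_subset[OF assms(2) T(1)] v(1)
    by (intro degree_relabel_le[where A = T]) (auto simp: induced_subgraph_def)
  then show "\<exists>v\<in>S. degree (induced_subgraph (relabel f G) S) v \<le> d"
    using v unfolding T(2) induced_subgraph_relabel[OF assms(1,2) T(1)] by force
qed

lemma matching_relabel:
  assumes "simple_graph G" "inj_on f (verts G)" "matching G M"
  shows "matching (relabel f G) ((`) f ` M)"
proof -
  have "disjnt (f ` e) (f ` e')" if "e \<in> M" "e' \<in> M" "f ` e \<noteq> f ` e'" for e e'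
  proof -
    have "e \<subseteq> verts G" "e' \<subseteq> verts G"
      using assms(1,3) that by (auto simp: matching_def simple_graph_def)
    moreover have "pairwise disjnt M" "e \<noteq> e'" using assms(3) that(3) by (auto simp: matching_def)
    then have "disjnt e e'" using that(1,2) by (metis pairwiseD)
    ultimately show ?thesis using inj_on_image_Int[OF assms(2), of e e'] by (simp add: disjnt_def)
  qed
  then show ?thesis using assms(3) by (auto simp: matching_def relabel_def pairwise_def)
qed

lemma backbone_k_coloring_relabel:
  fixes f :: "'a \<Rightarrow> 'b"
  assumes "backbone_k_coloring lam k (relabel f G) (relabel f H) c"
  shows "backbone_k_coloring lam k G H (c \<circ> f)"
proof -
  have "{f u, f v} \<in> edges (relabel f X)" if "{u, v} \<in> edges X" for u v and X :: "'a ugraph"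
    using imageI[OF that, of "(`) f"] by (simp add: relabel_def)
  then show ?thesis using assms unfolding backbone_k_coloring_def backbone_coloring_def
    by (auto simp: relabel_def)
qed

lemma BBC_le: "backbone_k_coloring lam k G H c \<Longrightarrow> BBC lam G H \<le> k"
  unfolding BBC_def by (rule Least_le) blast

lemma BBC_le_relabel:
  assumes "finds_coloring_in_time p T lam k (relabel f G) (relabel f H)" "simple_graph G"
    "inj_on f (verts G)"
    and "f ` verts G = {..<n}" "spanning_subgraph H G"
  shows "BBC lam G H \<le> k"
proof -
  have "spanning_subgraph (relabel f H) (relabel f G)"
    using assms(5) by (auto simp: spanning_subgraph_def relabel_def)
  then obtain c where "backbone_k_coloring lam k (relabel f G) (relabel f H) c"
    using finds_coloring_in_time_ex_coloring[OF assms(1) simple_graph_relabel[OF assms(2,3)]] assms(4)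
    by (auto simp: relabel_def)
  then have "backbone_k_coloring lam k G H (c \<circ> f)" by (rule backbone_k_coloring_relabel)
  then show ?thesis by (rule BBC_le)
qed

lemma ex_relabeling:
  assumes "finite A"
  obtains f :: "'a \<Rightarrow> nat" where "inj_on f A" "f ` A = {..<card A}"
  using ex_bij_betw_finite_nat[OF assms] by (auto simp: bij_betw_def lessThan_atLeast0)

lemma BBC_matching_le:
  assumes "simple_graph G" "max_degree G \<le> 4" "2 \<le> lam" "matching G M"
  shows "BBC lam G (spanned_by G M) \<le> 2 * lam + 1"
proof -
  obtain f :: "'a \<Rightarrow> nat" where f: "inj_on f (verts G)" "f ` verts G = {..<card (verts G)}"
    using ex_relabeling assms(1) by (metis simple_graph_def)
  have "finds_coloring_in_time matching_program (\<lambda>n. matching_cost * (n + 1)) lam (2 * lam + 1)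
      (relabel f G) (spanned_by (relabel f G) ((`) f ` M))"
    using max_degree_relabel_le[OF assms(1) f(1)] assms
    by (intro finds_coloring_in_time_matching simple_graph_relabel matching_relabel f(1)) auto
  moreover have "spanned_by (relabel f G) ((`) f ` M) = relabel f (spanned_by G M)"
    by (simp add: relabel_def spanned_by_def)
  ultimately show ?thesis
    using BBC_le_relabel[OF _ assms(1) f spanning_subgraph_spanned_by[OF assms(4)]] by simp
qed

lemma BBC_forest_le:
  assumes "simple_graph G" "max_degree G \<le> 4" "2 \<le> lam" "spanning_subgraph H G" "degenerate 1 H"
  shows "BBC lam G H \<le> 2 * lam + 2"
proof -
  obtain f :: "'a \<Rightarrow> nat" where f: "inj_on f (verts G)" "f ` verts G = {..<card (verts G)}"
    using ex_relabeling assms(1) by (metis simple_graph_def)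
  have "inj_on f (verts H)" using f(1) assms(4) by (simp add: spanning_subgraph_def)
  then have "degenerate 1 (relabel f H)"
    using degenerate_relabel[OF spanning_subgraph_simple[OF assms(4,1)]] assms(5) by blast
  moreover have "spanning_subgraph (relabel f H) (relabel f G)"
    using assms(4) by (auto simp: spanning_subgraph_def relabel_def)
  ultimately have "finds_coloring_in_time forest_program (\<lambda>n. forest_cost * (n + 1)) lam (2 * lam + 2)
      (relabel f G) (relabel f H)"
    using max_degree_relabel_le[OF assms(1) f(1)] assms
    by (intro finds_coloring_in_time_forest simple_graph_relabel f(1)) auto
  then show ?thesis using assms(1) f assms(4) by (rule BBC_le_relabel)
qed

lemma linear_in_bigo: "(\<lambda>n. real (C * (n + 1))) \<in> O(\<lambda>n. real n)"
proof (rule bigoI)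
  have "norm (real (C * (n + 1))) \<le> real (2 * C) * norm (real n)" if "1 \<le> n" for n
    using mult_left_mono[of "real n + 1" "2 * real n" "real C"] that by (simp add: algebra_simps)
  then show "\<forall>\<^sub>F n in sequentially. norm (real (C * (n + 1))) \<le> real (2 * C) * norm (real n)"
    by (rule eventually_sequentiallyI)
qed

theorem theorem9:
  "(\<forall>(G :: 'a ugraph) (lam :: nat). simple_graph G \<and> max_degree G \<le> 4 \<and> 2 \<le> lam \<longrightarrow>
      (\<forall>M. matching G M \<longrightarrow> BBC lam G (spanned_by G M) \<le> 2 * lam + 1) \<and>
      (\<forall>H. spanning_subgraph H G \<and> degenerate 1 H \<longrightarrow> BBC lam G H \<le> 2 * lam + 2))
   \<and>
   (\<exists>(p :: com) (T :: nat \<Rightarrow> nat). (\<lambda>n. real (T n)) \<in> O(\<lambda>n. real n) \<and>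
      (\<forall>(G :: nat ugraph) (lam :: nat) M.
         simple_graph G \<and> max_degree G \<le> 4 \<and> 2 \<le> lam \<and> matching G M \<longrightarrow>
         finds_coloring_in_time p T lam (2 * lam + 1) G (spanned_by G M)))
   \<and>
   (\<exists>(p :: com) (T :: nat \<Rightarrow> nat). (\<lambda>n. real (T n)) \<in> O(\<lambda>n. real n) \<and>
      (\<forall>(G :: nat ugraph) (lam :: nat) H.
         simple_graph G \<and> max_degree G \<le> 4 \<and> 2 \<le> lam \<and> spanning_subgraph H G \<and> degenerate 1 H \<longrightarrow>
         finds_coloring_in_time p T lam (2 * lam + 2) G H))"
proof (intro conjI allI impI exI)
  fix G :: "'a ugraph" and lam :: nat and M
  assume "simple_graph G \<and> max_degree G \<le> 4 \<and> 2 \<le> lam" "matching G M"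
  then show "BBC lam G (spanned_by G M) \<le> 2 * lam + 1" by (intro BBC_matching_le) auto
next
  fix G H :: "'a ugraph" and lam :: nat
  assume "simple_graph G \<and> max_degree G \<le> 4 \<and> 2 \<le> lam" "spanning_subgraph H G \<and> degenerate 1 H"
  then show "BBC lam G H \<le> 2 * lam + 2" by (intro BBC_forest_le) auto
next
  fix G :: "nat ugraph" and lam :: nat and M
  assume "simple_graph G \<and> max_degree G \<le> 4 \<and> 2 \<le> lam \<and> matching G M"
  then show "finds_coloring_in_time matching_program (\<lambda>n. matching_cost * (n + 1)) lam (2 * lam + 1)
      G (spanned_by G M)"
    by (intro finds_coloring_in_time_matching) auto
next
  fix G H :: "nat ugraph" and lam :: nat
  assume "simple_graph G \<and> max_degree G \<le> 4 \<and> 2 \<le> lam \<and> spanning_subgraph H G \<and> degenerate 1 H"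
  then show "finds_coloring_in_time forest_program (\<lambda>n. forest_cost * (n + 1)) lam (2 * lam + 2) G H"
    by (intro finds_coloring_in_time_forest) auto
qed (rule linear_in_bigo)+

end
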